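(* Let $n \geq 2$ be an integer, let $X$ be the $n$-adic Cantor space, let $G = \mathbb{Q}_n \times_{\delta} \mathbb{Z}$, and let $\alpha$ be the partial action of $G$ on $C(X)$ induced by the partial action $\beta_{(r,k)}(x) = \frac{x}{n^k} + r$ of $G$ on $X$ (all as defined in the context). Then the partial crossed product $C(X) \times_{\alpha} G$ is isomorphic, as a $C^*$-algebra, to the Cuntz algebra $O_n$.
   Context: Fix an integer $n \ge 2$. $O_n$ is the Cuntz algebra, i.e. the universal unital $C^*$-algebra generated by $n$ isometries $S_1,\dots,S_n$ with $\sum_{i=1}^n S_iS_i^*=I$. $\mathbb{Q}_n$ denotes the additive group of $n$-adic rationals, $\mathbb{Q}_n=\{m/n^j : m\in\mathbb{Z}, j\ge 0\}$. The space $X$: the Cantor set obtained from $[0,1]$ by replacing each $n$-adic rational $r\in(0,1)$ by a pair $r^-<r^+$, with $r^-$ the immediate predecessor of $r^+$; $X$ carries the order topology. The endpoints are not doubled: $0$ is regarded as $0^+$ and $1$ as $1^-$, and $0^-$, $1^+$ do not belong to $X$. The group $G=\mathbb{Q}_n\times_\delta\mathbb{Z}$ (a discrete group): the set $\mathbb{Q}_n\times\mathbb{Z}$, formed using the action $\delta_k(r)=r/n^k$ of $\mathbb{Z}$ on $\mathbb{Q}_n$, with $$(s,j)(r,k)=\left(\frac{r}{n^j}+s,\; j+k\right),\qquad (r,k)^{-1}=(-n^k r,-k).$$ The partial action $\beta$ of $G$ on $X$: $\beta_{(r,k)}(x)=\frac{x}{n^k}+r$, with domain the set of all $x\in X$ for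 which $\frac{x}{n^k}+r\in X$. Here superscripts are preserved: for $x$ $n$-adic, $\beta_{(r,k)}(x^{\pm})=(\frac{x}{n^k}+r)^{\pm}$. Each $\beta_g$ is a homeomorphism between (possibly empty) clopen subsets $\operatorname{dom}\beta_g$ and $\operatorname{ran}\beta_g$ of $X$. The induced partial action $\alpha$ of $G$ on $C(X)$: $\alpha_g: C_0(\operatorname{dom}\beta_g)\to C_0(\operatorname{ran}\beta_g)$, $\alpha_g(f)=f\circ\beta_g^{-1}$, where for an open set $V \subseteq X$, $C_0(V)$ is the ideal of functions in $C(X)$ vanishing off $V$. The partial crossed product: for a partial action $\alpha$ of a discrete group $G$ on a $C^*$-algebra $C$ (isomorphisms $\alpha_g:\operatorname{dom}\alpha_g\to\operatorname{ran}\alpha_g$ between closed two-sided ideals of $C$, with $\operatorname{dom}\alpha_g=\operatorname{ran}\alpha_{g^{-1}}$, $\alpha_e=\mathrm{id}_C$, and $\alpha_{gh}$ extending $\alpha_g\circ\alpha_h$ on its natural domain), $C\times_\alpha G$ is the (full) $C^*$-algebra obtained as the enveloping $C^*$-algebra of the $*$-algebra of finite formal sums $\sum_g f_gU^g$ with $f_g\in\operatorname{ran}\alpha_g$, with operations determined by $$(eU^g)(fU^h)=\alpha_g(\alpha_{g^{-1}}(e)f)\,U^{gh},\qquad (fU^g)^*=\alpha_{g^{-1}}(f^* )\,U^{g^{-1}}.$$ *)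

theory Defs
  imports "HOL-Analysis.Analysis" "HOL-Algebra.Algebraic_Closure_Type"
begin

section \<open>Unital *-algebras and C*-algebras\<close>

record 'a star_algebra = "(complex, 'a) module" +
  star :: "'a \<Rightarrow> 'a"

record 'a cstar_algebra = "'a star_algebra" +
  cnorm :: "'a \<Rightarrow> real"

locale star_algebra =
  Ring.ring A + Module.module "ring_of_type_algebra :: complex ring" A
  for A :: "('a, 'm) star_algebra_scheme" (structure) +
  assumes smult_mult_left:
      "\<lbrakk>x \<in> carrier A; y \<in> carrier A\<rbrakk> \<Longrightarrow> (c \<odot> x) \<otimes> y = c \<odot> (x \<otimes> y)"
    and smult_mult_right:
      "\<lbrakk>x \<in> carrier A; y \<in> carrier A\<rbrakk> \<Longrightarrow> x \<otimes> (c \<odot> y) = c \<odot> (x \<otimes> y)"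
    and star_closed: "x \<in> carrier A \<Longrightarrow> star A x \<in> carrier A"
    and star_star: "x \<in> carrier A \<Longrightarrow> star A (star A x) = x"
    and star_add:
      "\<lbrakk>x \<in> carrier A; y \<in> carrier A\<rbrakk> \<Longrightarrow> star A (x \<oplus> y) = star A x \<oplus> star A y"
    and star_smult: "x \<in> carrier A \<Longrightarrow> star A (c \<odot> x) = cnj c \<odot> star A x"
    and star_mult:
      "\<lbrakk>x \<in> carrier A; y \<in> carrier A\<rbrakk> \<Longrightarrow> star A (x \<otimes> y) = star A y \<otimes> star A x"

text \<open>
  Nonnegativity of \<open>p\<close> and \<open>p (star A x) = p x\<close> follow from the clauses below.
\<close>

definition cstar_seminorms :: "('a, 'm) star_algebra_scheme \<Rightarrow> ('a \<Rightarrow> real) set" where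
  "cstar_seminorms A =
    {p. (\<forall>x\<in>carrier A. \<forall>y\<in>carrier A. p (x \<oplus>\<^bsub>A\<^esub> y) \<le> p x + p y) \<and>
        (\<forall>c. \<forall>x\<in>carrier A. p (c \<odot>\<^bsub>A\<^esub> x) = cmod c * p x) \<and>
        (\<forall>x\<in>carrier A. \<forall>y\<in>carrier A. p (x \<otimes>\<^bsub>A\<^esub> y) \<le> p x * p y) \<and>
        (\<forall>x\<in>carrier A. p (star A x \<otimes>\<^bsub>A\<^esub> x) = (p x)\<^sup>2)}"

definition cauchy_seqs :: "('a, 'm) ring_scheme \<Rightarrow> ('a \<Rightarrow> real) \<Rightarrow> (nat \<Rightarrow> 'a) set" where
  "cauchy_seqs A p =
    {s. range s \<subseteq> carrier A \<and> (\<forall>e>0. \<exists>N. \<forall>i\<ge>N. \<forall>j\<ge>N. p (s i \<ominus>\<^bsub>A\<^esub> s j) < e)}"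

locale cstar_algebra = star_algebra A
  for A :: "('a, 'm) cstar_algebra_scheme" (structure) +
  assumes norm_seminorm: "cnorm A \<in> cstar_seminorms A"
    and norm_definite: "\<lbrakk>x \<in> carrier A; cnorm A x = 0\<rbrakk> \<Longrightarrow> x = \<zero>"
    and complete: "s \<in> cauchy_seqs A (cnorm A) \<Longrightarrow>
      \<exists>x\<in>carrier A. (\<lambda>i. cnorm A (s i \<ominus> x)) \<longlonglongrightarrow> 0"

definition cstar_isomorphic ::
    "('a, 'm) cstar_algebra_scheme \<Rightarrow> ('b, 'k) cstar_algebra_scheme \<Rightarrow> bool" where
  "cstar_isomorphic A B \<longleftrightarrow>
    cstar_algebra A \<and> cstar_algebra B \<and>
    (\<exists>\<phi>. \<phi> \<in> ring_hom A B \<and> bij_betw \<phi> (carrier A) (carrier B) \<and>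
      (\<forall>c. \<forall>x\<in>carrier A. \<phi> (c \<odot>\<^bsub>A\<^esub> x) = c \<odot>\<^bsub>B\<^esub> \<phi> x) \<and>
      (\<forall>x\<in>carrier A. \<phi> (star A x) = star B (\<phi> x)) \<and>
      (\<forall>x\<in>carrier A. cnorm B (\<phi> x) = cnorm A x))"


section \<open>Enveloping C*-algebras and generators with relations\<close>

text \<open>
  The Hausdorff completion of \<open>A\<close> with respect to the seminorm \<open>p\<close>: Cauchy sequences
  modulo \<open>p\<close>-null sequences, with termwise operations.
\<close>

definition null_rel ::
    "('a, 'm) ring_scheme \<Rightarrow> ('a \<Rightarrow> real) \<Rightarrow> ((nat \<Rightarrow> 'a) \<times> (nat \<Rightarrow> 'a)) set" where
  "null_rel A p =
    {(s, t). s \<in> cauchy_seqs A p \<and> t \<in> cauchy_seqs A p \<and> (\<lambda>i. p (s i \<ominus>\<^bsub>A\<^esub> t i)) \<longlonglongrightarrow> 0}"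

definition completion ::
    "('a, 'm) star_algebra_scheme \<Rightarrow> ('a \<Rightarrow> real) \<Rightarrow> (nat \<Rightarrow> 'a) set cstar_algebra" where
  "completion A p =
    \<lparr> carrier = cauchy_seqs A p // null_rel A p,
      mult = (\<lambda>U V. \<Union>s\<in>U. \<Union>t\<in>V. null_rel A p `` {\<lambda>i. s i \<otimes>\<^bsub>A\<^esub> t i}),
      one = null_rel A p `` {\<lambda>i. \<one>\<^bsub>A\<^esub>},
      zero = null_rel A p `` {\<lambda>i. \<zero>\<^bsub>A\<^esub>},
      add = (\<lambda>U V. \<Union>s\<in>U. \<Union>t\<in>V. null_rel A p `` {\<lambda>i. s i \<oplus>\<^bsub>A\<^esub> t i}),
      smult = (\<lambda>c U. \<Union>s\<in>U. null_rel A p `` {\<lambda>i. c \<odot>\<^bsub>A\<^esub> s i}),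
      star = (\<lambda>U. \<Union>s\<in>U. null_rel A p `` {\<lambda>i. star A (s i)}),
      cnorm = (\<lambda>U. lim (\<lambda>i. p ((SOME s. s \<in> U) i))) \<rparr>"

text \<open>
  The universal C*-algebra of the *-algebra \<open>A\<close> subject to the relations \<open>x = 0\<close>,
  \<open>x \<in> R\<close>: the completion in the largest C*-seminorm that vanishes on \<open>R\<close>. With no
  relations this is the enveloping C*-algebra of \<open>A\<close>. Both are meaningful when the
  supremum is finite on \<open>carrier A\<close>.
\<close>

definition universal_cstar ::
    "('a, 'm) star_algebra_scheme \<Rightarrow> 'a set \<Rightarrow> (nat \<Rightarrow> 'a) set cstar_algebra" where
  "universal_cstar A R =
    completion A (\<lambda>x. SUP p \<in> {p \<in> cstar_seminorms A. \<forall>r\<in>R. p r = 0}. p x)"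

definition enveloping_cstar ::
    "('a, 'm) star_algebra_scheme \<Rightarrow> (nat \<Rightarrow> 'a) set cstar_algebra" where
  "enveloping_cstar A = universal_cstar A {}"


section \<open>The Cuntz algebra\<close>

text \<open>
  The free unital *-algebra on a set \<open>I\<close> of generators. The letter \<open>(i, False)\<close> stands for
  the generator \<open>i\<close> and \<open>(i, True)\<close> for its adjoint; an element is a finitely supported
  function from words to coefficients.
\<close>

type_synonym 'i free_star = "('i \<times> bool) list \<Rightarrow> complex"

definition word :: "('i \<times> bool) list \<Rightarrow> 'i free_star" where
  "word w = (\<lambda>v. if v = w then 1 else 0)"

definition free_star_algebra :: "'i set \<Rightarrow> 'i free_star star_algebra" where
  "free_star_algebra I =
    \<lparr> carrier = {a. finite {w. a w \<noteq> 0} \<and> {w. a w \<noteq> 0} \<subseteq> lists (I \<times> UNIV)},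
      mult = (\<lambda>a b w. \<Sum>k\<le>length w. a (take k w) * b (drop k w)),
      one = word [],
      zero = (\<lambda>w. 0),
      add = (\<lambda>a b w. a w + b w),
      smult = (\<lambda>c a w. c * a w),
      star = (\<lambda>a w. cnj (a (rev (map (\<lambda>(i, e). (i, \<not> e)) w)))) \<rparr>"

definition generator :: "'i \<Rightarrow> 'i free_star" where
  "generator i = word [(i, False)]"

definition cuntz_relations :: "nat \<Rightarrow> nat free_star set" where
  "cuntz_relations n =
    (let F = free_star_algebra {1..n}; S = generator in
      {star F (S i) \<otimes>\<^bsub>F\<^esub> S i \<ominus>\<^bsub>F\<^esub> \<one>\<^bsub>F\<^esub> | i. i \<in> {1..n}} \<union>
      {(\<Oplus>\<^bsub>F\<^esub>i\<in>{1..n}. S i \<otimes>\<^bsub>F\<^esub> star F (S i)) \<ominus>\<^bsub>F\<^esub> \<one>\<^bsub>F\<^esub>})"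

definition cuntz_algebra :: "nat \<Rightarrow> (nat \<Rightarrow> nat free_star) set cstar_algebra" where
  "cuntz_algebra n = universal_cstar (free_star_algebra {1..n}) (cuntz_relations n)"


section \<open>Partial crossed products\<close>

text \<open>
  Here \<open>J g\<close> is the range of \<open>\<alpha> g\<close>, an ideal of \<open>C\<close>, and \<open>J (inv g)\<close> is its domain. The
  formal sum of the \<open>f\<^sub>g U\<^sup>g\<close> is the finitely supported function \<open>g \<mapsto> f\<^sub>g\<close>.
\<close>

definition partial_crossed_star_algebra ::
    "('g, 'k) monoid_scheme \<Rightarrow> ('a, 'm) star_algebra_scheme \<Rightarrow> ('g \<Rightarrow> 'a set) \<Rightarrow>
     ('g \<Rightarrow> 'a \<Rightarrow> 'a) \<Rightarrow> ('g \<Rightarrow> 'a) star_algebra" where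
  "partial_crossed_star_algebra G C J \<alpha> =
    \<lparr> carrier = {a. (\<forall>g\<in>carrier G. a g \<in> J g) \<and> (\<forall>g. g \<notin> carrier G \<longrightarrow> a g = \<zero>\<^bsub>C\<^esub>) \<and>
                    finite {g. a g \<noteq> \<zero>\<^bsub>C\<^esub>}},
      mult = (\<lambda>a b k. \<Oplus>\<^bsub>C\<^esub>x \<in> {(g, h). a g \<noteq> \<zero>\<^bsub>C\<^esub> \<and> b h \<noteq> \<zero>\<^bsub>C\<^esub> \<and> g \<otimes>\<^bsub>G\<^esub> h = k}.
                case x of (g, h) \<Rightarrow> \<alpha> g (\<alpha> (inv\<^bsub>G\<^esub> g) (a g) \<otimes>\<^bsub>C\<^esub> b h)),
      one = (\<lambda>g. if g = \<one>\<^bsub>G\<^esub> then \<one>\<^bsub>C\<^esub> else \<zero>\<^bsub>C\<^esub>),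
      zero = (\<lambda>g. \<zero>\<^bsub>C\<^esub>),
      add = (\<lambda>a b g. a g \<oplus>\<^bsub>C\<^esub> b g),
      smult = (\<lambda>c a g. c \<odot>\<^bsub>C\<^esub> a g),
      star = (\<lambda>a g. if g \<in> carrier G then \<alpha> g (star C (a (inv\<^bsub>G\<^esub> g))) else \<zero>\<^bsub>C\<^esub>) \<rparr>"

definition partial_crossed_product ::
    "('g, 'k) monoid_scheme \<Rightarrow> ('a, 'm) star_algebra_scheme \<Rightarrow> ('g \<Rightarrow> 'a set) \<Rightarrow>
     ('g \<Rightarrow> 'a \<Rightarrow> 'a) \<Rightarrow> (nat \<Rightarrow> 'g \<Rightarrow> 'a) set cstar_algebra" where
  "partial_crossed_product G C J \<alpha> = enveloping_cstar (partial_crossed_star_algebra G C J \<alpha>)"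


section \<open>The algebra of continuous functions on a compact space\<close>

text \<open>Functions are normalized to be \<open>0\<close> off the space, so that equality is equality on it.\<close>

definition continuous_functions :: "'x topology \<Rightarrow> ('x \<Rightarrow> complex) cstar_algebra" where
  "continuous_functions T =
    \<lparr> carrier = {f. continuous_map T euclidean f \<and> (\<forall>x. x \<notin> topspace T \<longrightarrow> f x = 0)},
      mult = (\<lambda>f g x. f x * g x),
      one = (\<lambda>x. if x \<in> topspace T then 1 else 0),
      zero = (\<lambda>x. 0),
      add = (\<lambda>f g x. f x + g x),
      smult = (\<lambda>c f x. c * f x),
      star = (\<lambda>f x. cnj (f x)),
      cnorm = (\<lambda>f. SUP x\<in>topspace T. cmod (f x)) \<rparr>"

definition vanishing_off :: "'x topology \<Rightarrow> 'x set \<Rightarrow> ('x \<Rightarrow> complex) set" where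
  "vanishing_off T V = {f \<in> carrier (continuous_functions T). \<forall>x. x \<notin> V \<longrightarrow> f x = 0}"


section \<open>The n-adic Cantor space and the partial action on it\<close>

definition adic_rationals :: "nat \<Rightarrow> real set" where
  "adic_rationals n = {of_int m / of_nat n ^ j | m j. True}"

definition adic_group :: "nat \<Rightarrow> (real \<times> int) monoid" where
  "adic_group n =
    \<lparr> carrier = adic_rationals n \<times> UNIV,
      mult = (\<lambda>(s, j) (r, k). (r / of_nat n powi j + s, j + k)),
      one = (0, 0) \<rparr>"

lemma adic_rationals_0: "0 \<in> adic_rationals n"
proof -
  have "(0 :: real) = of_int 0 / of_nat n ^ 0"
    by simp
  then show ?thesis
    unfolding adic_rationals_def by blast
qed

lemma adic_rationals_uminus:
  assumes "r \<in> adic_rationals n"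
  shows "- r \<in> adic_rationals n"
proof -
  obtain a i where "r = of_int a / of_nat n ^ i"
    using assms unfolding adic_rationals_def by blast
  then have "- r = of_int (- a) / of_nat n ^ i"
    by simp
  then show ?thesis
    unfolding adic_rationals_def by blast
qed

lemma adic_rationals_add:
  assumes "n \<ge> 2" "r \<in> adic_rationals n" "s \<in> adic_rationals n"
  shows "r + s \<in> adic_rationals n"
proof -
  obtain a i b j where r: "r = of_int a / of_nat n ^ i" and s: "s = of_int b / of_nat n ^ j"
    using assms(2,3) unfolding adic_rationals_def by blast
  have "r + s = of_int (a * int n ^ j + b * int n ^ i) / of_nat n ^ (i + j)"
    using assms(1) by (simp add: r s power_add add_divide_distrib mult.commute)
  then show ?thesis
    unfolding adic_rationals_def by blast
qed

lemma adic_rationals_powi: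
  assumes "n \<ge> 2" "r \<in> adic_rationals n"
  shows "r / of_nat n powi k \<in> adic_rationals n"
proof -
  obtain a i where r: "r = of_int a / of_nat n ^ i"
    using assms(2) unfolding adic_rationals_def by blast
  show ?thesis
  proof (cases "k \<ge> 0")
    case True
    then have "r / of_nat n powi k = of_int a / of_nat n ^ (i + nat k)"
      by (simp add: r power_add power_int_def)
    then show ?thesis
      unfolding adic_rationals_def by blast
  next
    case False
    then have "r / of_nat n powi k = of_int (a * int n ^ nat (- k)) / of_nat n ^ i"
      by (simp add: r power_int_def field_simps)
    then show ?thesis
      unfolding adic_rationals_def by blast
  qed
qed

lemma adic_group_inv_aux:
  assumes "n \<ge> 2" "r \<in> adic_rationals n"
  shows "(- (of_nat n powi k * r), - k) \<in> carrier (adic_group n)"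
    and "(- (of_nat n powi k * r), - k) \<otimes>\<^bsub>adic_group n\<^esub> (r, k) = \<one>\<^bsub>adic_group n\<^esub>"
proof -
  have eq: "r / of_nat n powi (- k) = of_nat n powi k * r"
    by (simp add: power_int_minus divide_inverse mult.commute)
  have "- (of_nat n powi k * r) \<in> adic_rationals n"
    using adic_rationals_uminus[OF adic_rationals_powi[OF assms, of "- k"]] unfolding eq .
  then show "(- (of_nat n powi k * r), - k) \<in> carrier (adic_group n)"
    by (simp add: adic_group_def)
  show "(- (of_nat n powi k * r), - k) \<otimes>\<^bsub>adic_group n\<^esub> (r, k) = \<one>\<^bsub>adic_group n\<^esub>"
    by (simp add: adic_group_def eq)
qed

lemma adic_group_group:
  assumes "n \<ge> 2"
  shows "Group.group (adic_group n)"
proof (rule groupI)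
  fix g h assume "g \<in> carrier (adic_group n)" "h \<in> carrier (adic_group n)"
  then show "g \<otimes>\<^bsub>adic_group n\<^esub> h \<in> carrier (adic_group n)"
    using adic_rationals_add[OF assms] adic_rationals_powi[OF assms]
    by (auto simp: adic_group_def)
next
  show "\<one>\<^bsub>adic_group n\<^esub> \<in> carrier (adic_group n)"
    by (simp add: adic_group_def adic_rationals_0)
next
  fix g h k
  show "g \<otimes>\<^bsub>adic_group n\<^esub> h \<otimes>\<^bsub>adic_group n\<^esub> k = g \<otimes>\<^bsub>adic_group n\<^esub> (h \<otimes>\<^bsub>adic_group n\<^esub> k)"
    using assms
    by (auto simp: adic_group_def power_int_add add_divide_distrib mult.commute split: prod.splits)
next
  fix g assume "g \<in> carrier (adic_group n)"
  then show "\<one>\<^bsub>adic_group n\<^esub> \<otimes>\<^bsub>adic_group n\<^esub> g = g"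
    by (auto simp: adic_group_def)
next
  fix g assume g: "g \<in> carrier (adic_group n)"
  obtain r k where rk: "g = (r, k)"
    by (cases g)
  with g have "r \<in> adic_rationals n"
    by (simp add: adic_group_def)
  then show "\<exists>h\<in>carrier (adic_group n). h \<otimes>\<^bsub>adic_group n\<^esub> g = \<one>\<^bsub>adic_group n\<^esub>"
    unfolding rk using adic_group_inv_aux[OF assms] by blast
qed

lemma adic_group_inv:
  assumes "n \<ge> 2" "(r, k) \<in> carrier (adic_group n)"
  shows "inv\<^bsub>adic_group n\<^esub> (r, k) = (- (of_nat n powi k * r), - k)"
proof -
  have "r \<in> adic_rationals n"
    using assms(2) by (simp add: adic_group_def)
  then show ?thesis
    using adic_group_inv_aux[OF assms(1)] assms(2)
    by (intro group.inv_equality[OF adic_group_group[OF assms(1)]]) auto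
qed

text \<open>
  An adic rational \<open>r\<close> is represented by \<open>r\<^sup>- = (r, Below)\<close> and \<open>r\<^sup>+ = (r, Above)\<close>,
  any other real \<open>x\<close> by \<open>(x, Regular)\<close>.
\<close>

datatype side = Below | Regular | Above

type_synonym point = "real \<times> side"

definition adic_cantor_set :: "nat \<Rightarrow> point set" where
  "adic_cantor_set n =
    {(x, s). 0 \<le> x \<and> x \<le> 1 \<and>
      (if x \<in> adic_rationals n then s = Below \<and> x \<noteq> 0 \<or> s = Above \<and> x \<noteq> 1
       else s = Regular)}"

definition point_less :: "point \<Rightarrow> point \<Rightarrow> bool" where
  "point_less p q \<longleftrightarrow> fst p < fst q \<or> fst p = fst q \<and> snd p = Below \<and> snd q = Above"

definition adic_cantor_space :: "nat \<Rightarrow> point topology" where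
  "adic_cantor_space n = topology_generated_by
    ({{x \<in> adic_cantor_set n. point_less a x} | a. a \<in> adic_cantor_set n} \<union>
     {{x \<in> adic_cantor_set n. point_less x a} | a. a \<in> adic_cantor_set n})"

definition beta :: "nat \<Rightarrow> real \<times> int \<Rightarrow> point \<Rightarrow> point" where
  "beta n = (\<lambda>(r, k) (x, s). (x / of_nat n powi k + r, s))"

definition beta_dom :: "nat \<Rightarrow> real \<times> int \<Rightarrow> point set" where
  "beta_dom n g = {x \<in> adic_cantor_set n. beta n g x \<in> adic_cantor_set n}"

definition beta_ran :: "nat \<Rightarrow> real \<times> int \<Rightarrow> point set" where
  "beta_ran n g = beta n g ` beta_dom n g"

definition alpha :: "nat \<Rightarrow> real \<times> int \<Rightarrow> (point \<Rightarrow> complex) \<Rightarrow> point \<Rightarrow> complex" where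
  "alpha n g f = (\<lambda>y. if y \<in> beta_ran n g then f (inv_into (beta_dom n g) (beta n g) y) else 0)"

definition adic_crossed_product ::
    "nat \<Rightarrow> (nat \<Rightarrow> real \<times> int \<Rightarrow> point \<Rightarrow> complex) set cstar_algebra" where
  "adic_crossed_product n =
    partial_crossed_product (adic_group n) (continuous_functions (adic_cantor_space n))
      (\<lambda>g. vanishing_off (adic_cantor_space n) (beta_ran n g)) (alpha n)"

end

theory Submission
  imports Defs
begin

text \<open>
  Both algebras are completions of star-algebras for their largest C*-seminorms: the Cuntz algebra of
  the free star-algebra \<open>F\<close> on \<open>S\<^sub>1, \<dots>, S\<^sub>n\<close>, where only the C*-seminorms that vanish on the Cuntz
  relations count, and the crossed product of the algebra \<open>A\<close> of finite sums \<open>\<Sum> f\<^sub>g U\<^sup>g\<close>. The homomorphism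
  \<open>\<phi> : F \<rightarrow> A\<close> sends \<open>S\<^sub>i\<close> to the indicator function of the \<open>i\<close>-th \<open>n\<close>-adic interval of length \<open>1 / n\<close>, times
  \<open>U\<^sup>g\<close> for the group element \<open>g = ((i - 1) / n, 1)\<close> that maps the Cantor space onto this interval. A
  word \<open>\<mu>\<close> of length \<open>m\<close> goes to an interval of length \<open>1 / n ^ m\<close> in the same way, and the product
  \<open>S\<^sub>\<mu> S\<^sub>\<nu>\<^sup>*\<close> to the indicator function of the interval of \<open>\<mu>\<close> times the \<open>U\<^sup>g\<close> for which \<open>\<beta>\<^sub>g\<close> maps the
  interval of \<open>\<nu>\<close> onto that of \<open>\<mu>\<close>. The Cuntz relations hold in \<open>A\<close>, and it remains to match the
  C*-seminorms.

  The two families are compared by means of the norm \<open>\<Sum> \<parallel>f\<^sub>g\<parallel>\<close> on \<open>A\<close>, here called \<open>l1\<close>.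

  The range of \<open>\<phi>\<close> is dense for \<open>l1\<close> (\<open>\<phi>_dense\<close>), because a continuous function on the Cantor space is
  uniformly close to one that is constant on all \<open>n\<close>-adic intervals of some level.

  Every C*-seminorm of \<open>A\<close> is at most \<open>l1\<close> (\<open>seminorm_le_l1\<close>). So it is determined by its composition
  with \<open>\<phi>\<close>, which is a C*-seminorm of \<open>F\<close> that vanishes on the relations.

  Every C*-seminorm \<open>q\<close> of \<open>F\<close> that vanishes on the relations satisfies \<open>q x \<le> l1 (\<phi> x)\<close>
  (\<open>cuntz_rep_norm_le\<close>). Modulo the relations \<open>x\<close> is a linear combination of products \<open>S\<^sub>\<mu> S\<^sub>\<nu>\<^sup>*\<close> with
  \<open>\<nu>\<close> of one fixed length (\<open>common_normal_form\<close>). Those products that belong to the same group element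
  have orthogonal initial and orthogonal final projections, so their linear combination is of norm at
  most the largest modulus of the coefficients (\<open>group_norm_le\<close>), which is at most the supremum
  norm of the corresponding coefficient function of \<open>\<phi> x\<close>. By density \<open>q\<close> therefore is the composition
  of \<open>\<phi>\<close> with a C*-seminorm of \<open>A\<close> (\<open>seminorm_extension\<close>).

  It follows that the largest seminorms correspond, and that \<open>\<phi>\<close> extends to an isomorphism of the
  completions (\<open>completion_isomorphic\<close>).

  The reduction to normal forms uses \<open>S\<^sub>i\<^sup>* S\<^sub>j = 0\<close> for \<open>i \<noteq> j\<close>, which is not among the relations. In a
  C*-algebra it follows from \<open>\<Sum> S\<^sub>i S\<^sub>i\<^sup>* = 1\<close> by positivity (\<open>ranges_orthogonal\<close>).
\<close>

section \<open>Star-algebras and C*-seminorms\<close>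

locale star_alg =
  fixes A :: "('a, 'm) star_algebra_scheme" (structure)
  assumes star_algebra_A: "star_algebra A"
begin

lemma ring_A: "Ring.ring A"
  using star_algebra_A by (simp add: star_algebra_def)

lemma module_A: "Module.module (ring_of_type_algebra :: complex ring) A"
  using star_algebra_A by (simp add: star_algebra_def)

lemma scalar_ring [simp]:
  "carrier (ring_of_type_algebra :: complex ring) = UNIV"
  "(a :: complex) \<oplus>\<^bsub>ring_of_type_algebra\<^esub> b = a + b"
  "(a :: complex) \<otimes>\<^bsub>ring_of_type_algebra\<^esub> b = a * b"
  "\<one>\<^bsub>(ring_of_type_algebra :: complex ring)\<^esub> = 1"
  "\<zero>\<^bsub>(ring_of_type_algebra :: complex ring)\<^esub> = 0"
  by (simp_all add: ring_of_type_algebra_def)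

lemmas add_closed [simp, intro] = Ring.ring.ring_simprules(1)[OF ring_A]
lemmas zero_closed [simp, intro] = Ring.ring.ring_simprules(2)[OF ring_A]
lemmas neg_closed [simp, intro] = Ring.ring.ring_simprules(3)[OF ring_A]
lemmas minus_closed [simp, intro] = Ring.ring.ring_simprules(4)[OF ring_A]
lemmas mult_closed [simp, intro] = Ring.ring.ring_simprules(5)[OF ring_A]
lemmas one_closed [simp, intro] = Ring.ring.ring_simprules(6)[OF ring_A]
lemma mult_one_right [simp]: "x \<in> carrier A \<Longrightarrow> x \<otimes> \<one> = x"
  by (rule monoid.r_one[OF ring.is_monoid[OF ring_A]])

lemmas ring_rules = Ring.ring.ring_simprules(7-)[OF ring_A]

lemma star_closed [simp, intro]: "x \<in> carrier A \<Longrightarrow> star A x \<in> carrier A"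
  using star_algebra.star_closed[OF star_algebra_A] .

lemma smult_closed [simp, intro]: "x \<in> carrier A \<Longrightarrow> c \<odot> x \<in> carrier A"
  using Module.module.smult_closed[OF module_A] by simp


lemma smult_add_left: "x \<in> carrier A \<Longrightarrow> (a + b) \<odot> x = a \<odot> x \<oplus> b \<odot> x"
  using Module.module.smult_l_distr[OF module_A] by simp

lemma smult_add_right:
  "x \<in> carrier A \<Longrightarrow> y \<in> carrier A \<Longrightarrow> a \<odot> (x \<oplus> y) = a \<odot> x \<oplus> a \<odot> y"
  using Module.module.smult_r_distr[OF module_A] by simp

lemma smult_smult: "x \<in> carrier A \<Longrightarrow> a \<odot> (b \<odot> x) = (a * b) \<odot> x"
  using Module.module.smult_assoc1[OF module_A] by simp

lemma smult_1 [simp]: "x \<in> carrier A \<Longrightarrow> 1 \<odot> x = x"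
  using Module.module.smult_one[OF module_A] by simp

lemma smult_0_left [simp]: "x \<in> carrier A \<Longrightarrow> 0 \<odot> x = \<zero>"
  using Module.module.smult_l_null[OF module_A] by simp

lemma smult_0_right [simp]: "a \<odot> \<zero> = \<zero>"
  using Module.module.smult_r_null[OF module_A] by simp

lemma neg_eq: "x \<in> carrier A \<Longrightarrow> \<ominus> x = (- 1) \<odot> x"
proof (rule abelian_group.minus_equality[OF ring.is_abelian_group[OF ring_A]])
  assume x: "x \<in> carrier A"
  have "(- 1) \<odot> x \<oplus> 1 \<odot> x = (- 1 + 1) \<odot> x"
    using smult_add_left[OF x, of "- 1" 1] by (simp only:)
  then show "(- 1) \<odot> x \<oplus> x = \<zero>"
    using x by simp
qed auto

lemma minus_eq: "x \<in> carrier A \<Longrightarrow> y \<in> carrier A \<Longrightarrow> x \<ominus> y = x \<oplus> (- 1) \<odot> y"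
  by (simp add: a_minus_def neg_eq)

lemma smult_mult_left: "x \<in> carrier A \<Longrightarrow> y \<in> carrier A \<Longrightarrow> (c \<odot> x) \<otimes> y = c \<odot> (x \<otimes> y)"
  using star_algebra.smult_mult_left[OF star_algebra_A] .

lemma smult_mult_right: "x \<in> carrier A \<Longrightarrow> y \<in> carrier A \<Longrightarrow> x \<otimes> (c \<odot> y) = c \<odot> (x \<otimes> y)"
  using star_algebra.smult_mult_right[OF star_algebra_A] .

lemma null_left: "x \<in> carrier A \<Longrightarrow> \<zero> \<otimes> x = \<zero>"
  using smult_mult_left[of \<zero> x 0] by simp

lemma null_right: "x \<in> carrier A \<Longrightarrow> x \<otimes> \<zero> = \<zero>"
  using smult_mult_right[of x \<zero> 0] by simp

lemma star_star [simp]: "x \<in> carrier A \<Longrightarrow> star A (star A x) = x"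
  using star_algebra.star_star[OF star_algebra_A] .

lemma star_add: "x \<in> carrier A \<Longrightarrow> y \<in> carrier A \<Longrightarrow> star A (x \<oplus> y) = star A x \<oplus> star A y"
  using star_algebra.star_add[OF star_algebra_A] .

lemma star_smult: "x \<in> carrier A \<Longrightarrow> star A (c \<odot> x) = cnj c \<odot> star A x"
  using star_algebra.star_smult[OF star_algebra_A] .

lemma star_mult: "x \<in> carrier A \<Longrightarrow> y \<in> carrier A \<Longrightarrow> star A (x \<otimes> y) = star A y \<otimes> star A x"
  using star_algebra.star_mult[OF star_algebra_A] .

lemmas mult_simps = ring_rules smult_mult_left smult_mult_right smult_smult smult_add_right

lemma star_zero [simp]: "star A \<zero> = \<zero>"
  using star_smult[of \<zero> 0] by simp

lemma star_one [simp]: "star A \<one> = \<one>"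
  by (metis one_closed ring_rules(6) ring.ring_simprules(12) ring_A star_closed star_mult star_star)

lemma star_neg: "x \<in> carrier A \<Longrightarrow> star A (\<ominus> x) = \<ominus> star A x"
  by (simp add: neg_eq star_smult)

lemma star_minus: "x \<in> carrier A \<Longrightarrow> y \<in> carrier A \<Longrightarrow> star A (x \<ominus> y) = star A x \<ominus> star A y"
  by (simp add: a_minus_def star_add star_neg)

lemma smult_minus: "x \<in> carrier A \<Longrightarrow> y \<in> carrier A \<Longrightarrow> c \<odot> (x \<ominus> y) = c \<odot> x \<ominus> c \<odot> y"
  by (simp add: minus_eq smult_add_right smult_smult mult.commute)

lemma diff_self [simp]: "x \<in> carrier A \<Longrightarrow> x \<ominus> x = \<zero>"
  by (simp add: ring_rules)

lemma diff_split:
  "x \<in> carrier A \<Longrightarrow> y \<in> carrier A \<Longrightarrow> z \<in> carrier A \<Longrightarrow> x \<ominus> z = (x \<ominus> y) \<oplus> (y \<ominus> z)"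
  by (simp add: ring_rules)

lemma diff_add:
  assumes "x \<in> carrier A" "y \<in> carrier A" "u \<in> carrier A" "v \<in> carrier A"
  shows "(x \<oplus> u) \<ominus> (y \<oplus> v) = (x \<ominus> y) \<oplus> (u \<ominus> v)"
  using assms by (simp add: ring_rules)

lemma diff_mult:
  assumes "x \<in> carrier A" "y \<in> carrier A" "u \<in> carrier A" "v \<in> carrier A"
  shows "(x \<otimes> u) \<ominus> (y \<otimes> v) = x \<otimes> (u \<ominus> v) \<oplus> (x \<ominus> y) \<otimes> v"
  using assms by (simp add: ring_rules)

abbreviation asum where "asum f I \<equiv> finsum A f I"

lemma abelian_monoid_A: "abelian_monoid A"
  using ring_A by (simp add: Ring.ring_def abelian_group_def)

lemma sum_empty [simp]: "asum f {} = \<zero>"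
  by (rule abelian_monoid.finsum_empty[OF abelian_monoid_A])

lemma sum_closed [simp, intro]: "(\<And>i. i \<in> I \<Longrightarrow> f i \<in> carrier A) \<Longrightarrow> asum f I \<in> carrier A"
  by (rule abelian_monoid.finsum_closed[OF abelian_monoid_A]) auto

lemma sum_insert [simp]:
  "finite I \<Longrightarrow> i \<notin> I \<Longrightarrow> f i \<in> carrier A \<Longrightarrow> (\<And>j. j \<in> I \<Longrightarrow> f j \<in> carrier A) \<Longrightarrow>
   asum f (insert i I) = f i \<oplus> asum f I"
  by (rule abelian_monoid.finsum_insert[OF abelian_monoid_A]) auto

lemma sum_cong:
  "I = J \<Longrightarrow> (\<And>i. i \<in> J \<Longrightarrow> f i = g i) \<Longrightarrow> (\<And>i. i \<in> J \<Longrightarrow> g i \<in> carrier A) \<Longrightarrow>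
   asum f I = asum g J"
  by (rule abelian_monoid.finsum_cong'[OF abelian_monoid_A]) auto

lemma sum_add:
  "(\<And>i. i \<in> I \<Longrightarrow> f i \<in> carrier A) \<Longrightarrow> (\<And>i. i \<in> I \<Longrightarrow> g i \<in> carrier A) \<Longrightarrow>
   asum (\<lambda>i. f i \<oplus> g i) I = asum f I \<oplus> asum g I"
  by (rule abelian_monoid.finsum_addf[OF abelian_monoid_A]) auto

lemma sum_zero: "(\<And>i. i \<in> I \<Longrightarrow> f i = \<zero>) \<Longrightarrow> asum f I = \<zero>"
  using sum_cong[of I I f "\<lambda>_. \<zero>"] abelian_monoid.finsum_zero[OF abelian_monoid_A] by simp

lemma sum_reindex:
  "inj_on h I \<Longrightarrow> (\<And>i. i \<in> I \<Longrightarrow> f (h i) \<in> carrier A) \<Longrightarrow>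
   asum f (h ` I) = asum (\<lambda>i. f (h i)) I"
  by (rule abelian_monoid.finsum_reindex[OF abelian_monoid_A]) auto

lemma sum_bij:
  assumes "bij_betw h I J" "\<And>j. j \<in> J \<Longrightarrow> f j \<in> carrier A"
  shows "asum (\<lambda>i. f (h i)) I = asum f J"
  using sum_reindex[of h I f] assms by (auto simp: bij_betw_def)

lemma sum_Un_disjoint:
  "finite I \<Longrightarrow> finite J \<Longrightarrow> I \<inter> J = {} \<Longrightarrow> (\<And>i. i \<in> I \<union> J \<Longrightarrow> f i \<in> carrier A) \<Longrightarrow>
   asum f (I \<union> J) = asum f I \<oplus> asum f J"
  by (rule abelian_monoid.finsum_Un_disjoint[OF abelian_monoid_A]) auto

lemma sum_mono_neutral:
  assumes "finite J" "I \<subseteq> J" "\<And>i. i \<in> J - I \<Longrightarrow> f i = \<zero>" "\<And>i. i \<in> I \<Longrightarrow> f i \<in> carrier A"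
  shows "asum f J = asum f I"
proof -
  have "asum f (I \<union> (J - I)) = asum f I \<oplus> asum f (J - I)"
  proof (rule sum_Un_disjoint)
    show "f i \<in> carrier A" if "i \<in> I \<union> (J - I)" for i
      using assms(3,4) that by (cases "i \<in> I") auto
  qed (use assms in \<open>auto intro: finite_subset\<close>)
  moreover have "asum f (J - I) = \<zero>"
    using assms by (intro sum_zero) auto
  moreover have "I \<union> (J - I) = J"
    using assms by auto
  moreover have "asum f I \<in> carrier A"
    using assms by auto
  ultimately show ?thesis
    by (simp add: ring_rules)
qed

lemma sum_smult:
  assumes "finite I" "\<And>i. i \<in> I \<Longrightarrow> f i \<in> carrier A"
  shows "c \<odot> asum f I = asum (\<lambda>i. c \<odot> f i) I"
  using assms by (induction I rule: finite_induct) (auto simp: smult_add_right)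

lemma sum_mult_left:
  assumes "finite I" "\<And>i. i \<in> I \<Longrightarrow> f i \<in> carrier A" "x \<in> carrier A"
  shows "x \<otimes> asum f I = asum (\<lambda>i. x \<otimes> f i) I"
  using assms by (induction I rule: finite_induct) (auto simp: ring_rules)

lemma sum_mult_right:
  assumes "finite I" "\<And>i. i \<in> I \<Longrightarrow> f i \<in> carrier A" "x \<in> carrier A"
  shows "asum f I \<otimes> x = asum (\<lambda>i. f i \<otimes> x) I"
  using assms by (induction I rule: finite_induct) (auto simp: ring_rules)

lemma sum_star:
  assumes "finite I" "\<And>i. i \<in> I \<Longrightarrow> f i \<in> carrier A"
  shows "star A (asum f I) = asum (\<lambda>i. star A (f i)) I"
  using assms by (induction I rule: finite_induct) (auto simp: star_add)

lemma sum_delta: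
  assumes "finite I" "k \<in> I" "f k \<in> carrier A"
  shows "asum (\<lambda>i. if i = k then f i else \<zero>) I = f k"
proof -
  have "asum (\<lambda>i. if i = k then f i else \<zero>) I = asum (\<lambda>i. if i = k then f i else \<zero>) {k}"
    using assms by (intro sum_mono_neutral) auto
  also have "\<dots> = f k"
    using assms by (simp add: ring_rules)
  finally show ?thesis .
qed

lemma sum_Sigma:
  assumes "finite I" "\<And>i. i \<in> I \<Longrightarrow> finite (J i)"
    "\<And>i j. i \<in> I \<Longrightarrow> j \<in> J i \<Longrightarrow> f i j \<in> carrier A"
  shows "asum (\<lambda>i. asum (f i) (J i)) I = asum (\<lambda>(i, j). f i j) (Sigma I J)"
  using assms
proof (induction I rule: finite_induct)
  case (insert i I)
  have "Sigma (insert i I) J = Pair i ` J i \<union> Sigma I J"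
    by auto
  moreover have "asum (\<lambda>(i, j). f i j) (Pair i ` J i \<union> Sigma I J)
    = asum (\<lambda>(i, j). f i j) (Pair i ` J i) \<oplus> asum (\<lambda>(i, j). f i j) (Sigma I J)"
    using insert by (intro sum_Un_disjoint) auto
  moreover have "asum (\<lambda>(i, j). f i j) (Pair i ` J i) = asum (f i) (J i)"
    using insert by (subst sum_reindex) (auto simp: inj_on_def)
  ultimately show ?case
    using insert by (simp add: sum_insert sum_closed)
qed auto

end

text \<open>
  The module axioms hidden in \<open>star_algebra\<close> speak of the complex numbers as a ring record. Here
  that record has been unfolded, so that only operations of \<open>A\<close> remain to be checked.
\<close>

lemma star_algebraI:
  fixes A (structure)
  assumes "\<And>x y. \<lbrakk>x \<in> carrier A; y \<in> carrier A\<rbrakk> \<Longrightarrow> x \<oplus> y \<in> carrier A"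
    and "\<And>x y z. \<lbrakk>x \<in> carrier A; y \<in> carrier A; z \<in> carrier A\<rbrakk> \<Longrightarrow> (x \<oplus> y) \<oplus> z = x \<oplus> (y \<oplus> z)"
    and "\<And>x y. \<lbrakk>x \<in> carrier A; y \<in> carrier A\<rbrakk> \<Longrightarrow> x \<oplus> y = y \<oplus> x"
    and "\<zero> \<in> carrier A"
    and "\<And>x. x \<in> carrier A \<Longrightarrow> \<zero> \<oplus> x = x"
    and "\<And>x y. \<lbrakk>x \<in> carrier A; y \<in> carrier A\<rbrakk> \<Longrightarrow> x \<otimes> y \<in> carrier A"
    and "\<And>x y z. \<lbrakk>x \<in> carrier A; y \<in> carrier A; z \<in> carrier A\<rbrakk> \<Longrightarrow> (x \<otimes> y) \<otimes> z = x \<otimes> (y \<otimes> z)"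
    and "\<one> \<in> carrier A"
    and "\<And>x. x \<in> carrier A \<Longrightarrow> \<one> \<otimes> x = x"
    and "\<And>x. x \<in> carrier A \<Longrightarrow> x \<otimes> \<one> = x"
    and "\<And>x y z. \<lbrakk>x \<in> carrier A; y \<in> carrier A; z \<in> carrier A\<rbrakk> \<Longrightarrow> (x \<oplus> y) \<otimes> z = x \<otimes> z \<oplus> y \<otimes> z"
    and "\<And>x y z. \<lbrakk>x \<in> carrier A; y \<in> carrier A; z \<in> carrier A\<rbrakk> \<Longrightarrow> z \<otimes> (x \<oplus> y) = z \<otimes> x \<oplus> z \<otimes> y"
    and "\<And>c x. x \<in> carrier A \<Longrightarrow> c \<odot> x \<in> carrier A"
    and "\<And>a b x. x \<in> carrier A \<Longrightarrow> (a + b) \<odot> x = a \<odot> x \<oplus> b \<odot> x"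
    and "\<And>a x y. \<lbrakk>x \<in> carrier A; y \<in> carrier A\<rbrakk> \<Longrightarrow> a \<odot> (x \<oplus> y) = a \<odot> x \<oplus> a \<odot> y"
    and "\<And>a b x. x \<in> carrier A \<Longrightarrow> (a * b) \<odot> x = a \<odot> (b \<odot> x)"
    and "\<And>x. x \<in> carrier A \<Longrightarrow> 1 \<odot> x = x"
    and "\<And>x. x \<in> carrier A \<Longrightarrow> 0 \<odot> x = \<zero>"
    and "\<And>c x y. \<lbrakk>x \<in> carrier A; y \<in> carrier A\<rbrakk> \<Longrightarrow> (c \<odot> x) \<otimes> y = c \<odot> (x \<otimes> y)"
    and "\<And>c x y. \<lbrakk>x \<in> carrier A; y \<in> carrier A\<rbrakk> \<Longrightarrow> x \<otimes> (c \<odot> y) = c \<odot> (x \<otimes> y)"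
    and "\<And>x. x \<in> carrier A \<Longrightarrow> star A x \<in> carrier A"
    and "\<And>x. x \<in> carrier A \<Longrightarrow> star A (star A x) = x"
    and "\<And>x y. \<lbrakk>x \<in> carrier A; y \<in> carrier A\<rbrakk> \<Longrightarrow> star A (x \<oplus> y) = star A x \<oplus> star A y"
    and "\<And>c x. x \<in> carrier A \<Longrightarrow> star A (c \<odot> x) = cnj c \<odot> star A x"
    and "\<And>x y. \<lbrakk>x \<in> carrier A; y \<in> carrier A\<rbrakk> \<Longrightarrow> star A (x \<otimes> y) = star A y \<otimes> star A x"
  shows "star_algebra A"
proof -
  have inverse: "\<exists>y\<in>carrier A. y \<oplus> x = \<zero>" if "x \<in> carrier A" for x
  proof
    have "(- 1) \<odot> x \<oplus> 1 \<odot> x = (- 1 + 1) \<odot> x"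
      using assms(14)[OF that, of "- 1" 1] by (simp only:)
    then show "(- 1) \<odot> x \<oplus> x = \<zero>"
      using assms(17,18) that by simp
  qed (use assms that in auto)
  have group: "abelian_group A"
    by (rule abelian_groupI) (use assms inverse in auto)
  have ring: "Ring.ring A"
    by (rule ringI) (use assms group in \<open>auto intro: monoidI\<close>)
  have "Module.module (ring_of_type_algebra :: complex ring) A"
    by (rule moduleI)
       (use assms group in \<open>auto simp: ring_of_type_algebra_def
          intro: cring_from_type_algebra[unfolded ring_of_type_algebra_def]\<close>)
  with ring show ?thesis
    by (intro star_algebra.intro) (use assms in \<open>auto simp: star_algebra_axioms_def\<close>)
qed

locale cstar_seminormed = star_alg A
  for A :: "('a, 'm) star_algebra_scheme" (structure) +
  fixes p :: "'a \<Rightarrow> real"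
  assumes seminorm: "p \<in> cstar_seminorms A"
begin

lemma triangle: "x \<in> carrier A \<Longrightarrow> y \<in> carrier A \<Longrightarrow> p (x \<oplus> y) \<le> p x + p y"
  and homogeneous: "x \<in> carrier A \<Longrightarrow> p (c \<odot> x) = cmod c * p x"
  and submult: "x \<in> carrier A \<Longrightarrow> y \<in> carrier A \<Longrightarrow> p (x \<otimes> y) \<le> p x * p y"
  and cstar_identity: "x \<in> carrier A \<Longrightarrow> p (star A x \<otimes> x) = (p x)\<^sup>2"
  using seminorm by (auto simp: cstar_seminorms_def)

lemma seminorm_zero [simp]: "p \<zero> = 0"
  using homogeneous[of \<zero> 0] by simp

lemma seminorm_neg [simp]: "x \<in> carrier A \<Longrightarrow> p (\<ominus> x) = p x"
  by (simp add: neg_eq homogeneous)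

lemma nonneg: "x \<in> carrier A \<Longrightarrow> 0 \<le> p x"
  using triangle[of x "\<ominus> x"] by (simp add: ring_rules)

text \<open>
  By the C*-identity, \<open>p x ^ 2 = p (x\<^sup>* x) \<le> p (x\<^sup>*) * p x\<close>, so \<open>p x \<le> p (x\<^sup>*)\<close>; exchange \<open>x\<close> and \<open>x\<^sup>*\<close>.
\<close>

lemma seminorm_star [simp]:
  assumes "x \<in> carrier A"
  shows "p (star A x) = p x"
proof -
  have le: "p y \<le> p (star A y)" if y: "y \<in> carrier A" for y
  proof (cases "p y = 0")
    case False
    have "p y * p y \<le> p (star A y) * p y"
      using cstar_identity[OF y] submult[of "star A y" y] y by (simp add: power2_eq_square)
    then show ?thesis
      using False nonneg[OF y] by simp
  qed (use nonneg y in auto)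
  show ?thesis
    using le[of x] le[of "star A x"] assms by simp
qed

lemma triangle_diff: "x \<in> carrier A \<Longrightarrow> y \<in> carrier A \<Longrightarrow> p (x \<ominus> y) \<le> p x + p y"
  using triangle[of x "\<ominus> y"] by (simp add: a_minus_def)

lemma diff_commute:
  assumes "x \<in> carrier A" "y \<in> carrier A"
  shows "p (x \<ominus> y) = p (y \<ominus> x)"
proof -
  have "x \<ominus> y = \<ominus> (y \<ominus> x)"
    using assms by (simp add: ring_rules)
  then show ?thesis
    using assms by simp
qed

lemma dist_triangle:
  "x \<in> carrier A \<Longrightarrow> y \<in> carrier A \<Longrightarrow> z \<in> carrier A \<Longrightarrow> p (x \<ominus> z) \<le> p (x \<ominus> y) + p (y \<ominus> z)"
  using triangle[of "x \<ominus> y" "y \<ominus> z"] by (simp add: diff_split[of x y z])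

lemma abs_diff_le:
  assumes "x \<in> carrier A" "y \<in> carrier A"
  shows "\<bar>p x - p y\<bar> \<le> p (x \<ominus> y)"
proof -
  have *: "p u - p v \<le> p (u \<ominus> v)" if "u \<in> carrier A" "v \<in> carrier A" for u v
  proof -
    have "u = (u \<ominus> v) \<oplus> v"
      using that by (simp add: ring_rules)
    then show ?thesis
      using triangle[of "u \<ominus> v" v] that by simp
  qed
  show ?thesis
    using *[of x y] *[of y x] assms diff_commute[of x y] by linarith
qed

lemma diff_add_le:
  assumes "x \<in> carrier A" "y \<in> carrier A" "u \<in> carrier A" "v \<in> carrier A"
  shows "p ((x \<oplus> u) \<ominus> (y \<oplus> v)) \<le> p (x \<ominus> y) + p (u \<ominus> v)"
  using assms triangle[of "x \<ominus> y" "u \<ominus> v"] by (simp add: diff_add)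

lemma diff_mult_le:
  assumes "x \<in> carrier A" "y \<in> carrier A" "u \<in> carrier A" "v \<in> carrier A"
  shows "p ((x \<otimes> u) \<ominus> (y \<otimes> v)) \<le> p x * p (u \<ominus> v) + p (x \<ominus> y) * p v"
proof -
  have "p ((x \<otimes> u) \<ominus> (y \<otimes> v)) \<le> p (x \<otimes> (u \<ominus> v)) + p ((x \<ominus> y) \<otimes> v)"
    using assms triangle[of "x \<otimes> (u \<ominus> v)" "(x \<ominus> y) \<otimes> v"] by (simp add: diff_mult)
  also have "\<dots> \<le> p x * p (u \<ominus> v) + p (x \<ominus> y) * p v"
    using assms by (intro add_mono submult) auto
  finally show ?thesis .
qed

lemma diff_star: "x \<in> carrier A \<Longrightarrow> y \<in> carrier A \<Longrightarrow> p (star A x \<ominus> star A y) = p (x \<ominus> y)"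
  using seminorm_star[of "x \<ominus> y"] by (simp add: star_minus)

lemma diff_smult:
  "x \<in> carrier A \<Longrightarrow> y \<in> carrier A \<Longrightarrow> p (c \<odot> x \<ominus> c \<odot> y) = cmod c * p (x \<ominus> y)"
  using homogeneous[of "x \<ominus> y" c] by (simp add: smult_minus)

lemma projection_le_one:
  assumes "x \<in> carrier A" "star A x \<otimes> x = x"
  shows "p x \<le> 1"
proof -
  have "p x * p x = p x"
    using cstar_identity[of x] assms by (simp add: power2_eq_square)
  then show ?thesis
    by (cases "p x = 0") auto
qed

lemma one_le: "p \<one> \<le> 1"
  by (rule projection_le_one) (auto simp: ring_rules)

lemma isometry_le_one:
  assumes "x \<in> carrier A" "p (star A x \<otimes> x) \<le> 1"
  shows "p x \<le> 1"
  using cstar_identity[of x] assms by (metis abs_le_square_iff abs_of_nonneg abs_one nonneg one_power2)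

lemma sum_le:
  assumes "finite I" "\<And>i. i \<in> I \<Longrightarrow> f i \<in> carrier A"
  shows "p (asum f I) \<le> (\<Sum>i\<in>I. p (f i))"
  using assms
proof (induction I rule: finite_induct)
  case (insert i I)
  then show ?case
    using triangle[of "f i" "asum f I"] by force
qed auto

end

lemma cstar_seminormedI:
  "star_algebra A \<Longrightarrow> p \<in> cstar_seminorms A \<Longrightarrow> cstar_seminormed A p"
  by (simp add: cstar_seminormed_def cstar_seminormed_axioms_def star_alg_def)

lemma cstar_seminorms_zero: "(\<lambda>_. 0) \<in> cstar_seminorms A"
  by (simp add: cstar_seminorms_def)

text \<open>
  Each of the defining inequalities bounds a value of one member of the family by values of the
  same member, hence passes to the supremum.
\<close>

lemma cstar_seminorms_SUP:
  assumes A: "star_algebra A" and P: "P \<subseteq> cstar_seminorms A" "P \<noteq> {}"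
    and bounded: "\<And>x. x \<in> carrier A \<Longrightarrow> bdd_above ((\<lambda>p. p x) ` P)"
  shows "(\<lambda>x. SUP p\<in>P. p x) \<in> cstar_seminorms A"
proof -
  interpret A: star_alg A
    using A by (rule star_alg.intro)
  let ?s = "\<lambda>x. SUP p\<in>P. p x"
  have seminormed: "cstar_seminormed A p" if "p \<in> P" for p
    using that A P by (auto intro!: cstar_seminormedI)
  have upper: "p x \<le> ?s x" if "p \<in> P" "x \<in> carrier A" for p x
    using that by (intro cSUP_upper bounded)
  have nonneg: "0 \<le> p x" if "p \<in> P" "x \<in> carrier A" for p x
    using cstar_seminormed.nonneg[OF seminormed[OF that(1)] that(2)] .
  have sup_nonneg: "0 \<le> ?s x" if "x \<in> carrier A" for x
    using P(2) nonneg upper that by (meson equals0I order_trans)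
  have "?s (x \<oplus>\<^bsub>A\<^esub> y) \<le> ?s x + ?s y" if "x \<in> carrier A" "y \<in> carrier A" for x y
  proof (rule cSUP_least[OF P(2)])
    fix p assume p: "p \<in> P"
    have "p (x \<oplus>\<^bsub>A\<^esub> y) \<le> p x + p y"
      using cstar_seminormed.triangle[OF seminormed[OF p] that] .
    then show "p (x \<oplus>\<^bsub>A\<^esub> y) \<le> ?s x + ?s y"
      using upper[OF p that(1)] upper[OF p that(2)] by linarith
  qed
  moreover have "?s (x \<otimes>\<^bsub>A\<^esub> y) \<le> ?s x * ?s y" if "x \<in> carrier A" "y \<in> carrier A" for x y
  proof (rule cSUP_least[OF P(2)])
    fix p assume p: "p \<in> P"
    have "p (x \<otimes>\<^bsub>A\<^esub> y) \<le> p x * p y"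
      using cstar_seminormed.submult[OF seminormed[OF p] that] .
    also have "\<dots> \<le> ?s x * ?s y"
      using p that by (intro mult_mono upper nonneg sup_nonneg)
    finally show "p (x \<otimes>\<^bsub>A\<^esub> y) \<le> ?s x * ?s y" .
  qed
  moreover have "?s (c \<odot>\<^bsub>A\<^esub> x) = cmod c * ?s x" if x: "x \<in> carrier A" for c x
  proof -
    have *: "p (c \<odot>\<^bsub>A\<^esub> x) = cmod c * p x" if "p \<in> P" for p
      using cstar_seminormed.homogeneous[OF seminormed[OF that] x] .
    show ?thesis
    proof (cases "c = 0")
      case True
      show ?thesis
      proof -
        have "(\<lambda>p. p (c \<odot>\<^bsub>A\<^esub> x)) ` P = (\<lambda>p. 0) ` P"
          using * True by (intro image_cong) auto
        also have "\<dots> = {0}"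
          using P(2) by auto
        finally have "(\<lambda>p. p (c \<odot>\<^bsub>A\<^esub> x)) ` P = {0}" .
        then show ?thesis
          using True by simp
      qed
    next
      case False
      have "?s (c \<odot>\<^bsub>A\<^esub> x) \<le> cmod c * ?s x"
      proof (rule cSUP_least[OF P(2)])
        show "p (c \<odot>\<^bsub>A\<^esub> x) \<le> cmod c * ?s x" if "p \<in> P" for p
          using *[OF that] upper[OF that x] by (simp add: mult_left_mono)
      qed
      moreover have "?s x \<le> ?s (c \<odot>\<^bsub>A\<^esub> x) / cmod c"
      proof (rule cSUP_least[OF P(2)])
        fix p assume p: "p \<in> P"
        have "cmod c * p x \<le> ?s (c \<odot>\<^bsub>A\<^esub> x)"
          using upper[OF p A.smult_closed[OF x], of c] *[OF p] by simp
        then show "p x \<le> ?s (c \<odot>\<^bsub>A\<^esub> x) / cmod c"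
          using False by (simp add: field_simps)
      qed
      ultimately show ?thesis
        using False by (auto simp: field_simps)
    qed
  qed
  moreover have "?s (star A x \<otimes>\<^bsub>A\<^esub> x) = (?s x)\<^sup>2" if x: "x \<in> carrier A" for x
  proof (rule antisym)
    have *: "p (star A x \<otimes>\<^bsub>A\<^esub> x) = (p x)\<^sup>2" if "p \<in> P" for p
      using cstar_seminormed.cstar_identity[OF seminormed[OF that] x] .
    show "?s (star A x \<otimes>\<^bsub>A\<^esub> x) \<le> (?s x)\<^sup>2"
    proof (rule cSUP_least[OF P(2)])
      show "p (star A x \<otimes>\<^bsub>A\<^esub> x) \<le> (?s x)\<^sup>2" if "p \<in> P" for p
        using *[OF that] upper[OF that x] nonneg[OF that x] by (simp add: power_mono)
    qed
    have "?s x \<le> sqrt (?s (star A x \<otimes>\<^bsub>A\<^esub> x))"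
    proof (rule cSUP_least[OF P(2)])
      fix p assume p: "p \<in> P"
      have "(p x)\<^sup>2 \<le> ?s (star A x \<otimes>\<^bsub>A\<^esub> x)"
        using upper[OF p, of "star A x \<otimes>\<^bsub>A\<^esub> x"] x *[OF p] by simp
      then show "p x \<le> sqrt (?s (star A x \<otimes>\<^bsub>A\<^esub> x))"
        by (rule real_le_rsqrt)
    qed
    then show "(?s x)\<^sup>2 \<le> ?s (star A x \<otimes>\<^bsub>A\<^esub> x)"
      using sup_nonneg x by (metis A.mult_closed A.star_closed power_mono real_sqrt_pow2)
  qed
  ultimately show ?thesis
    by (auto simp: cstar_seminorms_def)
qed

section \<open>Completion with respect to a C*-seminorm\<close>

context cstar_seminormed
begin

abbreviation "cauchy \<equiv> cauchy_seqs A p"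
abbreviation "cls s \<equiv> null_rel A p `` {s}"
abbreviation "cpl \<equiv> completion A p"

lemma cauchy_carrier: "s \<in> cauchy \<Longrightarrow> s i \<in> carrier A"
  by (auto simp: cauchy_seqs_def)

lemma cauchy_const: "x \<in> carrier A \<Longrightarrow> (\<lambda>i. x) \<in> cauchy"
  by (auto simp: cauchy_seqs_def)

lemma cauchyI:
  assumes "\<And>i. s i \<in> carrier A" "\<And>e. e > 0 \<Longrightarrow> \<exists>N. \<forall>i\<ge>N. \<forall>j\<ge>N. p (s i \<ominus> s j) < e"
  shows "s \<in> cauchy"
  unfolding cauchy_seqs_def using assms by (intro CollectI conjI allI impI image_subsetI) simp_all

lemma cauchyD:
  assumes "s \<in> cauchy" "e > 0"
  shows "\<exists>N. \<forall>i\<ge>N. \<forall>j\<ge>N. p (s i \<ominus> s j) < e"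
proof -
  have "\<forall>e>0. \<exists>N. \<forall>i\<ge>N. \<forall>j\<ge>N. p (s i \<ominus> s j) < e"
    using assms(1) unfolding cauchy_seqs_def mem_Collect_eq by (rule conjunct2)
  then show ?thesis
    using assms(2) by blast
qed

lemma cauchy_norm:
  assumes "s \<in> cauchy"
  shows "Cauchy (\<lambda>i. p (s i))"
proof (rule metric_CauchyI)
  fix e :: real assume "e > 0"
  from cauchyD[OF assms this] obtain N
    where N: "\<And>i j. i \<ge> N \<Longrightarrow> j \<ge> N \<Longrightarrow> p (s i \<ominus> s j) < e"
    by blast
  show "\<exists>M. \<forall>m\<ge>M. \<forall>k\<ge>M. dist (p (s m)) (p (s k)) < e"
  proof (intro exI allI impI)
    fix i j assume "i \<ge> N" "j \<ge> N"
    then show "dist (p (s i)) (p (s j)) < e"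
      using N[of i j] abs_diff_le[OF cauchy_carrier[OF assms] cauchy_carrier[OF assms], of i j]
      by (simp add: dist_real_def)
  qed
qed

lemma cauchy_bounded:
  assumes "s \<in> cauchy"
  obtains K where "K > 0" "\<And>i. p (s i) \<le> K"
proof -
  have "Bseq (\<lambda>i. p (s i))"
    by (rule Cauchy_Bseq[OF cauchy_norm[OF assms]])
  then obtain K where "K > 0" "\<And>i. norm (p (s i)) \<le> K"
    by (auto simp: Bseq_def)
  then show ?thesis
    using that by (metis abs_ge_self order_trans real_norm_def)
qed

text \<open>
  Each algebra operation is Lipschitz on bounded sets, which is all that is needed to see that it
  takes Cauchy sequences to Cauchy sequences.
\<close>

lemma cauchy_lipschitz:
  assumes "s \<in> cauchy" "t \<in> cauchy" "\<And>i. u i \<in> carrier A" "K > 0"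
    and le: "\<And>i j. p (u i \<ominus> u j) \<le> K * (p (s i \<ominus> s j) + p (t i \<ominus> t j))"
  shows "u \<in> cauchy"
proof -
  have "\<exists>N. \<forall>i\<ge>N. \<forall>j\<ge>N. p (u i \<ominus> u j) < e" if "e > 0" for e
  proof -
    have "e / (2 * K) > 0"
      using that assms(4) by simp
    note pos = this
    obtain N where N: "\<And>i j. i \<ge> N \<Longrightarrow> j \<ge> N \<Longrightarrow> p (s i \<ominus> s j) < e / (2 * K)"
      using cauchyD[OF assms(1) pos] by blast
    obtain M where M: "\<And>i j. i \<ge> M \<Longrightarrow> j \<ge> M \<Longrightarrow> p (t i \<ominus> t j) < e / (2 * K)"
      using cauchyD[OF assms(2) pos] by blast
    have "p (u i \<ominus> u j) < e" if "i \<ge> max N M" "j \<ge> max N M" for i j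
    proof -
      have "p (s i \<ominus> s j) + p (t i \<ominus> t j) < e / (2 * K) + e / (2 * K)"
        using N[of i j] M[of i j] that by (intro add_strict_mono) auto
      then have "K * (p (s i \<ominus> s j) + p (t i \<ominus> t j)) < K * (e / K)"
        using assms(4) by (intro mult_strict_left_mono) auto
      then show ?thesis
        using le[of i j] assms(4) by simp
    qed
    then show ?thesis
      by blast
  qed
  then show ?thesis
    using assms(3) by (intro cauchyI)
qed

lemma cauchy_add:
  assumes "s \<in> cauchy" "t \<in> cauchy"
  shows "(\<lambda>i. s i \<oplus> t i) \<in> cauchy"
  by (rule cauchy_lipschitz[OF assms, where K = 1])
     (use assms cauchy_carrier in \<open>auto intro: diff_add_le\<close>)

lemma cauchy_smult:
  assumes "s \<in> cauchy"
  shows "(\<lambda>i. c \<odot> s i) \<in> cauchy"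
proof (rule cauchy_lipschitz[OF assms assms])
  show "cmod c + 1 > 0"
    by (simp add: add_nonneg_pos)
  fix i j
  have "0 \<le> p (s i \<ominus> s j)"
    using assms cauchy_carrier by (intro nonneg) auto
  then have "cmod c * p (s i \<ominus> s j) \<le> (cmod c + 1) * (p (s i \<ominus> s j) + p (s i \<ominus> s j))"
    by (intro mult_mono) auto
  then show "p (c \<odot> s i \<ominus> c \<odot> s j) \<le> (cmod c + 1) * (p (s i \<ominus> s j) + p (s i \<ominus> s j))"
    using assms cauchy_carrier by (simp add: diff_smult)
qed (use assms cauchy_carrier in auto)

lemma cauchy_star:
  assumes "s \<in> cauchy"
  shows "(\<lambda>i. star A (s i)) \<in> cauchy"
  by (rule cauchy_lipschitz[OF assms assms, where K = 1])
     (use assms cauchy_carrier nonneg in \<open>auto simp: diff_star\<close>)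

lemma cauchy_mult:
  assumes s: "s \<in> cauchy" and t: "t \<in> cauchy"
  shows "(\<lambda>i. s i \<otimes> t i) \<in> cauchy"
proof -
  obtain K where K: "K > 0" "\<And>i. p (s i) \<le> K"
    using cauchy_bounded[OF s] by blast
  obtain L where L: "L > 0" "\<And>i. p (t i) \<le> L"
    using cauchy_bounded[OF t] by blast
  show ?thesis
  proof (rule cauchy_lipschitz[OF s t])
    fix i j
    have "p (s i \<otimes> t i \<ominus> s j \<otimes> t j) \<le> p (s i) * p (t i \<ominus> t j) + p (s i \<ominus> s j) * p (t j)"
      using s t cauchy_carrier by (intro diff_mult_le) auto
    also have "\<dots> \<le> (K + L) * p (t i \<ominus> t j) + p (s i \<ominus> s j) * (K + L)"
      using K(1) L(1) K(2)[of i] L(2)[of j] s t cauchy_carrier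
      by (intro add_mono mult_mono) (auto intro!: nonneg)
    finally show "p (s i \<otimes> t i \<ominus> s j \<otimes> t j) \<le> (K + L) * (p (s i \<ominus> s j) + p (t i \<ominus> t j))"
      by (simp add: algebra_simps)
  qed (use K L s t cauchy_carrier in auto)
qed

lemma null_rel_iff:
  "(s, t) \<in> null_rel A p \<longleftrightarrow> s \<in> cauchy \<and> t \<in> cauchy \<and> (\<lambda>i. p (s i \<ominus> t i)) \<longlonglongrightarrow> 0"
  by (simp add: null_rel_def)

lemma null_squeeze:
  assumes "\<And>i. f i \<in> carrier A" "\<And>i. p (f i) \<le> g i" "g \<longlonglongrightarrow> 0"
  shows "(\<lambda>i. p (f i)) \<longlonglongrightarrow> 0"
  by (rule tendsto_sandwich[OF _ _ tendsto_const assms(3)]) (use assms nonneg in auto)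

lemma equiv_null_rel: "equiv cauchy (null_rel A p)"
proof (rule equivI)
  show "null_rel A p \<subseteq> cauchy \<times> cauchy"
    by (auto simp: null_rel_iff)
  show "refl_on cauchy (null_rel A p)"
    by (auto simp: refl_on_def null_rel_iff cauchy_carrier)
  show "sym (null_rel A p)"
  proof (rule symI)
    fix s t assume st: "(s, t) \<in> null_rel A p"
    then have "p (s i \<ominus> t i) = p (t i \<ominus> s i)" for i
      by (intro diff_commute) (auto simp: null_rel_iff cauchy_carrier)
    with st show "(t, s) \<in> null_rel A p"
      by (simp add: null_rel_iff)
  qed
  show "trans (null_rel A p)"
  proof (rule transI)
    fix s t u assume st: "(s, t) \<in> null_rel A p" and tu: "(t, u) \<in> null_rel A p"
    have "(\<lambda>i. p (s i \<ominus> u i)) \<longlonglongrightarrow> 0"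
    proof (rule null_squeeze)
      show "p (s i \<ominus> u i) \<le> p (s i \<ominus> t i) + p (t i \<ominus> u i)" for i
        using st tu by (intro dist_triangle) (auto simp: null_rel_iff cauchy_carrier)
      show "(\<lambda>i. p (s i \<ominus> t i) + p (t i \<ominus> u i)) \<longlonglongrightarrow> 0"
        using st tu by (auto simp: null_rel_iff intro: tendsto_add_zero)
    qed (use st tu in \<open>auto simp: null_rel_iff cauchy_carrier\<close>)
    then show "(s, u) \<in> null_rel A p"
      using st tu by (auto simp: null_rel_iff)
  qed
qed

lemma cls_eq_iff:
  "s \<in> cauchy \<Longrightarrow> t \<in> cauchy \<Longrightarrow> cls s = cls t \<longleftrightarrow> (\<lambda>i. p (s i \<ominus> t i)) \<longlonglongrightarrow> 0"
  using eq_equiv_class_iff[OF equiv_null_rel] by (auto simp: null_rel_iff)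

lemma cls_eqI:
  "s \<in> cauchy \<Longrightarrow> t \<in> cauchy \<Longrightarrow> (\<lambda>i. p (s i \<ominus> t i)) \<longlonglongrightarrow> 0 \<Longrightarrow> cls s = cls t"
  by (simp add: cls_eq_iff)

lemma cls_mem [simp, intro]: "s \<in> cauchy \<Longrightarrow> cls s \<in> carrier cpl"
  by (simp add: completion_def quotientI)

lemma cls_cases:
  assumes "U \<in> carrier cpl"
  obtains s where "s \<in> cauchy" "U = cls s"
  using assms by (auto simp: completion_def elim: quotientE)

lemma mem_cls: "s \<in> cauchy \<Longrightarrow> s \<in> cls s"
  using equiv_class_self[OF equiv_null_rel] .

lemma mem_clsD:
  assumes "s' \<in> cls s"
  shows "s' \<in> cauchy" "s \<in> cauchy" "(\<lambda>i. p (s' i \<ominus> s i)) \<longlonglongrightarrow> 0"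
proof -
  have "(s', s) \<in> null_rel A p"
    using assms equiv_null_rel by (auto elim: equivE symE)
  then show "s' \<in> cauchy" "s \<in> cauchy" "(\<lambda>i. p (s' i \<ominus> s i)) \<longlonglongrightarrow> 0"
    by (auto simp: null_rel_iff)
qed

text \<open>
  The operations of the completion are unions over the representatives of the argument classes;
  they are evaluated by showing that all representatives contribute the same class.
\<close>

lemma UN_const: "U \<noteq> {} \<Longrightarrow> (\<And>s. s \<in> U \<Longrightarrow> f s = c) \<Longrightarrow> (\<Union>s\<in>U. f s) = c"
  by auto

lemma comp_add:
  assumes "s \<in> cauchy" "t \<in> cauchy"
  shows "cls s \<oplus>\<^bsub>cpl\<^esub> cls t = cls (\<lambda>i. s i \<oplus> t i)"
proof -
  have *: "cls (\<lambda>i. s' i \<oplus> t' i) = cls (\<lambda>i. s i \<oplus> t i)" if "s' \<in> cls s" "t' \<in> cls t" for s' t'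
  proof (rule cls_eqI)
    note m = mem_clsD[OF that(1)] mem_clsD[OF that(2)]
    show "(\<lambda>i. s' i \<oplus> t' i) \<in> cauchy" "(\<lambda>i. s i \<oplus> t i) \<in> cauchy"
      using m by (auto intro: cauchy_add)
    show "(\<lambda>i. p (s' i \<oplus> t' i \<ominus> (s i \<oplus> t i))) \<longlonglongrightarrow> 0"
      by (rule null_squeeze[OF _ _ tendsto_add_zero[OF m(3) m(6)]])
         (use m cauchy_carrier in \<open>auto intro!: diff_add_le\<close>)
  qed
  have "cls s \<oplus>\<^bsub>cpl\<^esub> cls t = (\<Union>s'\<in>cls s. \<Union>t'\<in>cls t. cls (\<lambda>i. s' i \<oplus> t' i))"
    by (simp add: completion_def)
  also have "\<dots> = cls (\<lambda>i. s i \<oplus> t i)"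
    using assms mem_cls * by (intro UN_const) blast+
  finally show ?thesis .
qed

lemma comp_mult:
  assumes "s \<in> cauchy" "t \<in> cauchy"
  shows "cls s \<otimes>\<^bsub>cpl\<^esub> cls t = cls (\<lambda>i. s i \<otimes> t i)"
proof -
  have *: "cls (\<lambda>i. s' i \<otimes> t' i) = cls (\<lambda>i. s i \<otimes> t i)" if "s' \<in> cls s" "t' \<in> cls t" for s' t'
  proof (rule cls_eqI)
    note m = mem_clsD[OF that(1)] mem_clsD[OF that(2)]
    show "(\<lambda>i. s' i \<otimes> t' i) \<in> cauchy" "(\<lambda>i. s i \<otimes> t i) \<in> cauchy"
      using m by (auto intro: cauchy_mult)
    obtain K where K: "\<And>i. p (s' i) \<le> K"
      using cauchy_bounded[OF m(1)] by blast
    obtain L where L: "\<And>i. p (t i) \<le> L"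
      using cauchy_bounded[OF m(5)] by blast
    show "(\<lambda>i. p (s' i \<otimes> t' i \<ominus> s i \<otimes> t i)) \<longlonglongrightarrow> 0"
    proof (rule null_squeeze)
      show "(\<lambda>i. K * p (t' i \<ominus> t i) + p (s' i \<ominus> s i) * L) \<longlonglongrightarrow> 0"
        by (intro tendsto_add_zero tendsto_mult_right_zero tendsto_mult_left_zero m)
      fix i
      have "p (s' i \<otimes> t' i \<ominus> s i \<otimes> t i)
          \<le> p (s' i) * p (t' i \<ominus> t i) + p (s' i \<ominus> s i) * p (t i)"
        using m cauchy_carrier by (intro diff_mult_le) auto
      also have "\<dots> \<le> K * p (t' i \<ominus> t i) + p (s' i \<ominus> s i) * L"
        using K[of i] L[of i] m cauchy_carrier
        by (intro add_mono mult_left_mono mult_right_mono) (auto intro!: nonneg)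
      finally show "p (s' i \<otimes> t' i \<ominus> s i \<otimes> t i) \<le> K * p (t' i \<ominus> t i) + p (s' i \<ominus> s i) * L" .
    qed (use m cauchy_carrier in auto)
  qed
  have "cls s \<otimes>\<^bsub>cpl\<^esub> cls t = (\<Union>s'\<in>cls s. \<Union>t'\<in>cls t. cls (\<lambda>i. s' i \<otimes> t' i))"
    by (simp add: completion_def)
  also have "\<dots> = cls (\<lambda>i. s i \<otimes> t i)"
    using assms mem_cls * by (intro UN_const) blast+
  finally show ?thesis .
qed

lemma comp_smult:
  assumes "s \<in> cauchy"
  shows "c \<odot>\<^bsub>cpl\<^esub> cls s = cls (\<lambda>i. c \<odot> s i)"
proof -
  have *: "cls (\<lambda>i. c \<odot> s' i) = cls (\<lambda>i. c \<odot> s i)" if "s' \<in> cls s" for s'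
    using mem_clsD[OF that] cauchy_carrier
    by (intro cls_eqI cauchy_smult) (auto simp: diff_smult intro!: tendsto_mult_right_zero)
  have "c \<odot>\<^bsub>cpl\<^esub> cls s = (\<Union>s'\<in>cls s. cls (\<lambda>i. c \<odot> s' i))"
    by (simp add: completion_def)
  also have "\<dots> = cls (\<lambda>i. c \<odot> s i)"
    using assms mem_cls * by (intro UN_const) blast+
  finally show ?thesis .
qed

lemma comp_star:
  assumes "s \<in> cauchy"
  shows "star cpl (cls s) = cls (\<lambda>i. star A (s i))"
proof -
  have *: "cls (\<lambda>i. star A (s' i)) = cls (\<lambda>i. star A (s i))" if "s' \<in> cls s" for s'
    using mem_clsD[OF that] cauchy_carrier
    by (intro cls_eqI cauchy_star) (auto simp: diff_star)
  have "star cpl (cls s) = (\<Union>s'\<in>cls s. cls (\<lambda>i. star A (s' i)))"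
    by (simp add: completion_def)
  also have "\<dots> = cls (\<lambda>i. star A (s i))"
    using assms mem_cls * by (intro UN_const) blast+
  finally show ?thesis .
qed

lemma comp_one: "\<one>\<^bsub>cpl\<^esub> = cls (\<lambda>i. \<one>)"
  and comp_zero: "\<zero>\<^bsub>cpl\<^esub> = cls (\<lambda>i. \<zero>)"
  by (simp_all add: completion_def)

lemma comp_norm:
  assumes "s \<in> cauchy"
  shows "(\<lambda>i. p (s i)) \<longlonglongrightarrow> cnorm cpl (cls s)"
proof -
  define s' where "s' = (SOME t. t \<in> cls s)"
  have s': "s' \<in> cls s"
    unfolding s'_def by (rule someI[of _ s]) (rule mem_cls[OF assms])
  note m = mem_clsD[OF s']
  have "convergent (\<lambda>i. p (s' i))"
    using cauchy_norm[OF m(1)] by (simp add: Cauchy_convergent_iff)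
  then have lim: "(\<lambda>i. p (s' i)) \<longlonglongrightarrow> cnorm cpl (cls s)"
    by (simp add: completion_def s'_def convergent_LIMSEQ_iff)
  have "(\<lambda>i. p (s i) - p (s' i)) \<longlonglongrightarrow> 0"
  proof (rule Lim_null_comparison[OF _ m(3)])
    show "\<forall>\<^sub>F i in sequentially. norm (p (s i) - p (s' i)) \<le> p (s' i \<ominus> s i)"
      using abs_diff_le[OF cauchy_carrier[OF m(1)] cauchy_carrier[OF m(2)]]
      by (intro always_eventually) (simp add: abs_minus_commute)
  qed
  from tendsto_add[OF this lim] show ?thesis
    by simp
qed

lemma comp_star_algebra: "star_algebra cpl"
proof (rule star_algebraI)
  show "\<zero>\<^bsub>cpl\<^esub> \<in> carrier cpl" "\<one>\<^bsub>cpl\<^esub> \<in> carrier cpl"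
    by (auto simp: comp_zero comp_one intro: cauchy_const)
qed (auto elim!: cls_cases simp: comp_add comp_mult comp_smult comp_star comp_zero comp_one
       cauchy_add cauchy_mult cauchy_smult cauchy_star cauchy_const cauchy_carrier
       mult_simps smult_add_left star_add star_smult star_mult)

lemma comp_alg: "star_alg cpl"
  by (rule star_alg.intro[OF comp_star_algebra])

lemma comp_neg:
  assumes "s \<in> cauchy"
  shows "\<ominus>\<^bsub>cpl\<^esub> cls s = cls (\<lambda>i. \<ominus> s i)"
proof -
  have "\<ominus>\<^bsub>cpl\<^esub> cls s = cls (\<lambda>i. (- 1) \<odot> s i)"
    using assms by (simp add: star_alg.neg_eq[OF comp_alg] comp_smult)
  also have "(\<lambda>i. (- 1) \<odot> s i) = (\<lambda>i. \<ominus> s i)"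
    using assms by (simp add: neg_eq cauchy_carrier)
  finally show ?thesis .
qed

lemma cauchy_neg: "s \<in> cauchy \<Longrightarrow> (\<lambda>i. \<ominus> s i) \<in> cauchy"
  using cauchy_smult[of s "- 1"] by (simp add: neg_eq cauchy_carrier)

lemma cauchy_diff: "s \<in> cauchy \<Longrightarrow> t \<in> cauchy \<Longrightarrow> (\<lambda>i. s i \<ominus> t i) \<in> cauchy"
  using cauchy_add[OF _ cauchy_neg] by (simp add: a_minus_def)

lemma comp_diff:
  assumes "s \<in> cauchy" "t \<in> cauchy"
  shows "cls s \<ominus>\<^bsub>cpl\<^esub> cls t = cls (\<lambda>i. s i \<ominus> t i)"
  using assms by (simp add: a_minus_def comp_neg comp_add cauchy_neg)

lemma comp_norm_eq: "s \<in> cauchy \<Longrightarrow> (\<lambda>i. p (s i)) \<longlonglongrightarrow> l \<Longrightarrow> cnorm cpl (cls s) = l"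
  using LIMSEQ_unique comp_norm by blast

lemma comp_norm_const: "x \<in> carrier A \<Longrightarrow> cnorm cpl (cls (\<lambda>_. x)) = p x"
  by (rule comp_norm_eq) (auto intro: cauchy_const)

lemma comp_seminorm: "cnorm cpl \<in> cstar_seminorms cpl"
proof -
  have "cnorm cpl (U \<oplus>\<^bsub>cpl\<^esub> V) \<le> cnorm cpl U + cnorm cpl V"
    if U: "U \<in> carrier cpl" and V: "V \<in> carrier cpl" for U V
  proof -
    obtain s t where s: "s \<in> cauchy" "U = cls s" and t: "t \<in> cauchy" "V = cls t"
      using U V by (elim cls_cases)
    show ?thesis
      unfolding s t comp_add[OF s(1) t(1)]
      by (rule LIMSEQ_le[OF comp_norm[OF cauchy_add[OF s(1) t(1)]] tendsto_add[OF comp_norm[OF s(1)] comp_norm[OF t(1)]]])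
         (use s t in \<open>auto intro: triangle cauchy_carrier\<close>)
  qed
  moreover have "cnorm cpl (U \<otimes>\<^bsub>cpl\<^esub> V) \<le> cnorm cpl U * cnorm cpl V"
    if U: "U \<in> carrier cpl" and V: "V \<in> carrier cpl" for U V
  proof -
    obtain s t where s: "s \<in> cauchy" "U = cls s" and t: "t \<in> cauchy" "V = cls t"
      using U V by (elim cls_cases)
    show ?thesis
      unfolding s t comp_mult[OF s(1) t(1)]
      by (rule LIMSEQ_le[OF comp_norm[OF cauchy_mult[OF s(1) t(1)]] tendsto_mult[OF comp_norm[OF s(1)] comp_norm[OF t(1)]]])
         (use s t in \<open>auto intro: submult cauchy_carrier\<close>)
  qed
  moreover have "cnorm cpl (c \<odot>\<^bsub>cpl\<^esub> U) = cmod c * cnorm cpl U" if U: "U \<in> carrier cpl" for c U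
  proof -
    obtain s where s: "s \<in> cauchy" "U = cls s"
      using U by (elim cls_cases)
    show ?thesis
      unfolding s comp_smult[OF s(1)]
      by (rule comp_norm_eq[OF cauchy_smult[OF s(1)]])
         (use s tendsto_mult_left[OF comp_norm[OF s(1)], of "cmod c"] in \<open>simp add: homogeneous cauchy_carrier\<close>)
  qed
  moreover have "cnorm cpl (star cpl U \<otimes>\<^bsub>cpl\<^esub> U) = (cnorm cpl U)\<^sup>2" if U: "U \<in> carrier cpl" for U
  proof -
    obtain s where s: "s \<in> cauchy" "U = cls s"
      using U by (elim cls_cases)
    show ?thesis
      unfolding s comp_star[OF s(1)] comp_mult[OF cauchy_star[OF s(1)] s(1)]
      by (rule comp_norm_eq[OF cauchy_mult[OF cauchy_star[OF s(1)] s(1)]])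
         (use s tendsto_power[OF comp_norm[OF s(1)], of 2] in \<open>simp add: cstar_identity cauchy_carrier\<close>)
  qed
  ultimately show ?thesis
    by (simp add: cstar_seminorms_def)
qed

lemma comp_definite:
  assumes U: "U \<in> carrier cpl" and zero: "cnorm cpl U = 0"
  shows "U = \<zero>\<^bsub>cpl\<^esub>"
proof -
  obtain s where s: "s \<in> cauchy" "U = cls s"
    using U by (elim cls_cases)
  have "s i \<ominus> \<zero> = s i" for i
    using s(1) cauchy_carrier by (simp add: ring_rules)
  then show ?thesis
    unfolding s comp_zero
    using s comp_norm[OF s(1)] zero by (intro cls_eqI) (auto intro: cauchy_const)
qed

text \<open>
  A diagonal argument: from the \<open>i\<close>-th class pick a representative and in it a term beyond which
  the representative moves by less than \<open>1 / (i + 1)\<close>.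
\<close>

lemma comp_complete:
  assumes S: "S \<in> cauchy_seqs cpl (cnorm cpl)"
  shows "\<exists>U\<in>carrier cpl. (\<lambda>i. cnorm cpl (S i \<ominus>\<^bsub>cpl\<^esub> U)) \<longlonglongrightarrow> 0"
proof -
  have C: "cstar_seminormed cpl (cnorm cpl)"
    by (rule cstar_seminormedI[OF comp_star_algebra comp_seminorm])
  have Sc: "S i \<in> carrier cpl" for i
    by (rule cstar_seminormed.cauchy_carrier[OF C S])
  have "\<exists>r. r \<in> cauchy \<and> S i = cls r" for i
    using cls_cases[OF Sc[of i]] by blast
  then have "\<exists>r. \<forall>i. r i \<in> cauchy \<and> S i = cls (r i)"
    by (intro choice allI)
  then obtain r where r: "\<And>i. r i \<in> cauchy" "\<And>i. S i = cls (r i)"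
    by blast
  have "\<exists>N. \<forall>j\<ge>N. \<forall>k\<ge>N. p (r i j \<ominus> r i k) < inverse (real (Suc i))" for i
  proof -
    have "inverse (real (Suc i)) > 0"
      by simp
    then show ?thesis
      by (rule cauchyD[OF r(1)])
  qed
  then have "\<exists>N. \<forall>i. \<forall>j\<ge>N i. \<forall>k\<ge>N i. p (r i j \<ominus> r i k) < inverse (real (Suc i))"
    by (intro choice allI)
  then obtain N where N: "\<And>i j k. j \<ge> N i \<Longrightarrow> k \<ge> N i \<Longrightarrow> p (r i j \<ominus> r i k) < inverse (real (Suc i))"
    by blast
  define x where "x i = r i (N i)" for i
  have xc: "x i \<in> carrier A" for i
    using r cauchy_carrier by (simp add: x_def)
  have close: "cnorm cpl (S i \<ominus>\<^bsub>cpl\<^esub> cls (\<lambda>_. x i)) \<le> inverse (real (Suc i))" for i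
  proof -
    have "(\<lambda>k. p (r i k \<ominus> x i)) \<longlonglongrightarrow> cnorm cpl (S i \<ominus>\<^bsub>cpl\<^esub> cls (\<lambda>_. x i))"
      unfolding r(2) using r(1) xc comp_norm[OF cauchy_diff[OF r(1) cauchy_const[OF xc]]]
      by (simp add: comp_diff cauchy_const)
    then show ?thesis
      by (rule LIMSEQ_le_const2) (use N in \<open>auto simp: x_def intro!: exI[of _ "N i"] less_imp_le\<close>)
  qed
  have null: "(\<lambda>i. inverse (real (Suc i))) \<longlonglongrightarrow> 0"
    by (rule LIMSEQ_inverse_real_of_nat)
  have x: "x \<in> cauchy"
  proof -
    have "\<exists>M. \<forall>i\<ge>M. \<forall>j\<ge>M. p (x i \<ominus> x j) < e" if e: "e > 0" for e
    proof -
      have "e / 3 > 0"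
        using e by simp
      then obtain K where K: "\<And>i j. i \<ge> K \<Longrightarrow> j \<ge> K \<Longrightarrow> cnorm cpl (S i \<ominus>\<^bsub>cpl\<^esub> S j) < e / 3"
        using cstar_seminormed.cauchyD[OF C S \<open>e / 3 > 0\<close>] by blast
      obtain L where L: "\<And>i. i \<ge> L \<Longrightarrow> inverse (real (Suc i)) < e / 3"
        using order_tendstoD(2)[OF null \<open>e / 3 > 0\<close>] by (auto simp: eventually_sequentially)
      have "p (x i \<ominus> x j) < e" if "i \<ge> max K L" "j \<ge> max K L" for i j
      proof -
        let ?c = "\<lambda>i. cls (\<lambda>_. x i)"
        have c: "?c i \<in> carrier cpl" for i
          using xc cauchy_const by auto
        have "p (x i \<ominus> x j) = cnorm cpl (?c i \<ominus>\<^bsub>cpl\<^esub> ?c j)"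
          using xc by (simp add: comp_diff cauchy_const comp_norm_const)
        also have "\<dots> \<le> cnorm cpl (?c i \<ominus>\<^bsub>cpl\<^esub> S i) + cnorm cpl (S i \<ominus>\<^bsub>cpl\<^esub> ?c j)"
          using c Sc by (intro cstar_seminormed.dist_triangle[OF C])
        also have "\<dots> \<le> cnorm cpl (?c i \<ominus>\<^bsub>cpl\<^esub> S i)
            + (cnorm cpl (S i \<ominus>\<^bsub>cpl\<^esub> S j) + cnorm cpl (S j \<ominus>\<^bsub>cpl\<^esub> ?c j))"
          using c Sc by (intro add_left_mono cstar_seminormed.dist_triangle[OF C])
        also have "\<dots> < e"
          using K[of i j] L[of i] L[of j] close[of i] close[of j] that cstar_seminormed.diff_commute[OF C c[of i] Sc[of i]]
          by simp
        finally show ?thesis .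
      qed
      then show ?thesis
        by blast
    qed
    then show ?thesis
      using xc by (intro cauchyI)
  qed
  have conv: "(\<lambda>i. cnorm cpl (cls (\<lambda>_. x i) \<ominus>\<^bsub>cpl\<^esub> cls x)) \<longlonglongrightarrow> 0"
  proof (rule LIMSEQ_I)
    fix e :: real assume "e > 0"
    then have "e / 2 > 0"
      by simp
    from cauchyD[OF x this] obtain M where M: "\<And>i j. i \<ge> M \<Longrightarrow> j \<ge> M \<Longrightarrow> p (x i \<ominus> x j) < e / 2"
      by blast
    have "cnorm cpl (cls (\<lambda>_. x i) \<ominus>\<^bsub>cpl\<^esub> cls x) \<le> e / 2" if "i \<ge> M" for i
    proof -
      have "(\<lambda>k. p (x i \<ominus> x k)) \<longlonglongrightarrow> cnorm cpl (cls (\<lambda>_. x i) \<ominus>\<^bsub>cpl\<^esub> cls x)"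
        using comp_norm[OF cauchy_diff[OF cauchy_const[OF xc] x]] x xc
        by (simp add: comp_diff cauchy_const)
      then show ?thesis
        by (rule LIMSEQ_le_const2) (use M that in \<open>auto intro!: exI[of _ M] less_imp_le\<close>)
    qed
    moreover have "0 \<le> cnorm cpl (cls (\<lambda>_. x i) \<ominus>\<^bsub>cpl\<^esub> cls x)" for i
      using x xc cauchy_const by (intro cstar_seminormed.nonneg[OF C] star_alg.minus_closed[OF comp_alg] cls_mem) auto
    ultimately show "\<exists>no. \<forall>i\<ge>no. norm (cnorm cpl (cls (\<lambda>_. x i) \<ominus>\<^bsub>cpl\<^esub> cls x) - 0) < e"
      using \<open>e > 0\<close> by (intro exI[of _ M]) (force intro: le_less_trans)
  qed
  have "(\<lambda>i. cnorm cpl (S i \<ominus>\<^bsub>cpl\<^esub> cls x)) \<longlonglongrightarrow> 0"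
  proof (rule cstar_seminormed.null_squeeze[OF C])
    show "(\<lambda>i. inverse (real (Suc i)) + cnorm cpl (cls (\<lambda>_. x i) \<ominus>\<^bsub>cpl\<^esub> cls x)) \<longlonglongrightarrow> 0"
      by (rule tendsto_add_zero[OF null conv])
    fix i
    have "cnorm cpl (S i \<ominus>\<^bsub>cpl\<^esub> cls x)
        \<le> cnorm cpl (S i \<ominus>\<^bsub>cpl\<^esub> cls (\<lambda>_. x i)) + cnorm cpl (cls (\<lambda>_. x i) \<ominus>\<^bsub>cpl\<^esub> cls x)"
      using Sc x xc cauchy_const by (intro cstar_seminormed.dist_triangle[OF C]) auto
    then show "cnorm cpl (S i \<ominus>\<^bsub>cpl\<^esub> cls x)
        \<le> inverse (real (Suc i)) + cnorm cpl (cls (\<lambda>_. x i) \<ominus>\<^bsub>cpl\<^esub> cls x)"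
      using close[of i] by simp
  qed (use Sc x star_alg.minus_closed[OF comp_alg] in auto)
  then show ?thesis
    using x by blast
qed

lemma comp_cstar_algebra: "cstar_algebra cpl"
  using comp_star_algebra comp_seminorm comp_definite comp_complete
  by (intro cstar_algebra.intro cstar_algebra_axioms.intro) auto

end

section \<open>Maps with dense range\<close>

locale star_hom = B: star_alg B + A: star_alg A
  for B :: "('b, 'k) star_algebra_scheme" and A :: "('a, 'm) star_algebra_scheme" +
  fixes \<phi> :: "'b \<Rightarrow> 'a"
  assumes ring_hom: "\<phi> \<in> ring_hom B A"
    and hom_smult: "x \<in> carrier B \<Longrightarrow> \<phi> (c \<odot>\<^bsub>B\<^esub> x) = c \<odot>\<^bsub>A\<^esub> \<phi> x"
    and hom_star: "x \<in> carrier B \<Longrightarrow> \<phi> (star B x) = star A (\<phi> x)"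
begin

lemma hom_closed [simp, intro]: "x \<in> carrier B \<Longrightarrow> \<phi> x \<in> carrier A"
  and hom_mult: "x \<in> carrier B \<Longrightarrow> y \<in> carrier B \<Longrightarrow> \<phi> (x \<otimes>\<^bsub>B\<^esub> y) = \<phi> x \<otimes>\<^bsub>A\<^esub> \<phi> y"
  and hom_add: "x \<in> carrier B \<Longrightarrow> y \<in> carrier B \<Longrightarrow> \<phi> (x \<oplus>\<^bsub>B\<^esub> y) = \<phi> x \<oplus>\<^bsub>A\<^esub> \<phi> y"
  and hom_one: "\<phi> \<one>\<^bsub>B\<^esub> = \<one>\<^bsub>A\<^esub>"
  using ring_hom_memE[OF ring_hom] by simp_all

lemma hom_zero: "\<phi> \<zero>\<^bsub>B\<^esub> = \<zero>\<^bsub>A\<^esub>"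
  using hom_smult[of "\<zero>\<^bsub>B\<^esub>" 0] by simp

lemma hom_neg: "x \<in> carrier B \<Longrightarrow> \<phi> (\<ominus>\<^bsub>B\<^esub> x) = \<ominus>\<^bsub>A\<^esub> \<phi> x"
  by (simp add: B.neg_eq A.neg_eq hom_smult)

lemma hom_diff: "x \<in> carrier B \<Longrightarrow> y \<in> carrier B \<Longrightarrow> \<phi> (x \<ominus>\<^bsub>B\<^esub> y) = \<phi> x \<ominus>\<^bsub>A\<^esub> \<phi> y"
  by (simp add: a_minus_def hom_neg hom_add)

lemma hom_sum:
  assumes "finite I" "\<And>i. i \<in> I \<Longrightarrow> f i \<in> carrier B"
  shows "\<phi> (finsum B f I) = finsum A (\<lambda>i. \<phi> (f i)) I"
  using assms by (induction I rule: finite_induct) (simp_all add: hom_zero hom_add)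

lemma pullback_seminorm: "p \<in> cstar_seminorms A \<Longrightarrow> (\<lambda>x. p (\<phi> x)) \<in> cstar_seminorms B"
  by (simp add: cstar_seminorms_def hom_add hom_mult hom_smult hom_star)

end

lemma star_homI:
  assumes "star_algebra B" "star_algebra A" "\<phi> \<in> ring_hom B A"
    and "\<And>x c. x \<in> carrier B \<Longrightarrow> \<phi> (c \<odot>\<^bsub>B\<^esub> x) = c \<odot>\<^bsub>A\<^esub> \<phi> x"
    and "\<And>x. x \<in> carrier B \<Longrightarrow> \<phi> (star B x) = star A (\<phi> x)"
  shows "star_hom B A \<phi>"
  using assms by (intro star_hom.intro star_alg.intro star_hom_axioms.intro)

lemma (in cstar_seminormed) comp_embedding: "star_hom A cpl (\<lambda>x. cls (\<lambda>_. x))"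
  by (rule star_homI[OF star_algebra_A comp_star_algebra])
     (auto intro!: ring_hom_memI cauchy_const simp: comp_add comp_mult comp_smult comp_star comp_one cauchy_const)

text \<open>
  A homomorphism that preserves the seminorms and has dense range extends to the completions, and
  the extension is onto because a Cauchy sequence may be replaced by an equivalent one in the range.
\<close>

lemma completion_isomorphic:
  assumes hom: "star_hom B A \<phi>"
    and p: "p \<in> cstar_seminorms A" and q: "q \<in> cstar_seminorms B"
    and q_eq: "\<And>x. x \<in> carrier B \<Longrightarrow> q x = p (\<phi> x)"
    and dense: "\<And>a e. a \<in> carrier A \<Longrightarrow> e > 0 \<Longrightarrow> \<exists>x\<in>carrier B. p (\<phi> x \<ominus>\<^bsub>A\<^esub> a) < e"
  shows "cstar_isomorphic (completion A p) (completion B q)"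
proof -
  interpret star_hom B A \<phi>
    by (rule hom)
  interpret P: cstar_seminormed A p
    by (rule cstar_seminormedI[OF A.star_algebra_A p])
  interpret Q: cstar_seminormed B q
    by (rule cstar_seminormedI[OF B.star_algebra_A q])
  have push: "(\<lambda>i. \<phi> (s i)) \<in> P.cauchy" if "s \<in> Q.cauchy" for s
  proof (rule P.cauchyI)
    fix e :: real assume "e > 0"
    from Q.cauchyD[OF that this] show "\<exists>N. \<forall>i\<ge>N. \<forall>j\<ge>N. p (\<phi> (s i) \<ominus>\<^bsub>A\<^esub> \<phi> (s j)) < e"
      using Q.cauchy_carrier[OF that] by (simp add: hom_diff q_eq)
  qed (use Q.cauchy_carrier[OF that] in auto)
  have eq: "P.cls (\<lambda>i. \<phi> (s i)) = P.cls (\<lambda>i. \<phi> (t i)) \<longleftrightarrow> Q.cls s = Q.cls t"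
    if "s \<in> Q.cauchy" "t \<in> Q.cauchy" for s t
    using that push Q.cauchy_carrier by (simp add: P.cls_eq_iff Q.cls_eq_iff hom_diff q_eq)
  have lift: "\<exists>s\<in>Q.cauchy. U = P.cls (\<lambda>i. \<phi> (s i))" if U: "U \<in> carrier P.cpl" for U
  proof -
    obtain t where t: "t \<in> P.cauchy" "U = P.cls t"
      using U by (rule P.cls_cases)
    have tc: "t i \<in> carrier A" for i
      by (rule P.cauchy_carrier[OF t(1)])
    have "\<exists>x\<in>carrier B. p (\<phi> x \<ominus>\<^bsub>A\<^esub> t i) < inverse (real (Suc i))" for i
      by (rule dense[OF tc]) simp
    then have "\<exists>s. \<forall>i. s i \<in> carrier B \<and> p (\<phi> (s i) \<ominus>\<^bsub>A\<^esub> t i) < inverse (real (Suc i))"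
      by (intro choice) blast
    then obtain s where s: "\<And>i. s i \<in> carrier B" "\<And>i. p (\<phi> (s i) \<ominus>\<^bsub>A\<^esub> t i) < inverse (real (Suc i))"
      by blast
    have null: "(\<lambda>i. p (\<phi> (s i) \<ominus>\<^bsub>A\<^esub> t i)) \<longlonglongrightarrow> 0"
      by (rule P.null_squeeze[OF _ _ LIMSEQ_inverse_real_of_nat]) (use s tc in \<open>auto intro: less_imp_le\<close>)
    have sc: "s \<in> Q.cauchy"
    proof (rule Q.cauchyI)
      fix e :: real assume "e > 0"
      then have e: "e / 3 > 0"
        by simp
      obtain N where N: "\<And>i j. i \<ge> N \<Longrightarrow> j \<ge> N \<Longrightarrow> p (t i \<ominus>\<^bsub>A\<^esub> t j) < e / 3"
        using P.cauchyD[OF t(1) e] by blast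
      obtain M where M: "\<And>i. i \<ge> M \<Longrightarrow> p (\<phi> (s i) \<ominus>\<^bsub>A\<^esub> t i) < e / 3"
        using order_tendstoD(2)[OF null e] unfolding eventually_sequentially by blast
      have "q (s i \<ominus>\<^bsub>B\<^esub> s j) < e" if "i \<ge> max M N" "j \<ge> max M N" for i j
      proof -
        have "q (s i \<ominus>\<^bsub>B\<^esub> s j) \<le> p (\<phi> (s i) \<ominus>\<^bsub>A\<^esub> t i) + (p (t i \<ominus>\<^bsub>A\<^esub> t j) + p (t j \<ominus>\<^bsub>A\<^esub> \<phi> (s j)))"
          using s(1) tc P.dist_triangle[of "\<phi> (s i)" "t i" "\<phi> (s j)"]
            P.dist_triangle[of "t i" "t j" "\<phi> (s j)"] by (simp add: hom_diff q_eq)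
        also have "\<dots> < e"
          using M[of i] M[of j] N[of i j] that P.diff_commute[of "t j" "\<phi> (s j)"] tc s(1) by simp
        finally show ?thesis .
      qed
      then show "\<exists>N. \<forall>i\<ge>N. \<forall>j\<ge>N. q (s i \<ominus>\<^bsub>B\<^esub> s j) < e"
        by blast
    qed (rule s(1))
    moreover have "U = P.cls (\<lambda>i. \<phi> (s i))"
      unfolding t(2) using P.cls_eqI[OF push[OF sc] t(1) null] by simp
    ultimately show ?thesis
      by blast
  qed
  \<comment> \<open>The inverse of \<open>cls s \<mapsto> cls (\<phi> \<circ> s)\<close>; by \<open>eq\<close> the chosen lift does not matter.\<close>
  define r where "r U = (SOME s. s \<in> Q.cauchy \<and> U = P.cls (\<lambda>i. \<phi> (s i)))" for U
  define \<Psi> where "\<Psi> U = Q.cls (r U)" for U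
  have \<Psi>: "\<Psi> (P.cls (\<lambda>i. \<phi> (s i))) = Q.cls s" if s: "s \<in> Q.cauchy" for s
  proof -
    have "r (P.cls (\<lambda>i. \<phi> (s i))) \<in> Q.cauchy \<and>
        P.cls (\<lambda>i. \<phi> (s i)) = P.cls (\<lambda>i. \<phi> (r (P.cls (\<lambda>i. \<phi> (s i))) i))"
      unfolding r_def by (rule someI[of _ s]) (use s in simp)
    then show ?thesis
      using eq[of s "r (P.cls (\<lambda>i. \<phi> (s i)))"] s unfolding \<Psi>_def by blast
  qed
  note comps = P.comp_add P.comp_mult P.comp_smult P.comp_star Q.comp_add Q.comp_mult Q.comp_smult Q.comp_star
  note closed = push Q.cauchy_add Q.cauchy_mult Q.cauchy_smult Q.cauchy_star
  have hom_add': "(\<lambda>i. \<phi> (s i) \<oplus>\<^bsub>A\<^esub> \<phi> (t i)) = (\<lambda>i. \<phi> (s i \<oplus>\<^bsub>B\<^esub> t i))"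
    and hom_mult': "(\<lambda>i. \<phi> (s i) \<otimes>\<^bsub>A\<^esub> \<phi> (t i)) = (\<lambda>i. \<phi> (s i \<otimes>\<^bsub>B\<^esub> t i))"
    if "s \<in> Q.cauchy" "t \<in> Q.cauchy" for s t
    using that Q.cauchy_carrier by (simp_all add: hom_add hom_mult)
  have hom_smult': "(\<lambda>i. c \<odot>\<^bsub>A\<^esub> \<phi> (s i)) = (\<lambda>i. \<phi> (c \<odot>\<^bsub>B\<^esub> s i))"
    and hom_star': "(\<lambda>i. star A (\<phi> (s i))) = (\<lambda>i. \<phi> (star B (s i)))"
    if "s \<in> Q.cauchy" for s c
    using that Q.cauchy_carrier by (simp_all add: hom_smult hom_star)
  have "\<Psi> \<in> ring_hom P.cpl Q.cpl"
  proof (rule ring_hom_memI)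
    fix U assume "U \<in> carrier P.cpl"
    then obtain s where s: "s \<in> Q.cauchy" "U = P.cls (\<lambda>i. \<phi> (s i))"
      using lift by blast
    then show "\<Psi> U \<in> carrier Q.cpl"
      by (simp add: \<Psi> Q.cls_mem)
    fix V assume "V \<in> carrier P.cpl"
    then obtain t where t: "t \<in> Q.cauchy" "V = P.cls (\<lambda>i. \<phi> (t i))"
      using lift by blast
    show "\<Psi> (U \<otimes>\<^bsub>P.cpl\<^esub> V) = \<Psi> U \<otimes>\<^bsub>Q.cpl\<^esub> \<Psi> V"
      using s t by (simp add: comps closed \<Psi> hom_mult')
    show "\<Psi> (U \<oplus>\<^bsub>P.cpl\<^esub> V) = \<Psi> U \<oplus>\<^bsub>Q.cpl\<^esub> \<Psi> V"
      using s t by (simp add: comps closed \<Psi> hom_add')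
  next
    show "\<Psi> \<one>\<^bsub>P.cpl\<^esub> = \<one>\<^bsub>Q.cpl\<^esub>"
      using \<Psi>[OF Q.cauchy_const[OF B.one_closed]] by (simp add: hom_one P.comp_one Q.comp_one)
  qed
  moreover have "bij_betw \<Psi> (carrier P.cpl) (carrier Q.cpl)"
  proof (rule bij_betw_imageI)
    show "inj_on \<Psi> (carrier P.cpl)"
    proof (rule inj_onI)
      fix U V assume "U \<in> carrier P.cpl" "V \<in> carrier P.cpl" "\<Psi> U = \<Psi> V"
      then show "U = V"
        using lift[of U] lift[of V] eq \<Psi> by metis
    qed
    show "\<Psi> ` carrier P.cpl = carrier Q.cpl"
    proof
      show "\<Psi> ` carrier P.cpl \<subseteq> carrier Q.cpl"
        using lift \<Psi> Q.cls_mem by fastforce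
      show "carrier Q.cpl \<subseteq> \<Psi> ` carrier P.cpl"
      proof
        fix V assume "V \<in> carrier Q.cpl"
        then obtain s where s: "s \<in> Q.cauchy" "V = Q.cls s"
          by (rule Q.cls_cases)
        then show "V \<in> \<Psi> ` carrier P.cpl"
          using \<Psi>[OF s(1)] P.cls_mem[OF push[OF s(1)]] by (metis imageI)
      qed
    qed
  qed
  moreover have "\<Psi> (c \<odot>\<^bsub>P.cpl\<^esub> U) = c \<odot>\<^bsub>Q.cpl\<^esub> \<Psi> U" "\<Psi> (star P.cpl U) = star Q.cpl (\<Psi> U)"
    "cnorm Q.cpl (\<Psi> U) = cnorm P.cpl U"
    if U: "U \<in> carrier P.cpl" for c U
  proof -
    obtain s where s: "s \<in> Q.cauchy" "U = P.cls (\<lambda>i. \<phi> (s i))"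
      using lift U by blast
    show "\<Psi> (c \<odot>\<^bsub>P.cpl\<^esub> U) = c \<odot>\<^bsub>Q.cpl\<^esub> \<Psi> U" "\<Psi> (star P.cpl U) = star Q.cpl (\<Psi> U)"
      using s by (simp_all add: comps closed \<Psi> hom_smult' hom_star')
    show "cnorm Q.cpl (\<Psi> U) = cnorm P.cpl U"
      unfolding s(2) \<Psi>[OF s(1)] using P.comp_norm[OF push[OF s(1)]] Q.cauchy_carrier[OF s(1)]
      by (intro Q.comp_norm_eq[OF s(1)]) (simp add: q_eq)
  qed
  ultimately show ?thesis
    unfolding cstar_isomorphic_def using P.comp_cstar_algebra Q.comp_cstar_algebra by blast
qed

text \<open>
  If the range of \<open>\<phi>\<close> is dense for an auxiliary submultiplicative seminorm \<open>N\<close> that dominates \<open>q\<close>,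
  then \<open>q\<close> descends along \<open>\<phi>\<close>: the value at \<open>a\<close> is the limit of \<open>q (x\<^sub>k)\<close> along any sequence with
  \<open>\<phi> (x\<^sub>k)\<close> tending to \<open>a\<close>, and all C*-seminorm axioms are closed conditions.
\<close>

lemma seminorm_extension:
  fixes B :: "('b, 'k) star_algebra_scheme" and A :: "('a, 'm) star_algebra_scheme"
  assumes hom: "star_hom B A \<phi>"
    and q: "q \<in> cstar_seminorms B"
    and N_nonneg: "\<And>a. a \<in> carrier A \<Longrightarrow> 0 \<le> N a"
    and N_add: "\<And>a b. a \<in> carrier A \<Longrightarrow> b \<in> carrier A \<Longrightarrow> N (a \<oplus>\<^bsub>A\<^esub> b) \<le> N a + N b"
    and N_smult: "\<And>c a. a \<in> carrier A \<Longrightarrow> N (c \<odot>\<^bsub>A\<^esub> a) \<le> cmod c * N a"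
    and N_mult: "\<And>a b. a \<in> carrier A \<Longrightarrow> b \<in> carrier A \<Longrightarrow> N (a \<otimes>\<^bsub>A\<^esub> b) \<le> N a * N b"
    and N_star: "\<And>a. a \<in> carrier A \<Longrightarrow> N (star A a) \<le> N a"
    and dense: "\<And>a e. a \<in> carrier A \<Longrightarrow> e > 0 \<Longrightarrow> \<exists>x\<in>carrier B. N (\<phi> x \<ominus>\<^bsub>A\<^esub> a) < e"
    and le: "\<And>x. x \<in> carrier B \<Longrightarrow> q x \<le> N (\<phi> x)"
  shows "\<exists>q'\<in>cstar_seminorms A. \<forall>x\<in>carrier B. q' (\<phi> x) = q x"
proof -
  interpret star_hom B A \<phi>
    by (rule hom)
  interpret Q: cstar_seminormed B q
    by (rule cstar_seminormedI[OF B.star_algebra_A q])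
  define conv where "conv x a \<longleftrightarrow> (\<forall>i. x i \<in> carrier B) \<and> a \<in> carrier A \<and>
    (\<lambda>i. N (\<phi> (x i) \<ominus>\<^bsub>A\<^esub> a)) \<longlonglongrightarrow> 0" for x :: "nat \<Rightarrow> 'b" and a
  have convD: "x i \<in> carrier B" "a \<in> carrier A" "(\<lambda>i. N (\<phi> (x i) \<ominus>\<^bsub>A\<^esub> a)) \<longlonglongrightarrow> 0" if "conv x a" for x a i
    using that by (auto simp: conv_def)
  have N_neg: "N (\<ominus>\<^bsub>A\<^esub> a) \<le> N a" if "a \<in> carrier A" for a
    using N_smult[OF that, of "- 1"] that by (simp add: A.neg_eq)
  have squeeze: "(\<lambda>i. N (f i)) \<longlonglongrightarrow> 0"
    if "\<And>i. f i \<in> carrier A" "\<And>i. N (f i) \<le> g i" "g \<longlonglongrightarrow> 0" for f g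
    by (rule tendsto_sandwich[OF _ _ tendsto_const that(3)]) (use that N_nonneg in auto)
  have exists: "\<exists>x. conv x a" if a: "a \<in> carrier A" for a
  proof -
    have "\<exists>x\<in>carrier B. N (\<phi> x \<ominus>\<^bsub>A\<^esub> a) < inverse (real (Suc i))" for i
      by (rule dense[OF a]) simp
    then have "\<exists>s. \<forall>i. s i \<in> carrier B \<and> N (\<phi> (s i) \<ominus>\<^bsub>A\<^esub> a) < inverse (real (Suc i))"
      by (intro choice) blast
    then obtain s where s: "\<And>i. s i \<in> carrier B" "\<And>i. N (\<phi> (s i) \<ominus>\<^bsub>A\<^esub> a) < inverse (real (Suc i))"
      by blast
    have "(\<lambda>i. N (\<phi> (s i) \<ominus>\<^bsub>A\<^esub> a)) \<longlonglongrightarrow> 0"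
      by (rule squeeze[OF _ _ LIMSEQ_inverse_real_of_nat]) (use s a in \<open>auto intro: less_imp_le\<close>)
    then show ?thesis
      using s a by (auto simp: conv_def)
  qed
  have N_diff: "N (a \<ominus>\<^bsub>A\<^esub> b) \<le> N (a \<ominus>\<^bsub>A\<^esub> c) + N (b \<ominus>\<^bsub>A\<^esub> c)"
    if "a \<in> carrier A" "b \<in> carrier A" "c \<in> carrier A" for a b c
  proof -
    have "c \<ominus>\<^bsub>A\<^esub> b = \<ominus>\<^bsub>A\<^esub> (b \<ominus>\<^bsub>A\<^esub> c)"
      using that by (simp add: A.ring_rules)
    then show ?thesis
      using A.diff_split[of a c b] N_add[of "a \<ominus>\<^bsub>A\<^esub> c" "c \<ominus>\<^bsub>A\<^esub> b"] N_neg[of "b \<ominus>\<^bsub>A\<^esub> c"] that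
      by simp
  qed
  have q_diff: "\<bar>q x - q y\<bar> \<le> N (\<phi> x \<ominus>\<^bsub>A\<^esub> a) + N (\<phi> y \<ominus>\<^bsub>A\<^esub> a)"
    if "x \<in> carrier B" "y \<in> carrier B" "a \<in> carrier A" for x y a
    using Q.abs_diff_le[of x y] le[of "x \<ominus>\<^bsub>B\<^esub> y"] N_diff[of "\<phi> x" "\<phi> y" a] that by (simp add: hom_diff)
  have converges: "convergent (\<lambda>i. q (x i))" if x: "conv x a" for x a
  proof -
    have "Cauchy (\<lambda>i. q (x i))"
    proof (rule metric_CauchyI)
      fix e :: real assume "e > 0"
      then have "e / 2 > 0"
        by simp
      then obtain M where M: "\<And>i. i \<ge> M \<Longrightarrow> N (\<phi> (x i) \<ominus>\<^bsub>A\<^esub> a) < e / 2"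
        using order_tendstoD(2)[OF convD(3)[OF x] \<open>e / 2 > 0\<close>] unfolding eventually_sequentially by blast
      show "\<exists>M. \<forall>i\<ge>M. \<forall>j\<ge>M. dist (q (x i)) (q (x j)) < e"
      proof (intro exI allI impI)
        fix i j assume "i \<ge> M" "j \<ge> M"
        then show "dist (q (x i)) (q (x j)) < e"
          using M[of i] M[of j] q_diff[of "x i" "x j" a] convD[OF x] by (simp add: dist_real_def)
      qed
    qed
    then show ?thesis
      by (simp add: Cauchy_convergent_iff)
  qed
  define q' where "q' a = lim (\<lambda>i. q ((SOME x. conv x a) i))" for a
  have limit: "(\<lambda>i. q (x i)) \<longlonglongrightarrow> q' a" if x: "conv x a" for x a
  proof -
    let ?y = "SOME x. conv x a"
    have y: "conv ?y a"
      by (rule someI[of _ x]) (rule x)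
    have "(\<lambda>i. q (?y i)) \<longlonglongrightarrow> q' a"
      using converges[OF y] by (simp add: q'_def convergent_LIMSEQ_iff)
    moreover have "(\<lambda>i. q (x i) - q (?y i)) \<longlonglongrightarrow> 0"
    proof (rule Lim_null_comparison)
      show "(\<lambda>i. N (\<phi> (x i) \<ominus>\<^bsub>A\<^esub> a) + N (\<phi> (?y i) \<ominus>\<^bsub>A\<^esub> a)) \<longlonglongrightarrow> 0"
        by (rule tendsto_add_zero[OF convD(3)[OF x] convD(3)[OF y]])
      show "\<forall>\<^sub>F i in sequentially. norm (q (x i) - q (?y i)) \<le> N (\<phi> (x i) \<ominus>\<^bsub>A\<^esub> a) + N (\<phi> (?y i) \<ominus>\<^bsub>A\<^esub> a)"
        using q_diff[OF convD(1)[OF x] convD(1)[OF y] convD(2)[OF x]] by (intro always_eventually) simp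
    qed
    ultimately have "(\<lambda>i. q (x i) - q (?y i) + q (?y i)) \<longlonglongrightarrow> 0 + q' a"
      by (intro tendsto_add)
    then show ?thesis
      by simp
  qed
  have conv_add: "conv (\<lambda>i. x i \<oplus>\<^bsub>B\<^esub> y i) (a \<oplus>\<^bsub>A\<^esub> b)" if x: "conv x a" and y: "conv y b" for x y a b
  proof -
    note c = convD[OF x] convD[OF y]
    have "(\<lambda>i. N (\<phi> (x i \<oplus>\<^bsub>B\<^esub> y i) \<ominus>\<^bsub>A\<^esub> (a \<oplus>\<^bsub>A\<^esub> b))) \<longlonglongrightarrow> 0"
    proof (rule squeeze[OF _ _ tendsto_add_zero[OF c(3) c(6)]])
      show "N (\<phi> (x i \<oplus>\<^bsub>B\<^esub> y i) \<ominus>\<^bsub>A\<^esub> (a \<oplus>\<^bsub>A\<^esub> b)) \<le> N (\<phi> (x i) \<ominus>\<^bsub>A\<^esub> a) + N (\<phi> (y i) \<ominus>\<^bsub>A\<^esub> b)" for i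
        using c N_add[of "\<phi> (x i) \<ominus>\<^bsub>A\<^esub> a" "\<phi> (y i) \<ominus>\<^bsub>A\<^esub> b"] by (simp add: hom_add A.diff_add)
    qed (use c in auto)
    then show ?thesis
      using c by (simp add: conv_def)
  qed
  have conv_smult: "conv (\<lambda>i. c \<odot>\<^bsub>B\<^esub> x i) (c \<odot>\<^bsub>A\<^esub> a)" if x: "conv x a" for x a c
  proof -
    note d = convD[OF x]
    have "(\<lambda>i. N (\<phi> (c \<odot>\<^bsub>B\<^esub> x i) \<ominus>\<^bsub>A\<^esub> (c \<odot>\<^bsub>A\<^esub> a))) \<longlonglongrightarrow> 0"
    proof (rule squeeze[OF _ _ tendsto_mult_right_zero[OF d(3)]])
      show "N (\<phi> (c \<odot>\<^bsub>B\<^esub> x i) \<ominus>\<^bsub>A\<^esub> (c \<odot>\<^bsub>A\<^esub> a)) \<le> cmod c * N (\<phi> (x i) \<ominus>\<^bsub>A\<^esub> a)" for i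
        using d N_smult[of "\<phi> (x i) \<ominus>\<^bsub>A\<^esub> a" c] by (simp add: hom_smult A.smult_minus)
    qed (use d in auto)
    then show ?thesis
      using d by (simp add: conv_def)
  qed
  have conv_star: "conv (\<lambda>i. star B (x i)) (star A a)" if x: "conv x a" for x a
  proof -
    note d = convD[OF x]
    have "(\<lambda>i. N (\<phi> (star B (x i)) \<ominus>\<^bsub>A\<^esub> star A a)) \<longlonglongrightarrow> 0"
    proof (rule squeeze[OF _ _ d(3)])
      show "N (\<phi> (star B (x i)) \<ominus>\<^bsub>A\<^esub> star A a) \<le> N (\<phi> (x i) \<ominus>\<^bsub>A\<^esub> a)" for i
        using d N_star[of "\<phi> (x i) \<ominus>\<^bsub>A\<^esub> a"] by (simp add: hom_star A.star_minus)
    qed (use d in auto)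
    then show ?thesis
      using d by (simp add: conv_def)
  qed
  have conv_mult: "conv (\<lambda>i. x i \<otimes>\<^bsub>B\<^esub> y i) (a \<otimes>\<^bsub>A\<^esub> b)" if x: "conv x a" and y: "conv y b" for x y a b
  proof -
    note c = convD[OF x] convD[OF y]
    let ?dx = "\<lambda>i. N (\<phi> (x i) \<ominus>\<^bsub>A\<^esub> a)" and ?dy = "\<lambda>i. N (\<phi> (y i) \<ominus>\<^bsub>A\<^esub> b)"
    have "(\<lambda>i. N (\<phi> (x i \<otimes>\<^bsub>B\<^esub> y i) \<ominus>\<^bsub>A\<^esub> (a \<otimes>\<^bsub>A\<^esub> b))) \<longlonglongrightarrow> 0"
    proof (rule squeeze)
      have "(\<lambda>i. (?dx i + N a) * ?dy i + ?dx i * N b) \<longlonglongrightarrow> (0 + N a) * 0 + 0 * N b"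
        by (intro tendsto_intros c)
      then show "(\<lambda>i. (?dx i + N a) * ?dy i + ?dx i * N b) \<longlonglongrightarrow> 0"
        by simp
      fix i
      have "\<phi> (x i) = (\<phi> (x i) \<ominus>\<^bsub>A\<^esub> a) \<oplus>\<^bsub>A\<^esub> a"
        using c by (simp add: A.ring_rules)
      then have Nx: "N (\<phi> (x i)) \<le> ?dx i + N a"
        using N_add[of "\<phi> (x i) \<ominus>\<^bsub>A\<^esub> a" a] c by simp
      have "N (\<phi> (x i \<otimes>\<^bsub>B\<^esub> y i) \<ominus>\<^bsub>A\<^esub> (a \<otimes>\<^bsub>A\<^esub> b))
          = N (\<phi> (x i) \<otimes>\<^bsub>A\<^esub> (\<phi> (y i) \<ominus>\<^bsub>A\<^esub> b) \<oplus>\<^bsub>A\<^esub> (\<phi> (x i) \<ominus>\<^bsub>A\<^esub> a) \<otimes>\<^bsub>A\<^esub> b)"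
        using c by (simp add: hom_mult A.diff_mult)
      also have "\<dots> \<le> N (\<phi> (x i) \<otimes>\<^bsub>A\<^esub> (\<phi> (y i) \<ominus>\<^bsub>A\<^esub> b)) + N ((\<phi> (x i) \<ominus>\<^bsub>A\<^esub> a) \<otimes>\<^bsub>A\<^esub> b)"
        using c by (intro N_add) auto
      also have "\<dots> \<le> N (\<phi> (x i)) * ?dy i + ?dx i * N b"
        using c by (intro add_mono N_mult) auto
      also have "\<dots> \<le> (?dx i + N a) * ?dy i + ?dx i * N b"
        using c Nx by (intro add_right_mono mult_right_mono N_nonneg) auto
      finally show "N (\<phi> (x i \<otimes>\<^bsub>B\<^esub> y i) \<ominus>\<^bsub>A\<^esub> (a \<otimes>\<^bsub>A\<^esub> b)) \<le> (?dx i + N a) * ?dy i + ?dx i * N b" .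
    qed (use c in auto)
    then show ?thesis
      using c by (simp add: conv_def)
  qed
  have "q' \<in> cstar_seminorms A"
    unfolding cstar_seminorms_def
  proof (intro CollectI conjI ballI allI)
    fix a assume "a \<in> carrier A"
    then obtain x where x: "conv x a"
      using exists by blast
    show "q' (c \<odot>\<^bsub>A\<^esub> a) = cmod c * q' a" for c
      by (rule LIMSEQ_unique[OF limit[OF conv_smult[OF x]]])
         (use tendsto_mult_left[OF limit[OF x]] convD[OF x] in \<open>simp add: Q.homogeneous\<close>)
    show "q' (star A a \<otimes>\<^bsub>A\<^esub> a) = (q' a)\<^sup>2"
      by (rule LIMSEQ_unique[OF limit[OF conv_mult[OF conv_star[OF x] x]]])
         (use tendsto_power[OF limit[OF x]] convD[OF x] in \<open>simp add: Q.cstar_identity\<close>)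
    fix b assume "b \<in> carrier A"
    then obtain y where y: "conv y b"
      using exists by blast
    show "q' (a \<oplus>\<^bsub>A\<^esub> b) \<le> q' a + q' b"
      by (rule LIMSEQ_le[OF limit[OF conv_add[OF x y]] tendsto_add[OF limit[OF x] limit[OF y]]])
         (use convD[OF x] convD[OF y] in \<open>auto intro: Q.triangle\<close>)
    show "q' (a \<otimes>\<^bsub>A\<^esub> b) \<le> q' a * q' b"
      by (rule LIMSEQ_le[OF limit[OF conv_mult[OF x y]] tendsto_mult[OF limit[OF x] limit[OF y]]])
         (use convD[OF x] convD[OF y] in \<open>auto intro: Q.submult\<close>)
  qed
  moreover have "q' (\<phi> x) = q x" if "x \<in> carrier B" for x
  proof -
    have "N \<zero>\<^bsub>A\<^esub> = 0"
      using N_smult[of "\<zero>\<^bsub>A\<^esub>" 0] N_nonneg[of "\<zero>\<^bsub>A\<^esub>"] by simp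
    then have "conv (\<lambda>_. x) (\<phi> x)"
      using that by (simp add: conv_def)
    from limit[OF this] show ?thesis
      by (simp add: LIMSEQ_const_iff)
  qed
  ultimately show ?thesis
    by blast
qed

section \<open>Positivity: orthogonality of the range projections\<close>

text \<open>
  The Cuntz relations contain \<open>S\<^sub>i\<^sup>* S\<^sub>i = 1\<close> and \<open>\<Sum> S\<^sub>i S\<^sub>i\<^sup>* = 1\<close>, but not \<open>S\<^sub>i\<^sup>* S\<^sub>j = 0\<close> for \<open>i \<noteq> j\<close>,
  which is where positivity enters: projections that add up to \<open>1\<close> are orthogonal. The argument here
  needs no spectral theory. A self-adjoint \<open>a\<close> with \<open>p (1 - a) \<le> 1\<close> takes the part of a positive
  element, and the fact that only \<open>0\<close> is both positive and negative becomes the statement that \<open>1\<close>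
  is an extreme point of the unit ball.
\<close>

context cstar_seminormed
begin

text \<open>
  Computations with a single element \<open>b\<close> and its adjoint are carried out with polynomials, whose
  commutative multiplication lets the simplifier verify the identities.
\<close>

definition peval :: "'a \<Rightarrow> complex poly \<Rightarrow> 'a" where
  "peval b P = fold_coeffs (\<lambda>a x. a \<odot> \<one> \<oplus> b \<otimes> x) P \<zero>"

context
  fixes b
  assumes b: "b \<in> carrier A"
begin

lemma peval_0 [simp]: "peval b 0 = \<zero>"
  by (simp add: peval_def)

lemma peval_pCons: "peval b (pCons a P) = a \<odot> \<one> \<oplus> b \<otimes> peval b P"
proof (cases "P = 0 \<and> a = 0")
  case True
  then show ?thesis
    using b by (simp add: null_right ring_rules)
next
  case False
  then show ?thesis
    by (auto simp: peval_def fold_coeffs_def cCons_def)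
qed

lemma peval_closed [simp, intro]: "peval b P \<in> carrier A"
  by (induction P) (use b in \<open>simp_all add: peval_pCons\<close>)

lemma peval_add: "peval b (P + Q) = peval b P \<oplus> peval b Q"
proof (induction P Q rule: poly_induct2)
  case (pCons a P c Q)
  then show ?case
    using b by (simp add: peval_pCons smult_add_left ring_rules)
qed (simp add: ring_rules)

lemma peval_smult: "peval b (Polynomial.smult c P) = c \<odot> peval b P"
proof (induction P)
  case (pCons a P)
  then show ?case
    using b by (simp add: peval_pCons smult_add_right smult_smult smult_mult_right)
qed simp

lemma peval_mult: "peval b (P * Q) = peval b P \<otimes> peval b Q"
proof (induction P)
  case (pCons a P)
  then show ?case
    using b by (simp add: peval_pCons peval_add peval_smult mult_pCons_left smult_mult_left ring_rules)
qed (simp add: null_left)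

lemma peval_X: "peval b [:0, 1:] = b"
  using b by (simp add: peval_pCons null_right ring_rules)

lemma peval_linear: "peval b [:1, c:] = \<one> \<oplus> c \<odot> b"
  using b by (simp add: peval_pCons null_right smult_mult_right ring_rules)

lemma peval_star:
  assumes "star A b = b"
  shows "star A (peval b P) = peval b (map_poly cnj P)"
proof (induction P)
  case (pCons a P)
  have "peval b (map_poly cnj P) \<otimes> b = peval b (map_poly cnj P * [:0, 1:])"
    by (simp add: peval_mult peval_X del: mult_pCons_right)
  also have "\<dots> = b \<otimes> peval b (map_poly cnj P)"
    by (subst mult.commute) (simp add: peval_mult peval_X del: mult_pCons_left)
  finally show ?case
    using pCons assms b by (simp add: peval_pCons map_poly_pCons star_add star_mult star_smult)
qed simp

text \<open>
  If \<open>1 + t b\<close> and \<open>1 - t b\<close> are contractions with \<open>b\<close> self-adjoint, then so is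
  \<open>1 + i t b\<close>, by the C*-identity and because \<open>1 + t\<^sup>2 b\<^sup>2\<close> is the mean of \<open>(1 + t b)\<^sup>2\<close> and
  \<open>(1 - t b)\<^sup>2\<close>. With \<open>T = t\<^sup>2 b\<^sup>2\<close>, the mean of \<open>(1 + i t b)\<^sup>4\<close> and its adjoint is
  \<open>1 - 6 T + T\<^sup>2\<close>, and averaging it with \<open>1 - T\<^sup>2\<close> gives \<open>1 - 3 T\<close>, which cancels the quadratic
  term of \<open>(1 + t b)\<^sup>2\<close> in a convex combination.
\<close>

lemma contraction_growth:
  fixes t :: real
  assumes sa: "star A b = b"
    and plus: "p (peval b [:1, of_real t:]) \<le> 1" and minus: "p (peval b [:1, - of_real t:]) \<le> 1"
  shows "p (peval b [:1, of_real (3 / 2 * t):]) \<le> 1"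
proof -
  let ?\<nu> = "\<lambda>P. p (peval b P)"
  have \<nu>_mult: "?\<nu> (P * Q) \<le> 1" if "?\<nu> P \<le> 1" "?\<nu> Q \<le> 1" for P Q
  proof -
    have "?\<nu> (P * Q) \<le> ?\<nu> P * ?\<nu> Q"
      by (simp add: peval_mult submult)
    also have "\<dots> \<le> 1"
      using that by (simp add: mult_le_one nonneg)
    finally show ?thesis .
  qed
  have \<nu>_add: "?\<nu> (P + Q) \<le> ?\<nu> P + ?\<nu> Q" for P Q
    by (simp add: peval_add triangle)
  have \<nu>_smult: "?\<nu> (Polynomial.smult (of_real c) P) \<le> c" if "?\<nu> P \<le> 1" "c \<ge> 0" for P c
    using that by (simp add: peval_smult homogeneous mult_left_le)
  have imaginary: "?\<nu> [:1, \<i> * of_real s:] \<le> 1"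
    if "?\<nu> [:1, of_real s:] \<le> 1" "?\<nu> [:1, - of_real s:] \<le> 1" for s :: real
  proof -
    have eq: "[:1, - (\<i> * of_real s):] * [:1, \<i> * of_real s:]
        = Polynomial.smult (of_real (1 / 2)) ([:1, of_real s:] * [:1, of_real s:])
          + Polynomial.smult (of_real (1 / 2)) ([:1, - of_real s:] * [:1, - of_real s:])"
      by (simp add: algebra_simps)
    have "(?\<nu> [:1, \<i> * of_real s:])\<^sup>2 = ?\<nu> ([:1, - (\<i> * of_real s):] * [:1, \<i> * of_real s:])"
      using cstar_identity[of "peval b [:1, \<i> * of_real s:]"] peval_star[OF sa]
      unfolding peval_mult by (simp add: map_poly_pCons)
    also have "\<dots> \<le> 1 / 2 + 1 / 2"
      unfolding eq using that by (intro order_trans[OF \<nu>_add] add_mono \<nu>_smult \<nu>_mult) auto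
    finally show ?thesis
      using nonneg[of "peval b [:1, \<i> * of_real s:]"] by (simp add: abs_square_le_1)
  qed
  have i_plus: "?\<nu> [:1, \<i> * of_real t:] \<le> 1"
    using plus minus by (rule imaginary)
  have i_minus: "?\<nu> [:1, - (\<i> * of_real t):] \<le> 1"
    using imaginary[of "- t"] plus minus by simp
  have eq: "[:1, of_real (3 / 2 * t):] = Polynomial.smult (of_real (3 / 4)) ([:1, of_real t:] * [:1, of_real t:])
      + (Polynomial.smult (of_real (1 / 16)) (([:1, \<i> * of_real t:] * [:1, \<i> * of_real t:]) * ([:1, \<i> * of_real t:] * [:1, \<i> * of_real t:]))
      + (Polynomial.smult (of_real (1 / 16)) (([:1, - (\<i> * of_real t):] * [:1, - (\<i> * of_real t):]) * ([:1, - (\<i> * of_real t):] * [:1, - (\<i> * of_real t):]))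
      + Polynomial.smult (of_real (1 / 8)) (([:1, of_real t:] * [:1, - of_real t:]) * ([:1, \<i> * of_real t:] * [:1, - (\<i> * of_real t):]))))"
    by (simp add: algebra_simps)
  have "?\<nu> [:1, of_real (3 / 2 * t):] \<le> 3 / 4 + (1 / 16 + (1 / 16 + 1 / 8))"
    unfolding eq using plus minus i_plus i_minus
    by (intro order_trans[OF \<nu>_add] add_mono order_refl \<nu>_smult \<nu>_mult) auto
  then show ?thesis
    by simp
qed

end

text \<open>
  By \<open>contraction_growth\<close> the hypotheses persist when \<open>b\<close> is multiplied by \<open>3 / 2\<close>, hence hold for
  arbitrarily large multiples of \<open>b\<close>, which are therefore all of norm at most \<open>2\<close>.
\<close>

lemma extreme_point:
  assumes b: "b \<in> carrier A" "star A b = b"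
    and "p (\<one> \<oplus> b) \<le> 1" "p (\<one> \<ominus> b) \<le> 1"
  shows "p b = 0"
proof (rule ccontr)
  assume "p b \<noteq> 0"
  then have pos: "p b > 0"
    using nonneg[OF b(1)] by simp
  have growth: "p (peval b [:1, of_real ((3 / 2) ^ k):]) \<le> 1 \<and> p (peval b [:1, - of_real ((3 / 2) ^ k):]) \<le> 1"
    for k :: nat
  proof (induction k)
    case 0
    then show ?case
      using assms by (simp add: peval_linear minus_eq)
  next
    case (Suc k)
    then show ?case
      using contraction_growth[OF b, of "(3 / 2) ^ k"] contraction_growth[OF b, of "- ((3 / 2) ^ k)"]
      by simp
  qed
  obtain k :: nat where k: "2 / p b < (3 / 2) ^ k"
    using real_arch_pow[of "3 / 2" "2 / p b"] by auto
  let ?x = "of_real ((3 / 2) ^ k) \<odot> b"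
  have "?x = (\<one> \<oplus> ?x) \<ominus> \<one>"
    using b(1) by (simp add: ring_rules)
  then have "p ?x \<le> p (\<one> \<oplus> ?x) + p \<one>"
    using triangle_diff[of "\<one> \<oplus> ?x" \<one>] b(1) by simp
  also have "\<dots> \<le> 2"
    using growth[of k] one_le b(1) by (simp add: peval_linear)
  finally have "(3 / 2) ^ k * p b \<le> 2"
    using b(1) homogeneous[of b "of_real ((3 / 2) ^ k)"] by (simp add: norm_power)
  then show False
    using k pos by (simp add: field_simps)
qed

lemma sum_const:
  assumes "finite I" "x \<in> carrier A"
  shows "asum (\<lambda>_. x) I = of_nat (card I) \<odot> x"
  using assms by (induction I rule: finite_induct) (simp_all add: smult_add_left)

text \<open>
  The element \<open>a i\<close> is the negative of the sum of the other ones. If there are \<open>m\<close> of them,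
  then \<open>1 + a i / m\<close> is the mean of the \<open>1 - a j\<close> with \<open>j \<noteq> i\<close>, and \<open>1 - a i / m\<close> is a convex combination
  of \<open>1\<close> and \<open>1 - a i\<close>. Both are contractions, so \<open>extreme_point\<close> applies.
\<close>

lemma zero_sum_of_positive:
  assumes I: "finite I" "i \<in> I"
    and a: "\<And>j. j \<in> I \<Longrightarrow> a j \<in> carrier A" "star A (a i) = a i"
    and small: "\<And>j. j \<in> I \<Longrightarrow> p (\<one> \<ominus> a j) \<le> 1"
    and zero: "asum a I = \<zero>"
  shows "p (a i) = 0"
proof -
  define J where "J = I - {i}"
  have J: "finite J" "i \<notin> J" "I = insert i J" "\<And>j. j \<in> J \<Longrightarrow> a j \<in> carrier A"
    using I a by (auto simp: J_def)
  have ai: "a i \<in> carrier A"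
    using I a by auto
  have sum0: "a i \<oplus> asum a J = \<zero>"
    using zero J ai by simp
  then have sumJ: "asum a J = \<ominus> a i"
    using J(4) ai ring_rules(1,3,4,9,11) by (metis neg_closed sum_closed)
  show ?thesis
  proof (cases "J = {}")
    case True
    then show ?thesis
      using sum0 ai by (simp add: ring_rules)
  next
    case False
    define m where "m = card J"
    have m: "m \<ge> 1"
      using False J(1) by (simp add: m_def Suc_leI card_gt_0_iff)
    define b where "b = of_real (1 / m) \<odot> a i"
    have b: "b \<in> carrier A" "star A b = b"
      using ai a(2) by (simp_all add: b_def star_smult)
    have "asum (\<lambda>j. \<one> \<ominus> a j) J = asum (\<lambda>_. \<one>) J \<oplus> asum (\<lambda>j. (- 1) \<odot> a j) J"
      using J(4) by (subst sum_add[symmetric]) (auto intro!: sum_cong simp: minus_eq)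
    also have "asum (\<lambda>j. (- 1) \<odot> a j) J = a i"
      using J(4) sum_smult[of J a "- 1", OF J(1,4)] ai sumJ by (simp add: neg_eq smult_smult)
    finally have "asum (\<lambda>j. \<one> \<ominus> a j) J = of_nat m \<odot> \<one> \<oplus> a i"
      using J(1) by (simp add: sum_const m_def)
    moreover have "p (asum (\<lambda>j. \<one> \<ominus> a j) J) \<le> (\<Sum>j\<in>J. p (\<one> \<ominus> a j))"
      using J by (intro sum_le) auto
    moreover have "(\<Sum>j\<in>J. p (\<one> \<ominus> a j)) \<le> (\<Sum>j\<in>J. 1)"
      using J by (intro sum_mono small) auto
    ultimately have bound: "p (of_nat m \<odot> \<one> \<oplus> a i) \<le> m"
      by (simp add: m_def)
    have "\<one> \<oplus> b = of_real (1 / m) \<odot> (of_nat m \<odot> \<one> \<oplus> a i)"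
      using m ai by (simp add: b_def smult_add_right smult_smult)
    then have "p (\<one> \<oplus> b) = 1 / m * p (of_nat m \<odot> \<one> \<oplus> a i)"
      using ai homogeneous[of "of_nat m \<odot> \<one> \<oplus> a i" "of_real (1 / m)"] by (simp add: norm_divide)
    also have "\<dots> \<le> 1"
      using bound m by (simp add: field_simps)
    finally have plus: "p (\<one> \<oplus> b) \<le> 1" .
    have "\<one> \<ominus> b = of_real (1 - 1 / m) \<odot> \<one> \<oplus> of_real (1 / m) \<odot> (\<one> \<ominus> a i)"
    proof -
      have "of_real (1 - 1 / m) \<odot> \<one> \<oplus> of_real (1 / m) \<odot> (\<one> \<ominus> a i)
          = (of_real (1 - 1 / m) \<odot> \<one> \<oplus> of_real (1 / m) \<odot> \<one>) \<oplus> (- of_real (1 / m)) \<odot> a i"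
        using ai by (simp add: neg_eq smult_add_right smult_smult ring_rules)
      also have "of_real (1 - 1 / m) \<odot> \<one> \<oplus> of_real (1 / m) \<odot> \<one> = \<one>"
        by (subst smult_add_left[symmetric]) simp_all
      finally show ?thesis
        using ai by (simp add: b_def minus_eq smult_smult)
    qed
    then have "p (\<one> \<ominus> b) \<le> p (of_real (1 - 1 / m) \<odot> \<one>) + p (of_real (1 / m) \<odot> (\<one> \<ominus> a i))"
      using ai triangle by simp
    also have "\<dots> = \<bar>1 - 1 / real m\<bar> * p \<one> + 1 / m * p (\<one> \<ominus> a i)"
      using ai homogeneous[of \<one> "of_real (1 - 1 / m)"] homogeneous[of "\<one> \<ominus> a i" "of_real (1 / m)"]
      by (simp only: norm_of_real) simp
    also have "\<dots> \<le> (1 - 1 / m) * 1 + 1 / m * 1"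
    proof (intro add_mono mult_mono)
      show "\<bar>1 - 1 / real m\<bar> \<le> 1 - 1 / m"
        using m by simp
    qed (use small I one_le nonneg ai m in auto)
    finally have "p (\<one> \<ominus> b) \<le> 1"
      by simp
    then have "p b = 0"
      using extreme_point b plus by blast
    then show ?thesis
      using ai m homogeneous[of "a i" "of_real (1 / m)"] by (simp add: b_def)
  qed
qed

text \<open>
  The compressions \<open>S\<^sub>j\<^sup>* P\<^sub>k S\<^sub>j\<close> of the range projections \<open>P\<^sub>k = S\<^sub>k S\<^sub>k\<^sup>*\<close> add up to \<open>S\<^sub>j\<^sup>* S\<^sub>j = 1\<close>, and the one with
  \<open>k = j\<close> is already \<open>1\<close>. So the other ones add up to \<open>0\<close>, and as they are positive, each vanishes;
  the one with \<open>k = i\<close> is the square of \<open>S\<^sub>i\<^sup>* S\<^sub>j\<close>.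
\<close>

lemma ranges_orthogonal:
  fixes n :: nat
  assumes S: "\<And>i. i < n \<Longrightarrow> S i \<in> carrier A" "\<And>i. i < n \<Longrightarrow> star A (S i) \<otimes> S i = \<one>"
    and sum: "asum (\<lambda>i. S i \<otimes> star A (S i)) {..<n} = \<one>"
    and ij: "i < n" "j < n" "i \<noteq> j"
  shows "p (star A (S i) \<otimes> S j) = 0"
proof -
  define P where "P i = S i \<otimes> star A (S i)" for i
  have P: "P i \<in> carrier A" "star A (P i) = P i" "star A (P i) \<otimes> P i = P i" if "i < n" for i
  proof -
    show "P i \<in> carrier A" "star A (P i) = P i"
      using S[OF that] by (simp_all add: P_def star_mult)
    have "P i \<otimes> P i = S i \<otimes> (star A (S i) \<otimes> S i) \<otimes> star A (S i)"
      using S(1)[OF that] by (simp add: P_def ring_rules)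
    then show "star A (P i) \<otimes> P i = P i"
      using S[OF that] \<open>star A (P i) = P i\<close> by (simp add: P_def)
  qed
  define a where "a i = star A (S j) \<otimes> P i \<otimes> S j" for i
  have Sj: "S j \<in> carrier A" "star A (S j) \<otimes> S j = \<one>" "p (S j) \<le> 1"
    using S ij isometry_le_one[of "S j"] one_le by auto
  have a: "a i \<in> carrier A" "star A (a i) = a i" if "i < n" for i
    using P[OF that] Sj by (simp_all add: a_def star_mult ring_rules)
  have "p (\<one> \<ominus> a i) \<le> 1" if "i < n" for i
  proof -
    have proj: "star A (\<one> \<ominus> P i) \<otimes> (\<one> \<ominus> P i) = \<one> \<ominus> P i"
      using P[OF that] by (simp add: star_add star_neg ring_rules)
    have "\<one> \<ominus> a i = star A (S j) \<otimes> (\<one> \<ominus> P i) \<otimes> S j"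
      using P[OF that] Sj by (simp add: a_def minus_eq ring_rules smult_mult_left smult_mult_right)
    then have "p (\<one> \<ominus> a i) \<le> p (star A (S j) \<otimes> (\<one> \<ominus> P i)) * p (S j)"
      using Sj P[OF that] by (simp add: submult)
    also have "\<dots> \<le> (p (star A (S j)) * p (\<one> \<ominus> P i)) * p (S j)"
      using Sj P[OF that] by (intro mult_right_mono submult nonneg) auto
    also have "\<dots> \<le> (1 * 1) * 1"
      using Sj P[OF that] projection_le_one[OF _ proj] by (intro mult_mono) (auto simp: nonneg)
    finally show ?thesis
      by simp
  qed
  moreover have "asum a ({..<n} - {j}) = \<zero>"
  proof -
    have "a j \<oplus> asum a ({..<n} - {j}) = asum a (insert j ({..<n} - {j}))"
      using a ij by (subst sum_insert) auto
    also have "insert j ({..<n} - {j}) = {..<n}"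
      using ij by auto
    also have "asum a {..<n} = star A (S j) \<otimes> asum P {..<n} \<otimes> S j"
      unfolding a_def using P Sj sum_mult_left[of "{..<n}" P "star A (S j)"]
        sum_mult_right[of "{..<n}" "\<lambda>i. star A (S j) \<otimes> P i" "S j"] by simp
    also have "\<dots> = \<one>"
      using sum Sj by (simp add: P_def[abs_def])
    also have "\<dots> = a j"
    proof -
      have "a j = (star A (S j) \<otimes> S j) \<otimes> (star A (S j) \<otimes> S j)"
        unfolding a_def P_def using Sj(1) by (simp add: ring_rules)
      then show ?thesis
        using Sj(2) by simp
    qed
    finally have "a j \<oplus> asum a ({..<n} - {j}) = a j" .
    moreover have "asum a ({..<n} - {j}) \<in> carrier A"
      using a by auto
    ultimately show ?thesis
      using a(1)[OF ij(2)] ring_rules by (metis neg_closed)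
  qed
  ultimately have "p (a i) = 0"
    using a ij by (intro zero_sum_of_positive[of "{..<n} - {j}"]) auto
  moreover have "a i = star A (star A (S i) \<otimes> S j) \<otimes> (star A (S i) \<otimes> S j)"
    using S ij by (simp add: a_def P_def star_mult ring_rules)
  ultimately show ?thesis
    using cstar_identity[of "star A (S i) \<otimes> S j"] S ij by simp
qed

end

section \<open>Cuntz families and normal forms\<close>

text \<open>
  A word of length \<open>m\<close> in \<open>n\<close> letters is encoded by the number \<open>j < n ^ m\<close> whose base-\<open>n\<close> digits
  are its letters.
\<close>

primrec digit_word ::
    "('a, 'm) star_algebra_scheme \<Rightarrow> nat \<Rightarrow> (nat \<Rightarrow> 'a) \<Rightarrow> nat \<Rightarrow> nat \<Rightarrow> 'a" where
  "digit_word A n S 0 j = \<one>\<^bsub>A\<^esub>"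
| "digit_word A n S (Suc m) j = digit_word A n S m (j div n) \<otimes>\<^bsub>A\<^esub> S (j mod n)"

text \<open>
  The product \<open>S\<^sub>\<mu> S\<^sub>\<nu>\<^sup>*\<close>, where the word \<open>\<mu>\<close> has length \<open>m\<close> and number \<open>j\<close>, and \<open>\<nu>\<close> has length \<open>L\<close> and
  number \<open>k\<close>.
\<close>

definition matrix_unit ::
    "('a, 'm) star_algebra_scheme \<Rightarrow> nat \<Rightarrow> (nat \<Rightarrow> 'a) \<Rightarrow> nat \<Rightarrow> nat \<times> nat \<times> nat \<Rightarrow> 'a" where
  "matrix_unit A n S L = (\<lambda>(m, j, k). digit_word A n S m j \<otimes>\<^bsub>A\<^esub> star A (digit_word A n S L k))"

definition unit_indices :: "nat \<Rightarrow> nat \<Rightarrow> (nat \<times> nat \<times> nat) set" where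
  "unit_indices n L = {(m, j, k). j < n ^ m \<and> k < n ^ L}"

locale generators = star_alg A
  for A :: "('a, 'm) star_algebra_scheme" (structure) +
  fixes n :: nat and S :: "nat \<Rightarrow> 'a"
  assumes n_pos: "n > 0"
    and S_closed [simp, intro]: "i < n \<Longrightarrow> S i \<in> carrier A"
begin

abbreviation "V \<equiv> digit_word A n S"
abbreviation "E \<equiv> matrix_unit A n S"

lemma V_closed [simp, intro]: "V m j \<in> carrier A"
  by (induction m arbitrary: j) (simp_all add: n_pos)

lemma E_closed [simp, intro]: "E L t \<in> carrier A"
  by (simp add: matrix_unit_def split: prod.split)

end

locale cuntz_family = generators A n S
  for A :: "('a, 'm) star_algebra_scheme" (structure) and n :: nat and S :: "nat \<Rightarrow> 'a" +
  assumes S_orth: "i < n \<Longrightarrow> j < n \<Longrightarrow> star A (S i) \<otimes> S j = (if i = j then \<one> else \<zero>)"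
    and S_sum: "asum (\<lambda>i. S i \<otimes> star A (S i)) {..<n} = \<one>"
begin

lemma div_less_power: "j < n ^ Suc m \<Longrightarrow> j div n < n ^ m"
  using n_pos by (simp add: less_mult_imp_div_less mult.commute)

lemma div_mod_eq_iff: "j div n = k div n \<and> j mod n = k mod n \<longleftrightarrow> j = k"
  by (metis div_mult_mod_eq)

lemma V_orth: "j < n ^ m \<Longrightarrow> k < n ^ m \<Longrightarrow> star A (V m j) \<otimes> V m k = (if j = k then \<one> else \<zero>)"
proof (induction m arbitrary: j k)
  case (Suc m)
  have mod: "j mod n < n" "k mod n < n"
    using n_pos by simp_all
  have "star A (V (Suc m) j) \<otimes> V (Suc m) k
      = star A (S (j mod n)) \<otimes> (star A (V m (j div n)) \<otimes> V m (k div n)) \<otimes> S (k mod n)"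
    using mod by (simp add: star_mult ring_rules)
  also have "\<dots> = (if j div n = k div n then star A (S (j mod n)) \<otimes> S (k mod n) else \<zero>)"
    using Suc.IH[OF div_less_power[OF Suc.prems(1)] div_less_power[OF Suc.prems(2)]] mod
    by (simp add: null_left null_right)
  also have "\<dots> = (if j = k then \<one> else \<zero>)"
    using S_orth[OF mod] div_mod_eq_iff[of j k] by auto
  finally show ?case .
qed (simp add: ring_rules)

text \<open>
  The recursion of \<open>digit_word\<close> appends letters on the right; on the left a letter becomes the leading
  digit.
\<close>

lemma S_V: "i < n \<Longrightarrow> j < n ^ m \<Longrightarrow> S i \<otimes> V m j = V (Suc m) (i * n ^ m + j)"
proof (induction m arbitrary: j)
  case 0
  then show ?case
    by (simp add: ring_rules)
next
  case (Suc m)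
  have "(i * n ^ Suc m + j) div n = i * n ^ m + j div n" "(i * n ^ Suc m + j) mod n = j mod n"
  proof -
    have "i * n ^ Suc m + j = j + n * (i * n ^ m)"
      by simp
    then show "(i * n ^ Suc m + j) div n = i * n ^ m + j div n" "(i * n ^ Suc m + j) mod n = j mod n"
      using n_pos by (simp_all only: div_mult_self2 mod_mult_self2)
  qed
  moreover have "S i \<otimes> V (Suc m) j = (S i \<otimes> V m (j div n)) \<otimes> S (j mod n)"
    using Suc.prems n_pos by (simp add: ring_rules)
  ultimately show ?case
    using Suc.IH[OF Suc.prems(1) div_less_power[OF Suc.prems(2)]] by simp
qed

lemma star_S_V:
  assumes "i < n" "j < n ^ Suc m"
  shows "star A (S i) \<otimes> V (Suc m) j = (if j div n ^ m = i then V m (j mod n ^ m) else \<zero>)"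
proof -
  have pos: "n ^ m > 0"
    using n_pos by simp
  have l: "j div n ^ m < n" "j mod n ^ m < n ^ m"
    using assms(2) pos by (simp_all add: less_mult_imp_div_less)
  have "V (Suc m) j = S (j div n ^ m) \<otimes> V m (j mod n ^ m)"
    using S_V[OF l] by (simp only: div_mult_mod_eq)
  then have "star A (S i) \<otimes> V (Suc m) j = (star A (S i) \<otimes> S (j div n ^ m)) \<otimes> V m (j mod n ^ m)"
    using assms(1) l by (simp add: ring_rules del: digit_word.simps)
  also have "\<dots> = (if j div n ^ m = i then V m (j mod n ^ m) else \<zero>)"
    using S_orth[OF assms(1) l(1)] by (auto simp: ring_rules null_left)
  finally show ?thesis .
qed

text \<open>Inserting the sum of the range projections in the middle refines a matrix unit.\<close>

lemma E_split:
  "E L (m, j, k) = asum (\<lambda>i. E (Suc L) (Suc m, n * j + i, n * k + i)) {..<n}"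
proof -
  have "V m j \<otimes> star A (V L k) = V m j \<otimes> asum (\<lambda>i. S i \<otimes> star A (S i)) {..<n} \<otimes> star A (V L k)"
    by (simp add: S_sum)
  also have "\<dots> = asum (\<lambda>i. V m j \<otimes> (S i \<otimes> star A (S i)) \<otimes> star A (V L k)) {..<n}"
    using sum_mult_left[of "{..<n}" "\<lambda>i. S i \<otimes> star A (S i)" "V m j"]
      sum_mult_right[of "{..<n}" "\<lambda>i. V m j \<otimes> (S i \<otimes> star A (S i))" "star A (V L k)"] by simp
  also have "\<dots> = asum (\<lambda>i. E (Suc L) (Suc m, n * j + i, n * k + i)) {..<n}"
    by (intro sum_cong) (auto simp: matrix_unit_def star_mult ring_rules)
  finally show ?thesis
    by (simp add: matrix_unit_def)
qed

lemma S_E: "i < n \<Longrightarrow> j < n ^ m \<Longrightarrow> S i \<otimes> E L (m, j, k) = E L (Suc m, i * n ^ m + j, k)"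
  using S_V[of i j m] by (simp add: matrix_unit_def ring_rules(5)[symmetric] del: digit_word.simps)

lemma star_S_E:
  assumes "i < n" "j < n ^ Suc m"
  shows "star A (S i) \<otimes> E L (Suc m, j, k) = (if j div n ^ m = i then E L (m, j mod n ^ m, k) else \<zero>)"
  using star_S_V[OF assms] assms(1)
  by (simp add: matrix_unit_def ring_rules(5)[symmetric] null_left del: digit_word.simps)

lemma V_star_V_mult:
  assumes "k < n ^ L" "k' < n ^ L"
  shows "(V L k \<otimes> star A (V L k)) \<otimes> (V L k' \<otimes> star A (V L k'))
    = (if k = k' then V L k \<otimes> star A (V L k) else \<zero>)"
proof -
  have "(V L k \<otimes> star A (V L k)) \<otimes> (V L k' \<otimes> star A (V L k'))
      = V L k \<otimes> (star A (V L k) \<otimes> V L k') \<otimes> star A (V L k')"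
    by (simp add: ring_rules)
  then show ?thesis
    using V_orth[OF assms] by (auto simp: null_left null_right)
qed

lemma E_star_E:
  assumes "j < n ^ m" "j' < n ^ m"
  shows "star A (E L (m, j, k)) \<otimes> E L (m, j', k')
    = (if j = j' then V L k \<otimes> star A (V L k') else \<zero>)"
proof -
  have "star A (E L (m, j, k)) \<otimes> E L (m, j', k') = V L k \<otimes> (star A (V m j) \<otimes> V m j') \<otimes> star A (V L k')"
    by (simp add: matrix_unit_def star_mult ring_rules)
  then show ?thesis
    using V_orth[OF assms] by (auto simp: null_left null_right)
qed

end

text \<open>
  The right length \<open>L\<close> is the same in all terms of a normal form, while the left length varies. This
  keeps the products \<open>E\<^sup>* E\<close> of terms with the same left length computable by \<open>E_star_E\<close>.
\<close>

definition combo ::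
    "('a, 'm) star_algebra_scheme \<Rightarrow> nat \<Rightarrow> (nat \<Rightarrow> 'a) \<Rightarrow> nat \<Rightarrow> (nat \<times> nat \<times> nat) set \<Rightarrow>
     (nat \<times> nat \<times> nat \<Rightarrow> complex) \<Rightarrow> 'a" where
  "combo A n S L T c = finsum A (\<lambda>t. c t \<odot>\<^bsub>A\<^esub> matrix_unit A n S L t) T"

locale cuntz_seminormed = cuntz_family A n S + cstar_seminormed A p
  for A :: "('a, 'm) star_algebra_scheme" (structure) and n S p
begin

text \<open>
  In a group of matrix units with fixed \<open>m\<close> and fixed difference \<open>j - k\<close> the index \<open>j\<close> determines
  \<open>k\<close> and conversely. A combination with unimodular coefficients is then a partial isometry, and
  any number of modulus at most \<open>K\<close> is \<open>K / 2\<close> times the sum of two unimodular ones.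
\<close>

lemma partial_isometry_le_one:
  assumes T: "finite T" "T \<subseteq> unit_indices n L"
    and group: "\<And>m j k m' j' k'. (m, j, k) \<in> T \<Longrightarrow> (m', j', k') \<in> T \<Longrightarrow>
      m = m' \<and> int j - int k = int j' - int k'"
    and z: "\<And>t. t \<in> T \<Longrightarrow> cmod (z t) = 1"
  shows "p (combo A n S L T z) \<le> 1"
proof -
  let ?w = "combo A n S L T z"
  define e where "e = (\<lambda>(m :: nat, j :: nat, k). V L k \<otimes> star A (V L k))"
  have e_closed: "e t \<in> carrier A" for t
    by (simp add: e_def split: prod.split)
  have star_E: "star A (E L t) \<otimes> E L t' = (if t = t' then e t else \<zero>)" if t: "t \<in> T" "t' \<in> T" for t t'
  proof -
    obtain m j k m' j' k' where eq: "t = (m, j, k)" "t' = (m', j', k')"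
      by (metis prod.collapse)
    have "m = m'" "j = j' \<longleftrightarrow> t = t'"
      using group[of m j k m' j' k'] t by (auto simp: eq)
    moreover have "j < n ^ m" "j' < n ^ m'"
      using t T(2) by (auto simp: eq unit_indices_def)
    ultimately show ?thesis
      using E_star_E[of j m j' L k k'] by (auto simp: eq e_def)
  qed
  have e_mult: "e t \<otimes> e t' = (if t = t' then e t else \<zero>)" if t: "t \<in> T" "t' \<in> T" for t t'
  proof -
    obtain m j k m' j' k' where eq: "t = (m, j, k)" "t' = (m', j', k')"
      by (metis prod.collapse)
    have "k = k' \<longleftrightarrow> t = t'"
      using group[of m j k m' j' k'] t by (auto simp: eq)
    moreover have "k < n ^ L" "k' < n ^ L"
      using t T(2) by (auto simp: eq unit_indices_def)
    ultimately show ?thesis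
      using V_star_V_mult[of k L k'] by (auto simp: eq e_def)
  qed
  have e_star: "star A (e t) = e t" for t
    by (simp add: e_def star_mult split: prod.split)
  have double: "asum f T \<otimes> asum g T = asum h T"
    if "\<And>t. t \<in> T \<Longrightarrow> f t \<in> carrier A" "\<And>t. t \<in> T \<Longrightarrow> g t \<in> carrier A" "\<And>t. t \<in> T \<Longrightarrow> h t \<in> carrier A"
      "\<And>t t'. t \<in> T \<Longrightarrow> t' \<in> T \<Longrightarrow> f t \<otimes> g t' = (if t' = t then h t' else \<zero>)" for f g h
  proof -
    have "asum f T \<otimes> asum g T = asum (\<lambda>t. f t \<otimes> asum g T) T"
      using that T(1) by (intro sum_mult_right) auto
    also have "\<dots> = asum h T"
    proof (rule sum_cong[OF refl])
      fix t assume t: "t \<in> T"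
      have "f t \<otimes> asum g T = asum (\<lambda>t'. f t \<otimes> g t') T"
        using that T(1) t by (intro sum_mult_left) auto
      also have "\<dots> = asum (\<lambda>t'. if t' = t then h t' else \<zero>) T"
        using that t by (intro sum_cong) auto
      also have "\<dots> = h t"
        using that T(1) t by (intro sum_delta) auto
      finally show "f t \<otimes> asum g T = h t" .
    qed (use that in auto)
    finally show ?thesis .
  qed
  have "star A ?w = asum (\<lambda>t. cnj (z t) \<odot> star A (E L t)) T"
    unfolding combo_def using T(1) by (simp add: sum_star star_smult)
  moreover have "asum (\<lambda>t. cnj (z t) \<odot> star A (E L t)) T \<otimes> ?w = asum e T"
    unfolding combo_def
  proof (rule double)
    fix t t' assume t: "t \<in> T" "t' \<in> T"
    have "cnj (z t) * z t = 1"
      using z[OF t(1)] complex_norm_square[of "z t"] by (simp add: mult.commute)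
    then show "cnj (z t) \<odot> star A (E L t) \<otimes> (z t' \<odot> E L t') = (if t' = t then e t' else \<zero>)"
      using star_E[OF t] e_closed[of t]
      by (auto simp: smult_mult_left smult_mult_right smult_smult mult.commute)
  qed (auto simp: e_closed)
  moreover have "p (asum e T) \<le> 1"
  proof (rule projection_le_one)
    show "star A (asum e T) \<otimes> asum e T = asum e T"
      using double[of e e e] e_closed e_mult T(1) by (simp add: sum_star e_star eq_commute)
  qed (use e_closed in auto)
  ultimately show ?thesis
    using isometry_le_one[of ?w] by (simp add: combo_def)
qed

lemma unimodular_mean:
  assumes "cmod c \<le> K"
  obtains z z' where "cmod z = 1" "cmod z' = 1" "c = of_real (K / 2) * z + of_real (K / 2) * z'"
proof (cases "K = 0")
  case True
  then show ?thesis
    using that[of 1 1] assms by simp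
next
  case False
  then have K: "K > 0"
    using assms norm_ge_zero[of c] by linarith
  define a where "a = cmod c / K"
  have a: "0 \<le> a" "a \<le> 1"
    using assms K by (simp_all add: a_def)
  \<comment> \<open>The point of the unit circle with real part \<open>a\<close>, so that \<open>u + cnj u = 2 a\<close>.\<close>
  define u where "u = Complex a (sqrt (1 - a\<^sup>2))"
  have "a\<^sup>2 \<le> 1"
    using a by (simp add: power_le_one)
  then have u: "cmod u = 1"
    by (simp add: u_def cmod_def)
  define s where "s = (if c = 0 then 1 else sgn c)"
  have s: "cmod s = 1" "c = of_real (cmod c) * s"
    by (simp_all add: s_def sgn_eq norm_divide)
  show ?thesis
  proof (rule that[of "s * u" "s * cnj u"])
    have "u + cnj u = of_real (2 * a)"
      by (simp add: u_def complex_eq_iff)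
    then have "of_real (K / 2) * (s * u) + of_real (K / 2) * (s * cnj u) = of_real (K / 2) * s * of_real (2 * a)"
      by (metis distrib_left mult.assoc)
    also have "\<dots> = of_real (cmod c) * s"
      using K by (simp add: a_def)
    finally show "c = of_real (K / 2) * (s * u) + of_real (K / 2) * (s * cnj u)"
      using s(2) by simp
  qed (use s u in \<open>simp_all add: norm_mult\<close>)
qed

lemma group_norm_le:
  assumes T: "finite T" "T \<subseteq> unit_indices n L"
    and group: "\<And>m j k m' j' k'. (m, j, k) \<in> T \<Longrightarrow> (m', j', k') \<in> T \<Longrightarrow>
      m = m' \<and> int j - int k = int j' - int k'"
    and c: "\<And>t. t \<in> T \<Longrightarrow> cmod (c t) \<le> K" and K: "K \<ge> 0"
  shows "p (combo A n S L T c) \<le> K"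
proof -
  have "\<forall>t\<in>T. \<exists>z z'. cmod z = 1 \<and> cmod z' = 1 \<and> c t = of_real (K / 2) * z + of_real (K / 2) * z'"
    using c unimodular_mean by metis
  then obtain z z' where z: "\<And>t. t \<in> T \<Longrightarrow> cmod (z t) = 1" "\<And>t. t \<in> T \<Longrightarrow> cmod (z' t) = 1"
    "\<And>t. t \<in> T \<Longrightarrow> c t = of_real (K / 2) * z t + of_real (K / 2) * z' t"
    by metis
  have closed: "combo A n S L T z \<in> carrier A" for z
    by (auto simp: combo_def)
  have "combo A n S L T c = asum (\<lambda>t. of_real (K / 2) \<odot> (z t \<odot> E L t) \<oplus> of_real (K / 2) \<odot> (z' t \<odot> E L t)) T"
    unfolding combo_def using z(3) by (intro sum_cong) (auto simp: smult_smult smult_add_left)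
  also have "\<dots> = of_real (K / 2) \<odot> combo A n S L T z \<oplus> of_real (K / 2) \<odot> combo A n S L T z'"
    unfolding combo_def using T(1) by (subst sum_add) (auto simp: sum_smult)
  also have "p \<dots> \<le> p (of_real (K / 2) \<odot> combo A n S L T z) + p (of_real (K / 2) \<odot> combo A n S L T z')"
    using closed by (intro triangle) auto
  also have "\<dots> = cmod (of_real (K / 2)) * p (combo A n S L T z)
      + cmod (of_real (K / 2)) * p (combo A n S L T z')"
    by (simp only: homogeneous[OF closed])
  also have "\<dots> = K / 2 * p (combo A n S L T z) + K / 2 * p (combo A n S L T z')"
    using K by (simp add: norm_divide)
  also have "\<dots> \<le> K / 2 * 1 + K / 2 * 1"
    using K z by (intro add_mono mult_left_mono partial_isometry_le_one[OF T group]) auto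
  finally show ?thesis
    by simp
qed

text \<open>
  One bound for each group of matrix units with fixed \<open>m\<close> and \<open>j - k\<close>. In the crossed product these
  groups are the group elements, so that the sum on the right becomes an \<open>l\<^sup>1\<close> norm.
\<close>

lemma combo_norm_le:
  assumes T: "finite T" "T \<subseteq> unit_indices n L"
    and c: "\<And>m j k. (m, j, k) \<in> T \<Longrightarrow> cmod (c (m, j, k)) \<le> K (m, int j - int k)"
    and K: "\<And>r. K r \<ge> 0"
  shows "p (combo A n S L T c) \<le> (\<Sum>r\<in>(\<lambda>(m, j, k). (m, int j - int k)) ` T. K r)"
proof -
  define key where "key = (\<lambda>(m :: nat, j, k). (m, int j - int k))"
  define part where "part r = {t \<in> T. key t = r}" for r
  have fin: "finite (part r)" for r
    using T(1) by (simp add: part_def)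
  have "bij_betw snd (Sigma (key ` T) part) T"
    by (rule bij_betwI[where g = "\<lambda>t. (key t, t)"]) (auto simp: part_def)
  then have "combo A n S L T c = asum (\<lambda>x. c (snd x) \<odot> E L (snd x)) (Sigma (key ` T) part)"
    unfolding combo_def by (intro sum_bij[symmetric]) auto
  also have "\<dots> = asum (\<lambda>r. combo A n S L (part r) c) (key ` T)"
    unfolding combo_def using T(1) fin by (subst sum_Sigma) (auto simp: case_prod_unfold)
  also have "p \<dots> \<le> (\<Sum>r\<in>key ` T. p (combo A n S L (part r) c))"
    using T(1) by (intro sum_le) (auto simp: combo_def)
  also have "\<dots> \<le> (\<Sum>r\<in>key ` T. K r)"
  proof (intro sum_mono group_norm_le)
    fix r assume "r \<in> key ` T"
    show "part r \<subseteq> unit_indices n L"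
      using T(2) by (auto simp: part_def)
    show "m = m' \<and> int j - int k = int j' - int k'" if "(m, j, k) \<in> part r" "(m', j', k') \<in> part r"
      for m j k m' j' k'
      using that by (auto simp: part_def key_def)
    show "cmod (c t) \<le> K r" if "t \<in> part r" for t
      using that c by (cases t) (auto simp: part_def key_def)
  qed (use fin K in auto)
  finally show ?thesis
    by (simp add: key_def)
qed

end

section \<open>The free star-algebra\<close>

definition word_star :: "('i \<times> bool) list \<Rightarrow> ('i \<times> bool) list" where
  "word_star w = rev (map (\<lambda>(i, e). (i, \<not> e)) w)"

definition splits :: "'a list \<Rightarrow> ('a list \<times> 'a list) set" where
  "splits w = {(u, v). u @ v = w}"

definition star_words :: "'i set \<Rightarrow> ('i \<times> bool) list set" where
  "star_words I = lists (I \<times> UNIV)"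

lemma star_words_simps [simp]:
  "[] \<in> star_words I" "l # w \<in> star_words I \<longleftrightarrow> fst l \<in> I \<and> w \<in> star_words I"
  "u @ v \<in> star_words I \<longleftrightarrow> u \<in> star_words I \<and> v \<in> star_words I"
  by (auto simp: star_words_def mem_Times_iff)

lemma word_star_word_star [simp]: "word_star (word_star w) = w"
  by (induction w) (auto simp: word_star_def)

lemma word_star_append [simp]: "word_star (u @ v) = word_star v @ word_star u"
  by (simp add: word_star_def)

lemma word_star_words [simp]: "word_star w \<in> star_words I \<longleftrightarrow> w \<in> star_words I"
  by (induction w) (auto simp: word_star_def)

lemma splits_image: "splits w = (\<lambda>k. (take k w, drop k w)) ` {..length w}"
proof
  show "splits w \<subseteq> (\<lambda>k. (take k w, drop k w)) ` {..length w}"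
  proof
    fix x assume "x \<in> splits w"
    then have "x = (\<lambda>k. (take k w, drop k w)) (length (fst x))" "length (fst x) \<le> length w"
      by (auto simp: splits_def)
    then show "x \<in> (\<lambda>k. (take k w, drop k w)) ` {..length w}"
      by blast
  qed
qed (auto simp: splits_def)

lemma finite_splits [simp]: "finite (splits w)"
  by (simp add: splits_image)

lemma sum_splits:
  fixes f :: "'a list \<Rightarrow> 'a list \<Rightarrow> complex"
  shows "(\<Sum>k\<le>length w. f (take k w) (drop k w)) = (\<Sum>(u, v)\<in>splits w. f u v)"
  by (rule sum.reindex_bij_witness[of _ "\<lambda>(u, v). length u" "\<lambda>k. (take k w, drop k w)"])
     (auto simp: splits_def)

context
  fixes I :: "'i set"
begin

abbreviation "F \<equiv> free_star_algebra I"

lemma free_carrier: "a \<in> carrier F \<longleftrightarrow> finite {w. a w \<noteq> 0} \<and> {w. a w \<noteq> 0} \<subseteq> star_words I"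
  by (simp add: free_star_algebra_def star_words_def)

lemma free_supportD: "a \<in> carrier F \<Longrightarrow> a w \<noteq> 0 \<Longrightarrow> w \<in> star_words I"
  by (auto simp: free_carrier)

lemma free_mult: "(a \<otimes>\<^bsub>F\<^esub> b) w = (\<Sum>(u, v)\<in>splits w. a u * b v)"
  by (simp add: free_star_algebra_def sum_splits[symmetric])

lemma free_simps:
  "\<one>\<^bsub>F\<^esub> = word []" "\<zero>\<^bsub>F\<^esub> w = 0" "(a \<oplus>\<^bsub>F\<^esub> b) w = a w + b w" "(c \<odot>\<^bsub>F\<^esub> a) w = c * a w"
  "star F a w = cnj (a (word_star w))"
  by (simp_all add: free_star_algebra_def word_star_def)

lemma free_mult_closed:
  assumes "a \<in> carrier F" "b \<in> carrier F"
  shows "a \<otimes>\<^bsub>F\<^esub> b \<in> carrier F"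
proof -
  have "{w. (a \<otimes>\<^bsub>F\<^esub> b) w \<noteq> 0} \<subseteq> (\<lambda>(u, v). u @ v) ` ({w. a w \<noteq> 0} \<times> {w. b w \<noteq> 0})"
  proof
    fix w assume "w \<in> {w. (a \<otimes>\<^bsub>F\<^esub> b) w \<noteq> 0}"
    then obtain x where "x \<in> splits w" "(case x of (u, v) \<Rightarrow> a u * b v) \<noteq> 0"
      by (force simp: free_mult elim: sum.not_neutral_contains_not_neutral)
    then show "w \<in> (\<lambda>(u, v). u @ v) ` ({w. a w \<noteq> 0} \<times> {w. b w \<noteq> 0})"
      by (force simp: splits_def)
  qed
  moreover have "finite ((\<lambda>(u, v). u @ v) ` ({w. a w \<noteq> 0} \<times> {w. b w \<noteq> 0}))"
    using assms by (simp add: free_carrier)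
  moreover have "(\<lambda>(u, v). u @ v) ` ({w. a w \<noteq> 0} \<times> {w. b w \<noteq> 0}) \<subseteq> star_words I"
    using assms free_supportD by auto
  ultimately show ?thesis
    unfolding free_carrier by (blast intro: finite_subset)
qed

text \<open>
  Both sides sum over the ways to cut a word into three pieces, in two steps.
\<close>

lemma free_mult_assoc: "(a \<otimes>\<^bsub>F\<^esub> b) \<otimes>\<^bsub>F\<^esub> c = a \<otimes>\<^bsub>F\<^esub> (b \<otimes>\<^bsub>F\<^esub> c)"
proof
  fix w
  have "((a \<otimes>\<^bsub>F\<^esub> b) \<otimes>\<^bsub>F\<^esub> c) w
      = (\<Sum>x\<in>splits w. \<Sum>y\<in>splits (fst x). a (fst y) * b (snd y) * c (snd x))"
    by (simp add: free_mult case_prod_unfold sum_distrib_right)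
  also have "\<dots> = (\<Sum>(x, y)\<in>Sigma (splits w) (\<lambda>x. splits (fst x)). a (fst y) * b (snd y) * c (snd x))"
    by (rule sum.Sigma) auto
  also have "\<dots> = (\<Sum>(x, y)\<in>Sigma (splits w) (\<lambda>x. splits (snd x)). a (fst x) * b (fst y) * c (snd y))"
    by (rule sum.reindex_bij_witness
          [of _ "\<lambda>(x, y). ((fst x @ fst y, snd y), (fst x, fst y))"
                "\<lambda>(x, y). ((fst y, snd y @ snd x), (snd y, snd x))"])
       (auto simp: splits_def)
  also have "\<dots> = (\<Sum>x\<in>splits w. \<Sum>y\<in>splits (snd x). a (fst x) * b (fst y) * c (snd y))"
    by (rule sum.Sigma[symmetric]) auto
  also have "\<dots> = (a \<otimes>\<^bsub>F\<^esub> (b \<otimes>\<^bsub>F\<^esub> c)) w"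
    by (simp add: free_mult case_prod_unfold sum_distrib_left mult.assoc)
  finally show "((a \<otimes>\<^bsub>F\<^esub> b) \<otimes>\<^bsub>F\<^esub> c) w = (a \<otimes>\<^bsub>F\<^esub> (b \<otimes>\<^bsub>F\<^esub> c)) w" .
qed

lemma free_word_mult: "(word u \<otimes>\<^bsub>F\<^esub> a) w = (if take (length u) w = u then a (drop (length u) w) else 0)"
proof -
  have "(word u \<otimes>\<^bsub>F\<^esub> a) w = (\<Sum>x\<in>splits w. if x = (u, drop (length u) w) then a (snd x) else 0)"
    unfolding free_mult by (intro sum.cong) (auto simp: word_def splits_def split: if_splits)
  also have "\<dots> = (if (u, drop (length u) w) \<in> splits w then a (drop (length u) w) else 0)"
    by simp
  also have "(u, drop (length u) w) \<in> splits w \<longleftrightarrow> take (length u) w = u"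
    by (metis (mono_tags, lifting) append_eq_conv_conj append_take_drop_id case_prod_conv mem_Collect_eq splits_def)
  finally show ?thesis .
qed

lemma free_mult_word_Nil: "a \<otimes>\<^bsub>F\<^esub> word [] = a"
proof
  fix w
  have "(a \<otimes>\<^bsub>F\<^esub> word []) w = (\<Sum>x\<in>splits w. if x = (w, []) then a (fst x) else 0)"
    unfolding free_mult by (intro sum.cong) (auto simp: word_def splits_def split: if_splits)
  also have "\<dots> = a w"
    by (simp add: sum.delta) (simp add: splits_def)
  finally show "(a \<otimes>\<^bsub>F\<^esub> word []) w = a w" .
qed

lemma word_mult: "word u \<otimes>\<^bsub>F\<^esub> word v = word (u @ v)"
proof
  fix w
  show "(word u \<otimes>\<^bsub>F\<^esub> word v) w = word (u @ v) w"
    unfolding free_word_mult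
    by (auto simp: word_def append_eq_conv_conj) (metis append_take_drop_id)
qed

lemma word_closed: "w \<in> star_words I \<Longrightarrow> word w \<in> carrier F"
  by (auto simp: free_carrier word_def)

lemma star_word: "star F (word w) = word (word_star w)"
  by (rule ext) (auto simp: free_simps word_def)

lemma free_star_mult: "star F (a \<otimes>\<^bsub>F\<^esub> b) = star F b \<otimes>\<^bsub>F\<^esub> star F a"
proof
  fix w
  have "star F (a \<otimes>\<^bsub>F\<^esub> b) w = (\<Sum>x\<in>splits (word_star w). cnj (a (fst x)) * cnj (b (snd x)))"
    by (simp add: free_simps free_mult case_prod_unfold)
  also have "\<dots> = (\<Sum>x\<in>splits w. cnj (b (word_star (fst x))) * cnj (a (word_star (snd x))))"
    by (rule sum.reindex_bij_witness
          [of _ "\<lambda>x. (word_star (snd x), word_star (fst x))" "\<lambda>x. (word_star (snd x), word_star (fst x))"])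
       (auto simp: splits_def simp flip: word_star_append)
  also have "\<dots> = (star F b \<otimes>\<^bsub>F\<^esub> star F a) w"
    by (simp add: free_simps free_mult case_prod_unfold)
  finally show "star F (a \<otimes>\<^bsub>F\<^esub> b) w = (star F b \<otimes>\<^bsub>F\<^esub> star F a) w" .
qed

lemma free_add_closed: "a \<in> carrier F \<Longrightarrow> b \<in> carrier F \<Longrightarrow> a \<oplus>\<^bsub>F\<^esub> b \<in> carrier F"
proof -
  assume a: "a \<in> carrier F" "b \<in> carrier F"
  have "{w. (a \<oplus>\<^bsub>F\<^esub> b) w \<noteq> 0} \<subseteq> {w. a w \<noteq> 0} \<union> {w. b w \<noteq> 0}"
    by (auto simp: free_simps)
  then show ?thesis
    using a unfolding free_carrier by (meson finite_UnI le_sup_iff order_trans rev_finite_subset)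
qed

lemma free_smult_closed: "a \<in> carrier F \<Longrightarrow> c \<odot>\<^bsub>F\<^esub> a \<in> carrier F"
proof -
  assume a: "a \<in> carrier F"
  have "{w. (c \<odot>\<^bsub>F\<^esub> a) w \<noteq> 0} \<subseteq> {w. a w \<noteq> 0}"
    by (auto simp: free_simps)
  then show ?thesis
    using a unfolding free_carrier by (meson finite_subset order_trans)
qed

lemma free_star_closed: "a \<in> carrier F \<Longrightarrow> star F a \<in> carrier F"
proof -
  assume a: "a \<in> carrier F"
  have "{w. star F a w \<noteq> 0} = word_star ` {w. a w \<noteq> 0}"
    by (force simp: free_simps image_iff)
  moreover have "word_star ` {w. a w \<noteq> 0} \<subseteq> star_words I"
    using free_supportD[OF a] by auto
  ultimately show ?thesis
    using a by (simp add: free_carrier)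
qed

lemma free_mult_one: "a \<otimes>\<^bsub>F\<^esub> \<one>\<^bsub>F\<^esub> = a"
  by (simp only: free_simps free_mult_word_Nil)

lemma free_star_algebra: "star_algebra F"
proof (rule star_algebraI)
  show "x \<oplus>\<^bsub>F\<^esub> y \<oplus>\<^bsub>F\<^esub> z = x \<oplus>\<^bsub>F\<^esub> (y \<oplus>\<^bsub>F\<^esub> z)" for x y z :: "'i free_star"
    by (simp add: fun_eq_iff free_simps)
  show "\<zero>\<^bsub>F\<^esub> \<in> carrier F" "\<one>\<^bsub>F\<^esub> \<in> carrier F"
    by (auto simp: free_carrier free_simps word_def)
  show "\<one>\<^bsub>F\<^esub> \<otimes>\<^bsub>F\<^esub> x = x" for x :: "'i free_star"
    by (simp add: fun_eq_iff free_simps free_word_mult)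
  show "x \<otimes>\<^bsub>F\<^esub> \<one>\<^bsub>F\<^esub> = x" for x :: "'i free_star"
    by (rule free_mult_one)
qed (auto simp: free_mult_closed free_mult_assoc free_star_mult free_add_closed free_smult_closed
       free_star_closed fun_eq_iff free_simps(2-) free_mult algebra_simps sum.distrib
       sum_distrib_left case_prod_unfold)

lemma free_alg: "star_alg F"
  by (rule star_alg.intro[OF free_star_algebra])

lemma free_induct [consumes 1, case_names zero add]:
  assumes a: "a \<in> carrier F"
    and zero: "Q \<zero>\<^bsub>F\<^esub>"
    and step: "\<And>c w x. w \<in> star_words I \<Longrightarrow> x \<in> carrier F \<Longrightarrow> Q x \<Longrightarrow> Q (c \<odot>\<^bsub>F\<^esub> word w \<oplus>\<^bsub>F\<^esub> x)"
  shows "Q a"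
proof -
  have "Q a" if "finite W" "a \<in> carrier F" "{w. a w \<noteq> 0} = W" for W a
    using that
  proof (induction W arbitrary: a rule: finite_induct)
    case empty
    then have "a = \<zero>\<^bsub>F\<^esub>"
      by (auto simp: fun_eq_iff free_simps)
    then show ?case
      using zero by simp
  next
    case (insert w W)
    let ?x = "a(w := 0)"
    have supp: "{v. ?x v \<noteq> 0} = W"
      using insert by auto
    have x: "?x \<in> carrier F" and w: "w \<in> star_words I"
      using insert supp by (auto simp: free_carrier)
    have "a = a w \<odot>\<^bsub>F\<^esub> word w \<oplus>\<^bsub>F\<^esub> ?x"
      by (auto simp: fun_eq_iff free_simps word_def)
    then show ?case
      using step[OF w x insert.IH[OF x supp], of "a w"] by (simp only:)
  qed
  then show ?thesis
    using a by (auto simp: free_carrier)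
qed

lemma generator_closed [simp]: "i \<in> I \<Longrightarrow> generator i \<in> carrier F"
  by (simp add: generator_def word_closed)

lemma star_generator: "star F (generator i) = word [(i, True)]"
  by (simp add: generator_def star_word word_star_def)

lemma word_Cons: "word ((i, e) # w) = (if e then star F (generator i) else generator i) \<otimes>\<^bsub>F\<^esub> word w"
  by (cases e) (simp_all add: star_generator word_mult, simp add: generator_def word_mult)

end

primrec word_value ::
    "('a, 'm) star_algebra_scheme \<Rightarrow> ('i \<Rightarrow> 'a) \<Rightarrow> ('i \<times> bool) list \<Rightarrow> 'a" where
  "word_value A S [] = \<one>\<^bsub>A\<^esub>"
| "word_value A S (l # w) = (if snd l then star A (S (fst l)) else S (fst l)) \<otimes>\<^bsub>A\<^esub> word_value A S w"

definition free_hom ::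
    "('a, 'm) star_algebra_scheme \<Rightarrow> ('i \<Rightarrow> 'a) \<Rightarrow> 'i free_star \<Rightarrow> 'a" where
  "free_hom A S a = finsum A (\<lambda>w. a w \<odot>\<^bsub>A\<^esub> word_value A S w) {w. a w \<noteq> 0}"

context star_alg
begin

context
  fixes I :: "'i set" and S
  assumes S: "\<And>i. i \<in> I \<Longrightarrow> S i \<in> carrier A"
begin

abbreviation "FI \<equiv> free_star_algebra I"
abbreviation "\<psi> \<equiv> free_hom A S"

lemma word_value_closed: "w \<in> star_words I \<Longrightarrow> word_value A S w \<in> carrier A"
  by (induction w) (auto simp: S)

lemma word_value_append:
  "u \<in> star_words I \<Longrightarrow> v \<in> star_words I \<Longrightarrow>
   word_value A S (u @ v) = word_value A S u \<otimes> word_value A S v"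
  by (induction u) (auto simp: S word_value_closed ring_rules(1-6))

lemma word_value_star:
  "w \<in> star_words I \<Longrightarrow> word_value A S (word_star w) = star A (word_value A S w)"
proof (induction w)
  case (Cons l w)
  obtain i e where l: "l = (i, e)" "i \<in> I" and w: "w \<in> star_words I"
    using Cons.prems by (cases l) auto
  have "word_star (l # w) = word_star w @ [(i, \<not> e)]"
    by (simp add: word_star_def l)
  moreover have "[(i, \<not> e)] \<in> star_words I" "word_star w \<in> star_words I"
    using l w by auto
  ultimately have "word_value A S (word_star (l # w))
      = star A (word_value A S w) \<otimes> word_value A S [(i, \<not> e)]"
    using Cons.IH[OF w] word_value_append by metis
  then show ?case
    using l w S word_value_closed by (simp add: star_mult)
qed (simp add: word_star_def)

lemma free_hom_superset:
  assumes "a \<in> carrier FI" "finite W" "{w. a w \<noteq> 0} \<subseteq> W"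
  shows "\<psi> a = asum (\<lambda>w. a w \<odot> word_value A S w) {w \<in> W. w \<in> star_words I}"
  unfolding free_hom_def
proof (rule sum_mono_neutral[symmetric])
  fix w assume "w \<in> {w \<in> W. w \<in> star_words I} - {w. a w \<noteq> 0}"
  then show "a w \<odot> word_value A S w = \<zero>"
    using word_value_closed by simp
qed (use assms word_value_closed free_supportD[OF assms(1)] in auto)

lemma free_hom_closed: "a \<in> carrier FI \<Longrightarrow> \<psi> a \<in> carrier A"
  using word_value_closed free_supportD[of a I] unfolding free_hom_def by (intro sum_closed) auto

lemma free_hom_zero: "\<psi> \<zero>\<^bsub>FI\<^esub> = \<zero>"
  by (simp add: free_hom_def free_simps)

lemma free_hom_add:
  assumes "a \<in> carrier FI" "b \<in> carrier FI"
  shows "\<psi> (a \<oplus>\<^bsub>FI\<^esub> b) = \<psi> a \<oplus> \<psi> b"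
proof -
  let ?W = "{w. a w \<noteq> 0} \<union> {w. b w \<noteq> 0}"
  have fin: "finite ?W"
    using assms by (auto simp: free_carrier)
  have ab: "\<psi> (a \<oplus>\<^bsub>FI\<^esub> b)
      = asum (\<lambda>w. (a \<oplus>\<^bsub>FI\<^esub> b) w \<odot> word_value A S w) {w \<in> ?W. w \<in> star_words I}"
    using assms fin by (intro free_hom_superset free_add_closed) (auto simp: free_simps)
  show ?thesis
    unfolding ab free_hom_superset[OF assms(1) fin Un_upper1] free_hom_superset[OF assms(2) fin Un_upper2]
    using word_value_closed by (subst sum_add[symmetric]) (auto intro!: sum_cong simp: free_simps smult_add_left)
qed

lemma free_hom_smult:
  assumes "a \<in> carrier FI"
  shows "\<psi> (c \<odot>\<^bsub>FI\<^esub> a) = c \<odot> \<psi> a"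
proof -
  let ?W = "{w. a w \<noteq> 0}"
  have fin: "finite ?W"
    using assms by (auto simp: free_carrier)
  have ca: "\<psi> (c \<odot>\<^bsub>FI\<^esub> a)
      = asum (\<lambda>w. (c \<odot>\<^bsub>FI\<^esub> a) w \<odot> word_value A S w) {w \<in> ?W. w \<in> star_words I}"
    using assms fin by (intro free_hom_superset free_smult_closed) (auto simp: free_simps)
  show ?thesis
    unfolding ca free_hom_superset[OF assms fin order_refl]
    using word_value_closed fin
    by (subst sum_smult) (auto intro!: sum_cong simp: free_simps smult_smult)
qed

lemma free_hom_word: "w \<in> star_words I \<Longrightarrow> \<psi> (word w) = word_value A S w"
proof -
  assume w: "w \<in> star_words I"
  have "{v. (word w :: 'i free_star) v \<noteq> 0} = {w}"
    by (auto simp: word_def)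
  then show ?thesis
    using word_value_closed[OF w] sum_insert[of "{}" w "\<lambda>v. word w v \<odot> word_value A S v"]
    by (simp add: free_hom_def ring_rules) (simp add: word_def ring_rules)
qed

lemma free_hom_generator: "i \<in> I \<Longrightarrow> \<psi> (generator i) = S i"
  using S by (simp add: generator_def free_hom_word ring_rules)

text \<open>
  The universal property of the free star-algebra: any choice of images of the generators extends.
\<close>

lemma free_hom_star_hom: "star_hom FI A \<psi>"
proof (rule star_homI[OF free_star_algebra star_algebra_A])
  interpret F: star_alg FI
    by (rule free_alg)
  have word_mult: "\<psi> (word u \<otimes>\<^bsub>FI\<^esub> b) = word_value A S u \<otimes> \<psi> b"
    if u: "u \<in> star_words I" and b: "b \<in> carrier FI" for u b
    using b
  proof (induction b rule: free_induct)
    case zero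
    then show ?case
      using word_closed[OF u] F.smult_mult_right[of "word u" "\<zero>\<^bsub>FI\<^esub>" 0] word_value_closed[OF u]
        smult_mult_right[of "word_value A S u" \<zero> 0] by (simp add: free_hom_zero)
  next
    case (add c w x)
    note closed = word_closed[OF u] word_closed[OF add(1)] add(2) word_value_closed[OF u]
      word_value_closed[OF add(1)] free_hom_closed[OF add(2)]
    have app: "\<psi> (word (u @ w)) = word_value A S u \<otimes> word_value A S w" "word (u @ w) \<in> carrier FI"
      using u add(1) by (simp_all add: free_hom_word word_value_append word_closed)
    have "\<psi> (word u \<otimes>\<^bsub>FI\<^esub> (c \<odot>\<^bsub>FI\<^esub> word w \<oplus>\<^bsub>FI\<^esub> x))
        = \<psi> (c \<odot>\<^bsub>FI\<^esub> word (u @ w) \<oplus>\<^bsub>FI\<^esub> word u \<otimes>\<^bsub>FI\<^esub> x)"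
      using closed app(2) by (simp add: F.ring_rules F.smult_mult_right word_mult)
    also have "\<dots> = c \<odot> (word_value A S u \<otimes> word_value A S w) \<oplus> word_value A S u \<otimes> \<psi> x"
      using closed app add by (simp add: free_hom_add free_hom_smult)
    also have "\<dots> = word_value A S u \<otimes> \<psi> (c \<odot>\<^bsub>FI\<^esub> word w \<oplus>\<^bsub>FI\<^esub> x)"
      using closed add(1) by (simp add: free_hom_add free_hom_smult free_hom_word ring_rules smult_mult_right)
    finally show ?case .
  qed
  have mult: "\<psi> (a \<otimes>\<^bsub>FI\<^esub> b) = \<psi> a \<otimes> \<psi> b" if a: "a \<in> carrier FI" and b: "b \<in> carrier FI" for a b
    using a
  proof (induction a rule: free_induct)
    case zero
    then show ?case
      using b F.smult_mult_left[of "\<zero>\<^bsub>FI\<^esub>" b 0] free_hom_closed[OF b]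
        smult_mult_left[of \<zero> "\<psi> b" 0] by (simp add: free_hom_zero)
  next
    case (add c w x)
    note closed = b word_closed[OF add(1)] add(2) word_value_closed[OF add(1)] free_hom_closed[OF b]
      free_hom_closed[OF add(2)]
    have "\<psi> ((c \<odot>\<^bsub>FI\<^esub> word w \<oplus>\<^bsub>FI\<^esub> x) \<otimes>\<^bsub>FI\<^esub> b)
        = \<psi> (c \<odot>\<^bsub>FI\<^esub> (word w \<otimes>\<^bsub>FI\<^esub> b) \<oplus>\<^bsub>FI\<^esub> x \<otimes>\<^bsub>FI\<^esub> b)"
      using closed by (simp add: F.ring_rules F.smult_mult_left)
    also have "\<dots> = c \<odot> (word_value A S w \<otimes> \<psi> b) \<oplus> \<psi> x \<otimes> \<psi> b"
      using closed add word_mult[OF add(1) b] by (simp add: free_hom_add free_hom_smult)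
    also have "\<dots> = \<psi> (c \<odot>\<^bsub>FI\<^esub> word w \<oplus>\<^bsub>FI\<^esub> x) \<otimes> \<psi> b"
      using closed add(1) by (simp add: free_hom_add free_hom_smult free_hom_word ring_rules smult_mult_left)
    finally show ?case .
  qed
  show "\<psi> \<in> ring_hom FI A"
    by (rule ring_hom_memI) (auto simp: free_hom_closed mult free_hom_add free_simps free_hom_word)
  show "\<psi> (star FI a) = star A (\<psi> a)" if "a \<in> carrier FI" for a
    using that
  proof (induction a rule: free_induct)
    case (add c w x)
    note closed = word_closed[OF add(1)] add(2) word_value_closed[OF add(1)] free_hom_closed[OF add(2)]
    have "word (word_star w) \<in> carrier FI"
      using add(1) by (simp add: word_closed)
    then show ?case
      using closed add
      by (simp add: F.star_add F.star_smult star_word free_hom_add free_hom_smult free_hom_word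
          word_value_star star_add star_smult)
  qed (simp add: free_hom_zero)
qed (rule free_hom_smult)

end

end

section \<open>Normal forms in representations of the Cuntz relations\<close>

(* The index set {1..n} of the generators is to keep this form. *)
declare One_nat_def [simp del]

lemma digit_bound:
  fixes i j n m :: nat
  shows "i < n \<Longrightarrow> j < n ^ m \<Longrightarrow> n * j + i < n ^ Suc m"
proof -
  assume "i < n" "j < n ^ m"
  then have "n * j + i < n * Suc j" "n * Suc j \<le> n * n ^ m"
    by (simp_all only: mult_le_mono2 Suc_leI) simp
  then show ?thesis
    by simp
qed

locale cuntz_rep = star_hom "free_star_algebra {1..n}" A \<psi> + cuntz_family A n "\<lambda>i. \<psi> (generator (Suc i))"
  for A :: "('a, 'm) star_algebra_scheme" (structure) and n :: nat and \<psi> :: "nat free_star \<Rightarrow> 'a"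
begin

abbreviation "FF \<equiv> free_star_algebra {1..n}"
abbreviation "SF \<equiv> \<lambda>i. generator (Suc i) :: nat free_star"

sublocale F: generators FF n SF
  using n_pos by (intro generators.intro generators_axioms.intro free_alg) auto

lemma hom_V: "\<psi> (F.V m j) = V m j"
  by (induction m arbitrary: j) (simp_all add: hom_one hom_mult n_pos)

lemma hom_E: "\<psi> (F.E L t) = E L t"
  by (cases t) (simp add: matrix_unit_def hom_mult hom_star hom_V)

lemma hom_combo: "finite T \<Longrightarrow> \<psi> (combo FF n SF L T c) = combo A n (\<lambda>i. \<psi> (SF i)) L T c"
  unfolding combo_def by (subst hom_sum) (auto simp: hom_smult hom_E)

lemma hom_E_split:
  "\<psi> (F.E L (m, j, k)) = \<psi> (finsum FF (\<lambda>i. F.E (Suc L) (Suc m, n * j + i, n * k + i)) {..<n})"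
  using E_split[of L m j k] by (subst hom_sum) (simp_all add: hom_E)

lemma hom_S_E:
  "i < n \<Longrightarrow> j < n ^ m \<Longrightarrow> \<psi> (SF i \<otimes>\<^bsub>FF\<^esub> F.E L (m, j, k)) = \<psi> (F.E L (Suc m, i * n ^ m + j, k))"
  using S_E[of i j m L k] by (simp add: hom_mult hom_E)

lemma hom_star_S_E:
  assumes i: "i < n" and j: "j < n ^ m"
  shows "\<psi> (star FF (SF i) \<otimes>\<^bsub>FF\<^esub> F.E L (m, j, k))
    = \<psi> (finsum FF (\<lambda>i'. if (n * j + i') div n ^ m = i
          then F.E (Suc L) (m, (n * j + i') mod n ^ m, n * k + i') else \<zero>\<^bsub>FF\<^esub>) {..<n})"
proof -
  let ?S = "\<lambda>i. \<psi> (SF i)"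
  have j': "n * j + i' < n ^ Suc m" if "i' < n" for i'
    by (rule digit_bound[OF that j])
  have "\<psi> (star FF (SF i) \<otimes>\<^bsub>FF\<^esub> F.E L (m, j, k))
      = star A (?S i) \<otimes> A.asum (\<lambda>i'. E (Suc L) (Suc m, n * j + i', n * k + i')) {..<n}"
    using i by (simp add: hom_mult hom_star hom_E flip: E_split)
  also have "\<dots> = A.asum (\<lambda>i'. star A (?S i) \<otimes> E (Suc L) (Suc m, n * j + i', n * k + i')) {..<n}"
    using i by (intro A.sum_mult_left) auto
  also have "\<dots> = A.asum (\<lambda>i'. if (n * j + i') div n ^ m = i
          then E (Suc L) (m, (n * j + i') mod n ^ m, n * k + i') else \<zero>) {..<n}"
    using star_S_E[OF i j'] by (intro A.sum_cong) auto
  also have "\<dots> = \<psi> (finsum FF (\<lambda>i'. if (n * j + i') div n ^ m = i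
          then F.E (Suc L) (m, (n * j + i') mod n ^ m, n * k + i') else \<zero>\<^bsub>FF\<^esub>) {..<n})"
    by (subst hom_sum) (auto intro!: A.sum_cong simp: hom_E hom_zero)
  finally show ?thesis .
qed

end

inductive_set normal_forms :: "nat \<Rightarrow> nat \<Rightarrow> nat free_star set" for n L where
  zero: "\<zero>\<^bsub>free_star_algebra {1..n}\<^esub> \<in> normal_forms n L"
| add: "y \<in> normal_forms n L \<Longrightarrow> t \<in> unit_indices n L \<Longrightarrow>
    c \<odot>\<^bsub>free_star_algebra {1..n}\<^esub> matrix_unit (free_star_algebra {1..n}) n (\<lambda>i. generator (Suc i)) L t
      \<oplus>\<^bsub>free_star_algebra {1..n}\<^esub> y \<in> normal_forms n L"

text \<open>
  Two representations are reduced simultaneously, because the reduction of an element of the free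
  algebra has to produce the same coefficients in both.
\<close>

locale two_cuntz_reps = r1: cuntz_rep A n \<psi>1 + r2: cuntz_rep B n \<psi>2
  for A :: "('a, 'm) star_algebra_scheme" and B :: "('b, 'k) star_algebra_scheme"
    and n :: nat and \<psi>1 \<psi>2
begin

abbreviation "F0 \<equiv> free_star_algebra {1..n}"
abbreviation "S0 \<equiv> \<lambda>i. generator (Suc i) :: nat free_star"
abbreviation "E0 \<equiv> matrix_unit F0 n S0"
abbreviation "NF \<equiv> normal_forms n"

definition same :: "nat free_star \<Rightarrow> nat free_star \<Rightarrow> bool" where
  "same x y \<longleftrightarrow> \<psi>1 x = \<psi>1 y \<and> \<psi>2 x = \<psi>2 y"

lemma same_add:
  "same x y \<Longrightarrow> same x' y' \<Longrightarrow> x \<in> carrier F0 \<Longrightarrow> y \<in> carrier F0 \<Longrightarrow> x' \<in> carrier F0 \<Longrightarrow>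
   y' \<in> carrier F0 \<Longrightarrow> same (x \<oplus>\<^bsub>F0\<^esub> x') (y \<oplus>\<^bsub>F0\<^esub> y')"
  by (simp add: same_def r1.hom_add r2.hom_add)

lemma same_smult:
  "same x y \<Longrightarrow> x \<in> carrier F0 \<Longrightarrow> y \<in> carrier F0 \<Longrightarrow> same (c \<odot>\<^bsub>F0\<^esub> x) (c \<odot>\<^bsub>F0\<^esub> y)"
  by (simp add: same_def r1.hom_smult r2.hom_smult)

lemma same_mult:
  "same x y \<Longrightarrow> z \<in> carrier F0 \<Longrightarrow> x \<in> carrier F0 \<Longrightarrow> y \<in> carrier F0 \<Longrightarrow>
   same (z \<otimes>\<^bsub>F0\<^esub> x) (z \<otimes>\<^bsub>F0\<^esub> y)"
  by (simp add: same_def r1.hom_mult r2.hom_mult)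

lemma same_trans: "same x y \<Longrightarrow> same y z \<Longrightarrow> same x z"
  by (simp add: same_def)

lemma same_refl: "same x x"
  by (simp add: same_def)

lemma NF_closed [simp]: "y \<in> NF L \<Longrightarrow> y \<in> carrier F0"
  by (induction rule: normal_forms.induct) auto

lemma NF_add: "x \<in> NF L \<Longrightarrow> y \<in> NF L \<Longrightarrow> x \<oplus>\<^bsub>F0\<^esub> y \<in> NF L"
proof (induction x rule: normal_forms.induct)
  case (add x t c)
  have "c \<odot>\<^bsub>F0\<^esub> E0 L t \<oplus>\<^bsub>F0\<^esub> x \<oplus>\<^bsub>F0\<^esub> y = c \<odot>\<^bsub>F0\<^esub> E0 L t \<oplus>\<^bsub>F0\<^esub> (x \<oplus>\<^bsub>F0\<^esub> y)"
    using add by (simp add: r1.B.ring_rules(1))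
  then show ?case
    using normal_forms.add[OF add.IH[OF add.prems] add.hyps(2)] by simp
qed (simp add: r1.B.ring_rules)

lemma NF_smult: "x \<in> NF L \<Longrightarrow> a \<odot>\<^bsub>F0\<^esub> x \<in> NF L"
proof (induction x rule: normal_forms.induct)
  case (add x t c)
  have "a \<odot>\<^bsub>F0\<^esub> (c \<odot>\<^bsub>F0\<^esub> E0 L t \<oplus>\<^bsub>F0\<^esub> x) = (a * c) \<odot>\<^bsub>F0\<^esub> E0 L t \<oplus>\<^bsub>F0\<^esub> a \<odot>\<^bsub>F0\<^esub> x"
    using add by (simp add: r1.B.smult_add_right r1.B.smult_smult)
  then show ?case
    using normal_forms.add[OF add.IH add.hyps(2)] by simp
qed (simp add: normal_forms.zero)

lemma NF_E: "t \<in> unit_indices n L \<Longrightarrow> E0 L t \<in> NF L"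
  using normal_forms.add[OF normal_forms.zero, of t n L 1] by (simp add: r1.B.ring_rules)

lemma NF_sum: "finite I \<Longrightarrow> (\<And>i. i \<in> I \<Longrightarrow> f i \<in> NF L) \<Longrightarrow> finsum F0 f I \<in> NF L"
proof (induction I rule: finite_induct)
  case (insert i I)
  have "f j \<in> carrier F0" if "j \<in> insert i I" for j
    using insert.prems[OF that] by (rule NF_closed)
  then show ?case
    using insert by (simp add: r1.B.sum_insert NF_add)
qed (simp add: normal_forms.zero)

text \<open>To transform a normal form it suffices to transform the matrix units in it.\<close>

lemma NF_transform:
  assumes y: "y \<in> NF L"
    and D: "D \<in> carrier F0"
    and unit: "\<And>t. t \<in> unit_indices n L \<Longrightarrow> \<exists>z\<in>NF L'. same (D \<otimes>\<^bsub>F0\<^esub> E0 L t) z"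
  shows "\<exists>z\<in>NF L'. same (D \<otimes>\<^bsub>F0\<^esub> y) z"
  using y
proof (induction y rule: normal_forms.induct)
  case zero
  have "D \<otimes>\<^bsub>F0\<^esub> \<zero>\<^bsub>F0\<^esub> = \<zero>\<^bsub>F0\<^esub>"
    using r1.B.smult_mult_right[of D "\<zero>\<^bsub>F0\<^esub>" 0] D by simp
  then show ?case
    using normal_forms.zero same_refl by (intro bexI[of _ "\<zero>\<^bsub>F0\<^esub>"]) simp_all
next
  case (add y t c)
  obtain z z' where z: "z \<in> NF L'" "same (D \<otimes>\<^bsub>F0\<^esub> y) z" "z' \<in> NF L'" "same (D \<otimes>\<^bsub>F0\<^esub> E0 L t) z'"
    using add.IH unit[OF add.hyps(2)] by blast
  have eq: "D \<otimes>\<^bsub>F0\<^esub> (c \<odot>\<^bsub>F0\<^esub> E0 L t \<oplus>\<^bsub>F0\<^esub> y) = c \<odot>\<^bsub>F0\<^esub> (D \<otimes>\<^bsub>F0\<^esub> E0 L t) \<oplus>\<^bsub>F0\<^esub> D \<otimes>\<^bsub>F0\<^esub> y"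
    using add D by (simp add: r1.B.ring_rules r1.B.smult_mult_right)
  show ?case
    unfolding eq using z add D
    by (intro bexI[of _ "c \<odot>\<^bsub>F0\<^esub> z' \<oplus>\<^bsub>F0\<^esub> z"] same_add same_smult NF_add NF_smult) auto
qed

lemma NF_raise:
  assumes "y \<in> NF L"
  shows "\<exists>z\<in>NF (Suc L). same y z"
proof -
  have "\<exists>z\<in>NF (Suc L). same (\<one>\<^bsub>F0\<^esub> \<otimes>\<^bsub>F0\<^esub> y) z"
  proof (rule NF_transform[OF assms])
    fix t assume t: "t \<in> unit_indices n L"
    obtain m j k where mjk: "t = (m, j, k)" "j < n ^ m" "k < n ^ L"
      using t by (cases t) (auto simp: unit_indices_def)
    let ?z = "finsum F0 (\<lambda>i. E0 (Suc L) (Suc m, n * j + i, n * k + i)) {..<n}"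
    have "?z \<in> NF (Suc L)"
    proof (rule NF_sum)
      fix i assume "i \<in> {..<n}"
      then show "E0 (Suc L) (Suc m, n * j + i, n * k + i) \<in> NF (Suc L)"
        using mjk digit_bound[of i n j m] digit_bound[of i n k L] by (intro NF_E) (auto simp: unit_indices_def)
    qed simp
    moreover have "same (\<one>\<^bsub>F0\<^esub> \<otimes>\<^bsub>F0\<^esub> E0 L t) ?z"
      using r1.hom_E_split[of L m j k] r2.hom_E_split[of L m j k] by (simp add: same_def mjk r1.B.ring_rules)
    ultimately show "\<exists>z\<in>NF (Suc L). same (\<one>\<^bsub>F0\<^esub> \<otimes>\<^bsub>F0\<^esub> E0 L t) z"
      by blast
  qed simp
  then show ?thesis
    using assms by (simp add: r1.B.ring_rules)
qed

lemma NF_raise_to: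
  assumes "y \<in> NF L" "L \<le> L'"
  shows "\<exists>z\<in>NF L'. same y z"
  using assms(2)
proof (induction L' rule: dec_induct)
  case base
  then show ?case
    using assms(1) same_refl by blast
next
  case (step L')
  then show ?case
    using NF_raise same_trans by blast
qed

text \<open>
  A generator in front lengthens the left words. An adjoint generator may meet an empty left word;
  after refining the matrix units the left words are nonempty, and it cancels or kills their first
  letter.
\<close>

lemma NF_left_generator:
  assumes y: "y \<in> NF L" and i: "i < n"
  shows "\<exists>z\<in>NF (Suc L). same ((if e then star F0 (S0 i) else S0 i) \<otimes>\<^bsub>F0\<^esub> y) z"
proof (cases e)
  case True
  have "\<exists>z\<in>NF (Suc L). same (star F0 (S0 i) \<otimes>\<^bsub>F0\<^esub> y) z"
  proof (rule NF_transform[OF y])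
    fix t assume t: "t \<in> unit_indices n L"
    obtain m j k where mjk: "t = (m, j, k)" "j < n ^ m" "k < n ^ L"
      using t by (cases t) (auto simp: unit_indices_def)
    let ?z = "finsum F0 (\<lambda>i'. if (n * j + i') div n ^ m = i
        then E0 (Suc L) (m, (n * j + i') mod n ^ m, n * k + i') else \<zero>\<^bsub>F0\<^esub>) {..<n}"
    have "?z \<in> NF (Suc L)"
    proof (rule NF_sum)
      fix i' assume "i' \<in> {..<n}"
      then show "(if (n * j + i') div n ^ m = i
          then E0 (Suc L) (m, (n * j + i') mod n ^ m, n * k + i') else \<zero>\<^bsub>F0\<^esub>) \<in> NF (Suc L)"
        using mjk digit_bound[of i' n k L] r1.n_pos
        by (auto intro!: NF_E normal_forms.zero simp: unit_indices_def)
    qed simp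
    moreover have "same (star F0 (S0 i) \<otimes>\<^bsub>F0\<^esub> E0 L t) ?z"
      using r1.hom_star_S_E[OF i mjk(2), of L k] r2.hom_star_S_E[OF i mjk(2), of L k]
      by (simp add: same_def mjk)
    ultimately show "\<exists>z\<in>NF (Suc L). same (star F0 (S0 i) \<otimes>\<^bsub>F0\<^esub> E0 L t) z"
      by blast
  qed (use i in auto)
  with True show ?thesis
    by simp
next
  case False
  have "\<exists>z\<in>NF L. same (S0 i \<otimes>\<^bsub>F0\<^esub> y) z"
  proof (rule NF_transform[OF y])
    fix t assume t: "t \<in> unit_indices n L"
    obtain m j k where mjk: "t = (m, j, k)" "j < n ^ m" "k < n ^ L"
      using t by (cases t) (auto simp: unit_indices_def)
    have "i * n ^ m + j < Suc i * n ^ m" "Suc i * n ^ m \<le> n * n ^ m"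
      using i mjk by (simp_all only: mult_le_mono1 Suc_leI) simp
    then have "i * n ^ m + j < n ^ Suc m"
      by simp
    then have "E0 L (Suc m, i * n ^ m + j, k) \<in> NF L"
      using mjk by (intro NF_E) (simp add: unit_indices_def)
    moreover have "same (S0 i \<otimes>\<^bsub>F0\<^esub> E0 L t) (E0 L (Suc m, i * n ^ m + j, k))"
      using r1.hom_S_E[OF i mjk(2), of L k] r2.hom_S_E[OF i mjk(2), of L k] by (simp add: same_def mjk)
    ultimately show "\<exists>z\<in>NF L. same (S0 i \<otimes>\<^bsub>F0\<^esub> E0 L t) z"
      by blast
  qed (use i in auto)
  with False show ?thesis
    using NF_raise same_trans by (simp del: r1.F.S_closed) blast
qed

lemma word_NF: "w \<in> star_words {1..n} \<Longrightarrow> \<exists>L. \<exists>z\<in>NF L. same (word w) z"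
proof (induction w)
  case Nil
  have "E0 0 (0, 0, 0) = word []"
    by (simp add: matrix_unit_def r1.B.ring_rules) (simp add: free_simps)
  moreover have "E0 0 (0, 0, 0) \<in> NF 0"
    by (rule NF_E) (simp add: unit_indices_def)
  ultimately show ?case
    using same_refl by auto
next
  case (Cons l w)
  obtain i e where l: "l = (Suc i, e)" "i < n"
    using Cons.prems by (cases l; cases "fst l") auto
  let ?g = "if e then star F0 (S0 i) else S0 i"
  have w: "w \<in> star_words {1..n}"
    using Cons.prems by simp
  then obtain L z where z: "z \<in> NF L" "same (word w) z"
    using Cons.IH by blast
  obtain z' where z': "z' \<in> NF (Suc L)" "same (?g \<otimes>\<^bsub>F0\<^esub> z) z'"
    using NF_left_generator[OF z(1) l(2)] by blast
  have "same (?g \<otimes>\<^bsub>F0\<^esub> word w) (?g \<otimes>\<^bsub>F0\<^esub> z)"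
    using z w l by (intro same_mult) (auto simp: word_closed)
  then show ?case
    unfolding l word_Cons[where I = "{1..n}"] using z' same_trans by blast
qed

lemma exists_NF: "x \<in> carrier F0 \<Longrightarrow> \<exists>L. \<exists>z\<in>NF L. same x z"
proof (induction x rule: free_induct)
  case zero
  then show ?case
    using normal_forms.zero same_refl by blast
next
  case (add c w x)
  obtain L z L' z' where z: "z \<in> NF L" "same x z" "z' \<in> NF L'" "same (word w) z'"
    using add.IH word_NF[OF add.hyps(1)] by blast
  obtain y y' where y: "y \<in> NF (max L L')" "same z y" "y' \<in> NF (max L L')" "same z' y'"
    using NF_raise_to[OF z(1), of "max L L'"] NF_raise_to[OF z(3), of "max L L'"] by auto
  have "same (c \<odot>\<^bsub>F0\<^esub> word w \<oplus>\<^bsub>F0\<^esub> x) (c \<odot>\<^bsub>F0\<^esub> y' \<oplus>\<^bsub>F0\<^esub> y)"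
    using z y add by (intro same_add same_smult) (auto intro: same_trans simp: word_closed)
  moreover have "c \<odot>\<^bsub>F0\<^esub> y' \<oplus>\<^bsub>F0\<^esub> y \<in> NF (max L L')"
    using y by (intro NF_add NF_smult)
  ultimately show ?case
    by blast
qed

lemma NF_combo: "y \<in> NF L \<Longrightarrow> \<exists>T c. finite T \<and> T \<subseteq> unit_indices n L \<and> y = combo F0 n S0 L T c"
proof (induction y rule: normal_forms.induct)
  case zero
  show ?case
    by (intro exI[of _ "{}"]) (simp add: combo_def)
next
  case (add y t c)
  obtain T d where T: "finite T" "T \<subseteq> unit_indices n L" "y = combo F0 n S0 L T d"
    using add.IH by blast
  define d' where "d' = d(t := c + (if t \<in> T then d t else 0))"
  have "combo F0 n S0 L (insert t T) d' = combo F0 n S0 L (insert t (T - {t})) d'"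
    by simp
  also have "\<dots> = d' t \<odot>\<^bsub>F0\<^esub> E0 L t \<oplus>\<^bsub>F0\<^esub> combo F0 n S0 L (T - {t}) d'"
    unfolding combo_def using T(1) by (subst r1.B.sum_insert) auto
  also have "combo F0 n S0 L (T - {t}) d' = combo F0 n S0 L (T - {t}) d"
    unfolding combo_def by (rule r1.B.sum_cong) (auto simp: d'_def)
  also have "d' t \<odot>\<^bsub>F0\<^esub> E0 L t \<oplus>\<^bsub>F0\<^esub> combo F0 n S0 L (T - {t}) d = c \<odot>\<^bsub>F0\<^esub> E0 L t \<oplus>\<^bsub>F0\<^esub> y"
  proof (cases "t \<in> T")
    case True
    have closed: "combo F0 n S0 L (T - {t}) d \<in> carrier F0"
      by (auto simp: combo_def)
    have "y = combo F0 n S0 L (insert t (T - {t})) d"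
      using True by (simp add: T(3) insert_absorb)
    also have "\<dots> = d t \<odot>\<^bsub>F0\<^esub> E0 L t \<oplus>\<^bsub>F0\<^esub> combo F0 n S0 L (T - {t}) d"
      unfolding combo_def using T(1) by (subst r1.B.sum_insert) auto
    finally show ?thesis
      using True closed by (simp add: d'_def r1.B.smult_add_left r1.B.ring_rules(1))
  qed (simp add: d'_def T(3))
  finally show ?case
    using T add.hyps(2) by (intro exI[of _ "insert t T"] exI[of _ d']) simp
qed

lemma common_normal_form:
  assumes "x \<in> carrier F0"
  obtains L T c where "finite T" "T \<subseteq> unit_indices n L"
    "\<psi>1 x = combo A n (\<lambda>i. \<psi>1 (S0 i)) L T c" "\<psi>2 x = combo B n (\<lambda>i. \<psi>2 (S0 i)) L T c"
proof -
  obtain L z where z: "z \<in> NF L" "same x z"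
    using exists_NF[OF assms] by blast
  obtain T c where T: "finite T" "T \<subseteq> unit_indices n L" "z = combo F0 n S0 L T c"
    using NF_combo[OF z(1)] by blast
  show ?thesis
    using that[OF T(1,2)] z(2) T(3) r1.hom_combo[OF T(1)] r2.hom_combo[OF T(1)]
    by (simp add: same_def)
qed

end

section \<open>Addresses in the Cantor space\<close>

text \<open>
  The address of level \<open>m\<close> of a point is the number of the \<open>n\<close>-adic interval of length \<open>1 / n ^ m\<close>
  in which the point lies; \<open>r\<^sup>-\<close> belongs to the interval that ends at \<open>r\<close>, and \<open>r\<^sup>+\<close> to the one
  that begins there. The action of the group is defined for all points of the doubled real line.
\<close>

definition addr :: "nat \<Rightarrow> nat \<Rightarrow> point \<Rightarrow> int" where
  "addr n m = (\<lambda>(x, s). if s = Below then \<lceil>x * of_nat n ^ m\<rceil> - 1 else \<lfloor>x * of_nat n ^ m\<rfloor>)"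

definition doubled_line :: "nat \<Rightarrow> point set" where
  "doubled_line n = {(x, s). s = Regular \<longleftrightarrow> x \<notin> adic_rationals n}"

locale adic =
  fixes n :: nat
  assumes n_ge_2: "n \<ge> 2"
begin

abbreviation "XX \<equiv> adic_cantor_set n"
abbreviation "Dbl \<equiv> doubled_line n"
abbreviation "G \<equiv> adic_group n"
abbreviation "act \<equiv> beta n"
abbreviation "ad \<equiv> addr n"

lemma n_pos: "n > 0" "real n > 0" "real n \<noteq> 0"
  using n_ge_2 by auto

lemma power_pos: "real n ^ m > 0"
  using n_pos by simp

lemma addr_iff:
  "ad m (x, s) = j \<longleftrightarrow> (if s = Below then of_int j < x * real n ^ m \<and> x * real n ^ m \<le> of_int j + 1
    else of_int j \<le> x * real n ^ m \<and> x * real n ^ m < of_int j + 1)"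
  by (auto simp: addr_def floor_eq_iff ceiling_eq_iff) linarith+

lemma addr_bounds:
  assumes "ad m p = j"
  shows "of_int j \<le> fst p * real n ^ m" "fst p * real n ^ m \<le> of_int j + 1"
  using assms addr_iff[of m "fst p" "snd p" j] by (auto split: if_splits)

lemma div_bounds:
  assumes "c div int n = q"
  shows "int n * q \<le> c" "c + 1 \<le> int n * (q + 1)"
    "real n * of_int q \<le> of_int c" "of_int c + 1 \<le> real n * (of_int q + 1)"
proof -
  have "c = int n * q + c mod int n"
    using assms by (metis mult_div_mod_eq)
  moreover have "0 \<le> c mod int n" "c mod int n < int n"
    using n_pos by simp_all
  ultimately show *: "int n * q \<le> c" "c + 1 \<le> int n * (q + 1)"
    by (simp_all only: distrib_left mult_1_right)
  from * have "of_int (int n * q) \<le> (of_int c :: real)" "of_int (c + 1) \<le> (of_int (int n * (q + 1)) :: real)"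
    by (simp_all only: of_int_le_iff)
  then show "real n * of_int q \<le> of_int c" "of_int c + 1 \<le> real n * (of_int q + 1)"
    by simp_all
qed

lemma addr_Suc: "ad (Suc m) p div int n = ad m p"
proof (cases p)
  case (Pair x s)
  define c where "c = ad (Suc m) p"
  define q where "q = c div int n"
  have q: "real n * of_int q \<le> of_int c" "of_int c + 1 \<le> real n * (of_int q + 1)"
    using div_bounds[of c q] by (simp_all add: q_def)
  have eq: "x * real n ^ Suc m = real n * (x * real n ^ m)"
    by simp
  have c: "if s = Below then of_int c < x * real n ^ Suc m \<and> x * real n ^ Suc m \<le> of_int c + 1
    else of_int c \<le> x * real n ^ Suc m \<and> x * real n ^ Suc m < of_int c + 1"
    using addr_iff[of "Suc m" x s c] by (simp add: c_def Pair)
  have "ad m p = q"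
    unfolding Pair addr_iff
  proof (cases "s = Below")
    case True
    then have "real n * of_int q < real n * (x * real n ^ m)" "real n * (x * real n ^ m) \<le> real n * (of_int q + 1)"
      using c q unfolding eq by simp_all
    then show "if s = Below then of_int q < x * real n ^ m \<and> x * real n ^ m \<le> of_int q + 1
        else of_int q \<le> x * real n ^ m \<and> x * real n ^ m < of_int q + 1"
      using True n_pos by (simp del: of_int_add)
  next
    case False
    then have "real n * of_int q \<le> real n * (x * real n ^ m)" "real n * (x * real n ^ m) < real n * (of_int q + 1)"
      using c q unfolding eq by simp_all
    then show "if s = Below then of_int q < x * real n ^ m \<and> x * real n ^ m \<le> of_int q + 1
        else of_int q \<le> x * real n ^ m \<and> x * real n ^ m < of_int q + 1"
      using False n_pos by (simp del: of_int_add)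
  qed
  then show ?thesis
    by (simp add: q_def c_def)
qed

lemma addr_div: "ad (m + k) p div int n ^ k = ad m p"
proof (induction k)
  case (Suc k)
  have "ad (m + Suc k) p div int n ^ Suc k = (ad (Suc (m + k)) p div int n) div int n ^ k"
    by (simp add: zdiv_zmult2_eq)
  then show ?case
    using Suc by (simp add: addr_Suc)
qed simp

lemma addr_coarser: "m \<le> m' \<Longrightarrow> ad m' p = ad m' q \<Longrightarrow> ad m p = ad m q"
  using addr_div[of m "m' - m" p] addr_div[of m "m' - m" q] by simp

lemma one_adic: "1 \<in> adic_rationals n"
proof -
  have "(1 :: real) = of_int 1 / of_nat n ^ 0"
    by simp
  then show ?thesis
    unfolding adic_rationals_def by blast
qed

lemma mem_X_iff: "p \<in> XX \<longleftrightarrow> p \<in> Dbl \<and> ad 0 p = 0"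
proof (cases p)
  case (Pair x s)
  have "x \<noteq> 0 \<and> x \<noteq> 1" if "x \<notin> adic_rationals n"
    using that adic_rationals_0 one_adic by metis
  then show ?thesis
    unfolding Pair addr_iff by (cases s) (auto simp: adic_cantor_set_def doubled_line_def)
qed

lemma X_in_D: "p \<in> XX \<Longrightarrow> p \<in> Dbl"
  by (simp add: mem_X_iff)

lemma addr_range:
  assumes "p \<in> XX"
  shows "0 \<le> ad m p" "ad m p < int n ^ m"
proof -
  have "ad m p div int n ^ m = 0"
    using addr_div[of 0 m p] assms by (simp add: mem_X_iff)
  then have "ad m p = ad m p mod int n ^ m"
    using div_mult_mod_eq[of "ad m p" "int n ^ m"] by simp
  moreover have "int n ^ m > 0"
    using n_pos by simp
  ultimately show "0 \<le> ad m p" "ad m p < int n ^ m"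
    by (metis pos_mod_sign, metis pos_mod_bound)
qed

lemma adic_integer:
  assumes "r \<in> adic_rationals n"
  obtains N where "\<And>m. m \<ge> N \<Longrightarrow> \<exists>e :: int. r * real n ^ m = of_int e"
proof -
  obtain a i where r: "r = of_int a / real n ^ i"
    using assms unfolding adic_rationals_def by auto
  have "r * real n ^ m = of_int (a * int n ^ (m - i))" if "m \<ge> i" for m
  proof -
    have "real n ^ m = real n ^ i * real n ^ (m - i)"
      using that by (simp flip: power_add)
    then show ?thesis
      using n_pos by (simp add: r)
  qed
  then show ?thesis
    using that by blast
qed

lemma integer_adic: "of_int e / real n ^ m \<in> adic_rationals n"
  unfolding adic_rationals_def by auto

subsection \<open>The group action\<close>

lemma act_pair: "act (r, k) (x, s) = (x / real n powi k + r, s)"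
  by (simp add: beta_def)

lemma G_group: "Group.group G"
  using n_ge_2 by (rule adic_group_group)

sublocale G: Group.group G
  by (rule G_group)

lemma act_mult: "act g (act h p) = act (g \<otimes>\<^bsub>G\<^esub> h) p"
  using n_pos
  by (cases g; cases h; cases p)
     (simp add: act_pair adic_group_def power_int_add add_divide_distrib mult.commute)

lemma act_one [simp]: "act \<one>\<^bsub>G\<^esub> p = p"
  by (cases p) (simp add: act_pair adic_group_def)

lemma act_inv [simp]: "g \<in> carrier G \<Longrightarrow> act g (act (inv\<^bsub>G\<^esub> g) p) = p"
  "g \<in> carrier G \<Longrightarrow> act (inv\<^bsub>G\<^esub> g) (act g p) = p"
  by (simp_all add: act_mult)

lemma adic_shift:
  assumes "r \<in> adic_rationals n"
  shows "x / real n powi k + r \<in> adic_rationals n \<longleftrightarrow> x \<in> adic_rationals n"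
proof
  assume "x / real n powi k + r \<in> adic_rationals n"
  then have "x / real n powi k + r + - r \<in> adic_rationals n"
    using adic_rationals_add[OF n_ge_2 _ adic_rationals_uminus[OF assms]] by blast
  then have "x / real n powi k \<in> adic_rationals n"
    by simp
  then have "(x / real n powi k) / real n powi (- k) \<in> adic_rationals n"
    by (rule adic_rationals_powi[OF n_ge_2])
  moreover have "(x / real n powi k) / real n powi (- k) = x"
    using n_pos by (simp add: power_int_minus)
  ultimately show "x \<in> adic_rationals n"
    by (simp only:)
next
  assume "x \<in> adic_rationals n"
  then show "x / real n powi k + r \<in> adic_rationals n"
    by (intro adic_rationals_add[OF n_ge_2] adic_rationals_powi[OF n_ge_2] assms)
qed

lemma act_D [simp]: "g \<in> carrier G \<Longrightarrow> act g p \<in> Dbl \<longleftrightarrow> p \<in> Dbl"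
  by (cases g; cases p) (auto simp: adic_group_def act_pair doubled_line_def adic_shift)

text \<open>
  A dilation shifts the level and a translation shifts the address, once the level is so fine that
  the translation is by a whole number of intervals.
\<close>

lemma addr_act:
  assumes "int m = k + int l" "r * real n ^ m = of_int e"
  shows "ad m (act (r, k) p) = ad l p + e"
proof (cases p)
  case (Pair x s)
  have "real n ^ m = real n powi (k + int l)"
    using assms(1) by (metis power_int_of_nat)
  also have "\<dots> = real n powi k * real n ^ l"
    using n_pos by (simp add: power_int_add)
  finally have "(x / real n powi k + r) * real n ^ m = x * real n ^ l + of_int e"
    using assms(2) n_pos by (simp add: distrib_right)
  then show ?thesis
    by (simp add: Pair act_pair addr_def)
qed

lemma act_uniform:
  assumes "g \<in> carrier G"
  obtains l where "\<And>p q. ad l p = ad l q \<Longrightarrow> ad m (act g p) = ad m (act g q)"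
proof -
  obtain r k where g: "g = (r, k)" "r \<in> adic_rationals n"
    using assms by (cases g) (auto simp: adic_group_def)
  obtain N where N: "\<And>m. m \<ge> N \<Longrightarrow> \<exists>e :: int. r * real n ^ m = of_int e"
    using adic_integer[OF g(2)] by blast
  define m' where "m' = m + N + nat k"
  define l where "l = nat (int m' - k)"
  obtain e :: int where e: "r * real n ^ m' = of_int e"
    using N[of m'] by (auto simp: m'_def)
  have l: "int m' = k + int l"
    by (simp add: l_def m'_def)
  show ?thesis
  proof (rule that)
    fix p q assume "ad l p = ad l q"
    then have "ad m' (act g p) = ad m' (act g q)"
      using addr_act[OF l e] by (simp add: g)
    then show "ad m (act g p) = ad m (act g q)"
      by (rule addr_coarser[rotated]) (simp add: m'_def)
  qed
qed

lemma ran_iff: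
  assumes "g \<in> carrier G"
  shows "y \<in> beta_ran n g \<longleftrightarrow> y \<in> XX \<and> act (inv\<^bsub>G\<^esub> g) y \<in> XX"
proof
  assume "y \<in> beta_ran n g"
  then show "y \<in> XX \<and> act (inv\<^bsub>G\<^esub> g) y \<in> XX"
    using assms by (auto simp: beta_ran_def beta_dom_def)
next
  assume "y \<in> XX \<and> act (inv\<^bsub>G\<^esub> g) y \<in> XX"
  then have "act (inv\<^bsub>G\<^esub> g) y \<in> beta_dom n g" "y = act g (act (inv\<^bsub>G\<^esub> g) y)"
    using assms by (auto simp: beta_dom_def)
  then show "y \<in> beta_ran n g"
    unfolding beta_ran_def by blast
qed

lemma dom_iff: "y \<in> beta_dom n g \<longleftrightarrow> y \<in> XX \<and> act g y \<in> XX"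
  by (auto simp: beta_dom_def)

lemma alpha_eq:
  assumes g: "g \<in> carrier G" and f: "\<And>y. f y \<noteq> 0 \<Longrightarrow> y \<in> XX"
  shows "alpha n g f y = (if y \<in> XX then f (act (inv\<^bsub>G\<^esub> g) y) else 0)"
proof (cases "y \<in> beta_ran n g")
  case True
  have "inj_on (act g) (beta_dom n g)"
    by (rule inj_on_inverseI[of _ "act (inv\<^bsub>G\<^esub> g)"]) (use g in simp)
  moreover have "act (inv\<^bsub>G\<^esub> g) y \<in> beta_dom n g"
    using True g by (simp add: dom_iff ran_iff)
  ultimately have "inv_into (beta_dom n g) (act g) (act g (act (inv\<^bsub>G\<^esub> g) y)) = act (inv\<^bsub>G\<^esub> g) y"
    by (rule inv_into_f_f)
  then show ?thesis
    using True g by (simp add: alpha_def ran_iff)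
next
  case False
  have "f (act (inv\<^bsub>G\<^esub> g) y) = 0" if "act (inv\<^bsub>G\<^esub> g) y \<notin> XX"
    using f that by blast
  then show ?thesis
    using False g by (auto simp: alpha_def ran_iff)
qed

subsection \<open>Continuity in terms of addresses\<close>

abbreviation "T \<equiv> adic_cantor_space n"

lemma zero_in_X: "(0, Above) \<in> XX" and one_in_X: "(1, Below) \<in> XX"
  using adic_rationals_0 one_adic by (auto simp: adic_cantor_set_def)

lemma topspace_T: "topspace T = XX"
proof
  show "topspace T \<subseteq> XX"
    by (auto simp: adic_cantor_space_def topology_generated_by_topspace)
  show "XX \<subseteq> topspace T"
  proof
    fix p assume p: "p \<in> XX"
    then have "point_less (0, Above) p \<or> point_less p (1, Below)"
      by (cases p) (auto simp: point_less_def adic_cantor_set_def)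
    then show "p \<in> topspace T"
      using p zero_in_X one_in_X
      unfolding adic_cantor_space_def topology_generated_by_topspace by blast
  qed
qed

text \<open>
  Rays that begin or end at an \<open>n\<close>-adic point are described by addresses. This makes cylinders open,
  and it provides cylinders inside a ray whose endpoint has the same real value as a given point.
\<close>

lemma less_adic_iff:
  assumes "q \<in> Dbl"
  shows "point_less (of_int e / real n ^ m, Below) q \<longleftrightarrow> e \<le> ad m q"
    and "point_less q (of_int e / real n ^ m, Above) \<longleftrightarrow> ad m q < e"
proof -
  obtain x s where q: "q = (x, s)"
    by (cases q)
  define j where "j = ad m (x, s)"
  have j: "if s = Below then of_int j < x * real n ^ m \<and> x * real n ^ m \<le> of_int j + 1
    else of_int j \<le> x * real n ^ m \<and> x * real n ^ m < of_int j + 1"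
    using addr_iff[of m x s j] by (simp add: j_def)
  have ej: "e \<le> j \<longleftrightarrow> real_of_int e \<le> of_int j" "e \<le> j \<longleftrightarrow> real_of_int e < of_int j + 1"
    using of_int_less_iff[of e "j + 1", where 'a = real] by auto
  have le: "e \<le> j \<longleftrightarrow> (if s = Below then of_int e < x * real n ^ m else of_int e \<le> x * real n ^ m)"
  proof (cases "s = Below")
    case True
    then have "of_int j < x * real n ^ m" "x * real n ^ m \<le> of_int j + 1"
      using j by simp_all
    then have "e \<le> j \<longleftrightarrow> of_int e < x * real n ^ m"
      using ej by (metis less_le_trans le_less_trans)
    with True show ?thesis
      by simp
  next
    case False
    then have "of_int j \<le> x * real n ^ m" "x * real n ^ m < of_int j + 1"
      using j by simp_all
    then have "e \<le> j \<longleftrightarrow> of_int e \<le> x * real n ^ m"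
      using ej by (metis order_trans le_less_trans)
    with False show ?thesis
      by simp
  qed
  have less: "point_less (of_int e / real n ^ m, Below) (x, s)
      \<longleftrightarrow> of_int e < x * real n ^ m \<or> of_int e = x * real n ^ m \<and> s = Above"
    "point_less (x, s) (of_int e / real n ^ m, Above)
      \<longleftrightarrow> x * real n ^ m < of_int e \<or> of_int e = x * real n ^ m \<and> s = Below"
    using power_pos[of m] by (auto simp: point_less_def divide_less_eq less_divide_eq divide_eq_eq eq_divide_eq)
  have reg: "s \<noteq> Regular" if "of_int e = x * real n ^ m"
  proof -
    have "x = of_int e / real n ^ m"
      using that power_pos[of m] by (simp add: eq_divide_eq)
    then show ?thesis
      using assms integer_adic[of e m] by (auto simp: q doubled_line_def)
  qed
  show "point_less (of_int e / real n ^ m, Below) q \<longleftrightarrow> e \<le> ad m q"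
    unfolding q less j_def[symmetric] le using reg by (cases s) (auto simp: le_less)
  have "ad m q < e \<longleftrightarrow> \<not> e \<le> ad m q"
    by auto
  then show "point_less q (of_int e / real n ^ m, Above) \<longleftrightarrow> ad m q < e"
    unfolding q less j_def[symmetric] le using reg by (cases s) (auto simp: le_less)
qed

lemma openin_ray:
  assumes "a \<in> XX"
  shows "openin T {x \<in> XX. point_less a x}" "openin T {x \<in> XX. point_less x a}"
  unfolding adic_cantor_space_def by (rule topology_generated_by_Basis, use assms in blast)+

lemma openin_cylinder: "openin T {q \<in> XX. ad m q = j}"
proof -
  have ge: "openin T {q \<in> XX. e \<le> ad m q}" for e
  proof -
    consider "e \<le> 0" | "e > int n ^ m" | "0 < e" "e \<le> int n ^ m"
      by linarith
    then show ?thesis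
    proof cases
      case 1
      then have "{q \<in> XX. e \<le> ad m q} = topspace T"
        using addr_range(1)[where m = m] by (auto simp: topspace_T intro: order_trans)
      then show ?thesis
        by (simp only: openin_topspace openin_empty)
    next
      case 2
      then have "\<not> e \<le> ad m q" if "q \<in> XX" for q
        using addr_range(2)[OF that, of m] by linarith
      then have "{q \<in> XX. e \<le> ad m q} = {}"
        by blast
      then show ?thesis
        by (simp only: openin_topspace openin_empty)
    next
      case 3
      have "of_int e \<le> real n ^ m"
        using 3(2) by (metis of_int_le_iff of_int_of_nat_eq of_int_power)
      then have "(of_int e / real n ^ m, Below) \<in> XX"
        using 3 integer_adic[of e m] power_pos[of m] by (auto simp: adic_cantor_set_def field_simps)
      from openin_ray(1)[OF this] show ?thesis
        using less_adic_iff(1) X_in_D by (simp cong: conj_cong)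
    qed
  qed
  have lt: "openin T {q \<in> XX. ad m q < e}" for e
  proof -
    consider "e \<le> 0" | "e \<ge> int n ^ m" | "0 < e" "e < int n ^ m"
      by linarith
    then show ?thesis
    proof cases
      case 1
      then have "\<not> ad m q < e" if "q \<in> XX" for q
        using addr_range(1)[OF that, of m] by linarith
      then have "{q \<in> XX. ad m q < e} = {}"
        by blast
      then show ?thesis
        by (simp only: openin_topspace openin_empty)
    next
      case 2
      then have "{q \<in> XX. ad m q < e} = topspace T"
        using addr_range(2)[where m = m] by (auto simp: topspace_T intro: less_le_trans)
      then show ?thesis
        by (simp only: openin_topspace openin_empty)
    next
      case 3
      have "of_int e < real n ^ m"
        using 3(2) by (metis of_int_less_iff of_int_of_nat_eq of_int_power)
      then have "(of_int e / real n ^ m, Above) \<in> XX"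
        using 3 integer_adic[of e m] power_pos[of m] by (auto simp: adic_cantor_set_def field_simps)
      from openin_ray(2)[OF this] show ?thesis
        using less_adic_iff(2) X_in_D by (simp cong: conj_cong)
    qed
  qed
  have "{q \<in> XX. ad m q = j} = {q \<in> XX. j \<le> ad m q} \<inter> {q \<in> XX. ad m q < j + 1}"
    by auto
  then show ?thesis
    using ge[of j] lt[of "j + 1"] by (simp add: openin_Int)
qed

lemma power_small:
  assumes "e > 0"
  obtains m where "1 / real n ^ m < e"
proof -
  obtain m where "1 / e < real n ^ m"
    using real_arch_pow[of "real n" "1 / e"] n_ge_2 by auto
  then have "1 / real n ^ m < e"
    using assms power_pos[of m] by (simp add: divide_less_eq mult.commute)
  then show ?thesis
    by (rule that)
qed

lemma same_addr_close:
  assumes "ad m p = ad m q"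
  shows "\<bar>fst p - fst q\<bar> \<le> 1 / real n ^ m"
proof -
  have "\<bar>fst p * real n ^ m - fst q * real n ^ m\<bar> \<le> 1"
    using addr_bounds[OF assms] addr_bounds[of m q, OF refl] by linarith
  then have "\<bar>fst p - fst q\<bar> * real n ^ m \<le> 1"
    using power_pos[of m] by (simp add: abs_mult flip: left_diff_distrib)
  then show ?thesis
    using power_pos[of m] by (simp add: field_simps)
qed

lemma ray_contains_cylinder:
  assumes "p \<in> XX" "a \<in> XX"
  shows "point_less a p \<Longrightarrow> \<exists>m. \<forall>q\<in>XX. ad m q = ad m p \<longrightarrow> point_less a q"
    and "point_less p a \<Longrightarrow> \<exists>m. \<forall>q\<in>XX. ad m q = ad m p \<longrightarrow> point_less q a"
proof -
  have apart: "\<exists>m. \<forall>q\<in>XX. ad m q = ad m p \<longrightarrow> \<bar>fst p - fst q\<bar> < \<bar>fst p - fst a\<bar>" if ne: "fst a \<noteq> fst p"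
  proof -
    have "\<bar>fst p - fst a\<bar> > 0"
      using ne by simp
    then obtain m where "1 / real n ^ m < \<bar>fst p - fst a\<bar>"
      using power_small by blast
    then show ?thesis
      using same_addr_close[of m p] by (metis le_less_trans)
  qed
  have split: "\<exists>m e. fst p = of_int e / real n ^ m" if "snd p \<noteq> Regular"
  proof -
    have "fst p \<in> adic_rationals n"
      using that assms(1) by (cases p) (auto simp: adic_cantor_set_def split: if_splits)
    then show ?thesis
      unfolding adic_rationals_def by auto
  qed
  show "\<exists>m. \<forall>q\<in>XX. ad m q = ad m p \<longrightarrow> point_less a q" if less: "point_less a p"
  proof (cases "fst a = fst p")
    case True
    then have s: "snd a = Below" "snd p = Above"
      using less by (auto simp: point_less_def)
    then obtain m e where e: "fst p = of_int e / real n ^ m"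
      using split by auto
    have "a = (of_int e / real n ^ m, Below)"
      using True s e by (simp add: prod_eq_iff)
    then show ?thesis
      using less less_adic_iff(1)[OF X_in_D] assms(1) by (intro exI[of _ m]) auto
  next
    case False
    then obtain m where m: "\<forall>q\<in>XX. ad m q = ad m p \<longrightarrow> \<bar>fst p - fst q\<bar> < \<bar>fst p - fst a\<bar>"
      using apart by blast
    have "fst a < fst p"
      using less False by (auto simp: point_less_def)
    then show ?thesis
      using m by (intro exI[of _ m]) (force simp: point_less_def)
  qed
  show "\<exists>m. \<forall>q\<in>XX. ad m q = ad m p \<longrightarrow> point_less q a" if less: "point_less p a"
  proof (cases "fst a = fst p")
    case True
    then have s: "snd a = Above" "snd p = Below"
      using less by (auto simp: point_less_def)
    then obtain m e where e: "fst p = of_int e / real n ^ m"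
      using split by auto
    have "a = (of_int e / real n ^ m, Above)"
      using True s e by (simp add: prod_eq_iff)
    then show ?thesis
      using less less_adic_iff(2)[OF X_in_D] assms(1) by (intro exI[of _ m]) auto
  next
    case False
    then obtain m where m: "\<forall>q\<in>XX. ad m q = ad m p \<longrightarrow> \<bar>fst p - fst q\<bar> < \<bar>fst p - fst a\<bar>"
      using apart by blast
    have "fst p < fst a"
      using less False by (auto simp: point_less_def)
    then show ?thesis
      using m by (intro exI[of _ m]) (force simp: point_less_def)
  qed
qed

text \<open>
  Together with \<open>openin_cylinder\<close>: the cylinders around a point form a neighbourhood base.
\<close>

lemma open_contains_cylinder:
  assumes "openin T U" "p \<in> U"
  shows "\<exists>m. \<forall>q\<in>XX. ad m q = ad m p \<longrightarrow> q \<in> U"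
proof -
  let ?S = "{{x \<in> XX. point_less a x} | a. a \<in> XX} \<union> {{x \<in> XX. point_less x a} | a. a \<in> XX}"
  have "generate_topology_on ?S U"
    using assms(1) by (simp add: adic_cantor_space_def openin_topology_generated_by_iff)
  then show ?thesis
    using assms(2)
  proof (induction arbitrary: p rule: generate_topology_on.induct)
    case (Int U V)
    obtain m where m: "\<forall>q\<in>XX. ad m q = ad m p \<longrightarrow> q \<in> U"
      using Int.IH(1)[of p] Int.prems by blast
    obtain m' where m': "\<forall>q\<in>XX. ad m' q = ad m' p \<longrightarrow> q \<in> V"
      using Int.IH(2)[of p] Int.prems by blast
    have "q \<in> U \<inter> V" if "q \<in> XX" "ad (max m m') q = ad (max m m') p" for q
      using m m' that addr_coarser[of m "max m m'" q p] addr_coarser[of m' "max m m'" q p] by simp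
    then show ?case
      by blast
  next
    case (UN K)
    then obtain V where V: "V \<in> K" "p \<in> V"
      by blast
    from UN.IH[OF V] show ?case
      using V(1) by blast
  next
    case (Basis V)
    then consider a where "a \<in> XX" "V = {x \<in> XX. point_less a x}"
      | a where "a \<in> XX" "V = {x \<in> XX. point_less x a}"
      by blast
    then show ?case
    proof cases
      case 1
      then have "p \<in> XX" "point_less a p"
        using Basis.prems by simp_all
      from ray_contains_cylinder(1)[OF this(1) 1(1) this(2)] show ?thesis
        by (simp add: 1(2))
    next
      case 2
      then have "p \<in> XX" "point_less p a"
        using Basis.prems by simp_all
      from ray_contains_cylinder(2)[OF this(1) 2(1) this(2)] show ?thesis
        by (simp add: 2(2))
    qed
  qed simp
qed

text \<open>
  The nested intervals meet in a single real number \<open>x\<close>. If \<open>x\<close> is the right end of one of them, then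
  of all finer ones, and the point is \<open>x\<^sup>-\<close>; otherwise it is \<open>x\<^sup>+\<close> or, if \<open>x\<close> is not \<open>n\<close>-adic, \<open>x\<close> itself.
\<close>

lemma nested_addresses:
  assumes j0: "j 0 = (0 :: int)" and step: "\<And>m. j (Suc m) div int n = j m"
  shows "\<exists>p\<in>XX. \<forall>m. ad m p = j m"
proof -
  define lo where "lo m = of_int (j m) / real n ^ m" for m
  define hi where "hi m = (of_int (j m) + 1) / real n ^ m" for m
  have "lo m \<le> lo (Suc m)" "hi (Suc m) \<le> hi m" for m
  proof -
    show "lo m \<le> lo (Suc m)"
    proof -
      have "of_int (j m) \<le> of_int (j (Suc m)) / real n"
        using n_pos div_bounds(3)[OF step[of m]] by (simp add: le_divide_eq mult.commute)
      from divide_right_mono[OF this, of "real n ^ m"] show ?thesis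
        by (simp add: lo_def)
    qed
    have "(of_int (j (Suc m)) + 1) / real n \<le> of_int (j m) + 1"
      using n_pos div_bounds(4)[OF step[of m]] by (simp add: divide_le_eq mult.commute)
    from divide_right_mono[OF this, of "real n ^ m"] show "hi (Suc m) \<le> hi m"
      by (simp add: hi_def)
  qed
  note Suc_steps = this
  have mono: "lo m \<le> lo m'" "hi m' \<le> hi m" if "m \<le> m'" for m m'
    by (rule lift_Suc_mono_le[of lo, OF Suc_steps(1) that])
       (rule lift_Suc_antimono_le[of hi, OF Suc_steps(2) that])
  have le: "lo m \<le> hi m" for m
    using power_pos[of m] by (simp add: lo_def hi_def divide_right_mono)
  have lo_hi: "lo m \<le> hi m'" for m m'
    using mono[of m "max m m'"] mono[of m' "max m m'"] le[of "max m m'"] by linarith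
  define x where "x = (SUP m. lo m)"
  have bdd: "bdd_above (range lo)"
    using lo_hi by (intro bdd_aboveI[of _ "hi 0"]) auto
  have lo_x: "lo m \<le> x" for m
    unfolding x_def by (intro cSUP_upper bdd) simp
  have x_hi: "x \<le> hi m" for m
    unfolding x_def by (intro cSUP_least lo_hi) simp
  have scale: "of_int (j m) \<le> x * real n ^ m" "x * real n ^ m \<le> of_int (j m) + 1" for m
    using lo_x[of m] x_hi[of m]
    by (simp_all add: lo_def hi_def pos_divide_le_eq[OF power_pos] pos_le_divide_eq[OF power_pos])
  have XX: "p \<in> XX" if "p \<in> Dbl" "ad 0 p = j 0" for p
    using that j0 by (simp add: mem_X_iff)
  show ?thesis
  proof (cases "\<exists>m. x = hi m")
    case True
    then obtain m where m: "x = hi m"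
      by blast
    have "lo m' \<noteq> x" for m'
    proof
      assume "lo m' = x"
      then have "lo (max m m') = x" "hi (max m m') = x"
        using mono(2)[of m "max m m'"] mono(1)[of m' "max m m'"] lo_x[of "max m m'"] x_hi[of "max m m'"] m
        by simp_all
      then have "lo (max m m') = hi (max m m')"
        by simp
      then show False
        using n_pos by (simp add: lo_def hi_def)
    qed
    then have "lo m' < x" for m'
      using lo_x[of m'] by (simp add: less_le)
    then have "of_int (j m') < x * real n ^ m'" for m'
      by (simp add: lo_def pos_divide_less_eq[OF power_pos])
    then have ad: "ad m' (x, Below) = j m'" for m'
      using scale[of m'] by (simp add: addr_iff)
    have "x \<in> adic_rationals n"
      using integer_adic[of "j m + 1" m] by (simp add: m hi_def)
    then have "(x, Below) \<in> Dbl"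
      by (simp add: doubled_line_def)
    then show ?thesis
      using ad XX by blast
  next
    case False
    then have "x < hi m" for m
      using x_hi[of m] by (simp add: less_le)
    then have "x * real n ^ m < of_int (j m) + 1" for m
      by (simp add: hi_def pos_less_divide_eq[OF power_pos])
    then have ad: "ad m (x, s) = j m" if "s \<noteq> Below" for m s
      using scale[of m] that by (simp add: addr_iff)
    define s where "s = (if x \<in> adic_rationals n then Above else Regular)"
    have "(x, s) \<in> Dbl" "s \<noteq> Below"
      by (auto simp: doubled_line_def s_def)
    then show ?thesis
      using ad XX by blast
  qed
qed

text \<open>
  By compactness continuity is the same as uniform continuity with respect to addresses
  (\<open>continuous_iff\<close>), a condition without reference to the topology.
\<close>

definition adic_uniform :: "(point \<Rightarrow> complex) \<Rightarrow> bool" where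
  "adic_uniform f \<longleftrightarrow>
    (\<forall>e>0. \<exists>m. \<forall>p\<in>XX. \<forall>q\<in>XX. ad m p = ad m q \<longrightarrow> cmod (f p - f q) < e)"

text \<open>
  A compactness argument: a cylinder that is bad, that is, on which no level works, has a bad child,
  so that bad cylinders would shrink to a point.
\<close>

lemma pointwise_imp_uniform:
  assumes cont: "\<And>p e. p \<in> XX \<Longrightarrow> e > 0 \<Longrightarrow> \<exists>m. \<forall>q\<in>XX. ad m q = ad m p \<longrightarrow> cmod (f q - f p) < e"
  shows "adic_uniform f"
  unfolding adic_uniform_def
proof (intro allI impI)
  fix e :: real assume e: "e > 0"
  define good where "good m j \<longleftrightarrow> (\<exists>M. \<forall>p\<in>XX. \<forall>q\<in>XX. ad m p = j \<longrightarrow> ad M p = ad M q \<longrightarrow> cmod (f p - f q) < e)"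
    for m j
  have children: "good m j" if "\<And>j'. j' div int n = j \<Longrightarrow> good (Suc m) j'" for m j
  proof -
    let ?C = "{j'. j' div int n = j}"
    have "\<exists>M. \<forall>j'\<in>?C. \<forall>p\<in>XX. \<forall>q\<in>XX. ad (Suc m) p = j' \<longrightarrow> ad (M j') p = ad (M j') q \<longrightarrow> cmod (f p - f q) < e"
      using that unfolding good_def by (intro bchoice) blast
    then obtain M where M: "\<And>p q. p \<in> XX \<Longrightarrow> q \<in> XX \<Longrightarrow> ad (Suc m) p div int n = j \<Longrightarrow>
        ad (M (ad (Suc m) p)) p = ad (M (ad (Suc m) p)) q \<Longrightarrow> cmod (f p - f q) < e"
      by blast
    have "finite ?C"
    proof (rule finite_subset)
      show "?C \<subseteq> {int n * j..int n * j + int n}"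
      proof
        fix c assume "c \<in> ?C"
        then show "c \<in> {int n * j..int n * j + int n}"
          using div_bounds(1,2)[of c j] by (simp add: distrib_left)
      qed
    qed simp
    then have le: "M j' \<le> Max (M ` ?C)" if "j' \<in> ?C" for j'
      using that by (intro Max_ge) auto
    have "cmod (f p - f q) < e"
      if "p \<in> XX" "q \<in> XX" "ad m p = j" "ad (Max (M ` ?C)) p = ad (Max (M ` ?C)) q" for p q
    proof (rule M[OF that(1,2)])
      show c: "ad (Suc m) p div int n = j"
        using that(3) by (simp add: addr_Suc)
      show "ad (M (ad (Suc m) p)) p = ad (M (ad (Suc m) p)) q"
        by (rule addr_coarser[OF le that(4)]) (use c in simp)
    qed
    then show ?thesis
      unfolding good_def by blast
  qed
  have "good 0 0"
  proof (rule ccontr)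
    assume bad: "\<not> good 0 0"
    have "\<exists>j. \<forall>m. (\<not> good m (j m) \<and> (m = 0 \<longrightarrow> j m = 0)) \<and> j (Suc m) div int n = j m"
    proof (rule dependent_nat_choice)
      show "\<exists>j. \<not> good 0 j \<and> (0 = 0 \<longrightarrow> j = 0)"
        using bad by blast
      show "\<exists>j'. (\<not> good (Suc m) j' \<and> (Suc m = 0 \<longrightarrow> j' = 0)) \<and> j' div int n = j"
        if "\<not> good m j \<and> (m = 0 \<longrightarrow> j = 0)" for j m
        using children[of j m] that by blast
    qed
    then obtain j where j: "\<And>m. \<not> good m (j m)" "j 0 = 0" "\<And>m. j (Suc m) div int n = j m"
      by blast
    obtain p where p: "p \<in> XX" "\<And>m. ad m p = j m"
      using nested_addresses[of j, OF j(2,3)] by blast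
    obtain m where m: "\<forall>q\<in>XX. ad m q = ad m p \<longrightarrow> cmod (f q - f p) < e / 2"
      using cont[OF p(1), of "e / 2"] e by auto
    have "cmod (f q - f q') < e" if q: "q \<in> XX" "q' \<in> XX" "ad m q = j m" "ad m q = ad m q'" for q q'
    proof -
      have "cmod (f q - f p) < e / 2" "cmod (f q' - f p) < e / 2"
        using m q p(2) by auto
      then show ?thesis
        using norm_triangle_ineq4[of "f q - f p" "f q' - f p"] by simp
    qed
    then have "good m (j m)"
      unfolding good_def by blast
    then show False
      using j(1) by blast
  qed
  then show "\<exists>m. \<forall>p\<in>XX. \<forall>q\<in>XX. ad m p = ad m q \<longrightarrow> cmod (f p - f q) < e"
    unfolding good_def by (simp add: mem_X_iff)
qed

lemma continuous_iff:
  fixes f :: "point \<Rightarrow> complex"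
  shows "continuous_map T euclidean f \<longleftrightarrow> adic_uniform f"
proof
  assume f: "continuous_map T euclidean f"
  show "adic_uniform f"
  proof (rule pointwise_imp_uniform)
    fix p and e :: real assume p: "p \<in> XX" "e > 0"
    have "openin T {q \<in> topspace T. f q \<in> ball (f p) e}"
      using f by (intro openin_continuous_map_preimage) auto
    from open_contains_cylinder[OF this, of p]
    show "\<exists>m. \<forall>q\<in>XX. ad m q = ad m p \<longrightarrow> cmod (f q - f p) < e"
      using p by (simp add: topspace_T dist_norm norm_minus_commute)
  qed
next
  assume f: "adic_uniform f"
  show "continuous_map T euclidean f"
    unfolding continuous_map_def
  proof (intro conjI allI impI)
    fix U :: "complex set" assume "openin euclidean U"
    then have U: "open U"
      by simp
    show "openin T {q \<in> topspace T. f q \<in> U}"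
    proof (subst openin_subopen, intro ballI)
      fix p assume "p \<in> {q \<in> topspace T. f q \<in> U}"
      then have p: "p \<in> XX" "f p \<in> U"
        by (auto simp: topspace_T)
      then obtain e where e: "e > 0" "ball (f p) e \<subseteq> U"
        using U openE by blast
      then obtain m where m: "\<And>q. q \<in> XX \<Longrightarrow> ad m p = ad m q \<Longrightarrow> cmod (f p - f q) < e"
        using f p(1) unfolding adic_uniform_def by metis
      show "\<exists>V. openin T V \<and> p \<in> V \<and> V \<subseteq> {q \<in> topspace T. f q \<in> U}"
      proof (intro exI conjI)
        show "openin T {q \<in> XX. ad m q = ad m p}"
          by (rule openin_cylinder)
        show "{q \<in> XX. ad m q = ad m p} \<subseteq> {q \<in> topspace T. f q \<in> U}"
          using m e(2) by (auto simp: topspace_T dist_norm subset_iff)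
      qed (use p in auto)
    qed
  qed simp
qed

end

section \<open>The crossed product star-algebra\<close>

(* Group elements and points are pairs, but are treated as single objects. *)
declare split_paired_All [simp del] split_paired_Ex [simp del]

context adic
begin

abbreviation "C \<equiv> continuous_functions T"
abbreviation "J g \<equiv> vanishing_off T (beta_ran n g)"

lemma C_carrier: "f \<in> carrier C \<longleftrightarrow> continuous_map T euclidean f \<and> (\<forall>p. p \<notin> XX \<longrightarrow> f p = 0)"
  by (simp add: continuous_functions_def topspace_T)

lemma C_iff: "f \<in> carrier C \<longleftrightarrow> adic_uniform f \<and> (\<forall>p. p \<notin> XX \<longrightarrow> f p = 0)"
  by (simp add: C_carrier continuous_iff)

lemma C_outside: "f \<in> carrier C \<Longrightarrow> f p \<noteq> 0 \<Longrightarrow> p \<in> XX"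
  unfolding C_carrier by blast

lemma C_ops:
  "\<zero>\<^bsub>C\<^esub> = (\<lambda>p. 0)" "\<one>\<^bsub>C\<^esub> = (\<lambda>p. if p \<in> XX then 1 else 0)"
  "f \<oplus>\<^bsub>C\<^esub> g = (\<lambda>p. f p + g p)" "f \<otimes>\<^bsub>C\<^esub> g = (\<lambda>p. f p * g p)" "c \<odot>\<^bsub>C\<^esub> f = (\<lambda>p. c * f p)"
  "star C f = (\<lambda>p. cnj (f p))"
  by (auto simp: continuous_functions_def topspace_T)

lemma C_compose:
  assumes "f \<in> carrier C" "continuous_on UNIV h"
  shows "(\<lambda>p. if p \<in> XX then h (f p) else 0) \<in> carrier C"
proof -
  have "continuous_map T euclidean (h \<circ> f)"
    using assms by (intro continuous_map_compose[of _ euclidean]) (auto simp: C_carrier)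
  then have "continuous_map T euclidean (\<lambda>p. if p \<in> XX then h (f p) else 0)"
    by (rule continuous_map_eq) (simp add: topspace_T)
  then show ?thesis
    by (simp add: C_carrier)
qed

lemma C_zero [simp, intro]: "(\<lambda>p. 0) \<in> carrier C"
  by (simp add: C_carrier)

lemma C_one: "(\<lambda>p. if p \<in> XX then 1 else 0) \<in> carrier C"
  using C_compose[OF C_zero, of "\<lambda>_. 1"] by simp

lemma C_add: "f \<in> carrier C \<Longrightarrow> g \<in> carrier C \<Longrightarrow> (\<lambda>p. f p + g p) \<in> carrier C"
  by (simp add: C_carrier continuous_map_add)

lemma C_mult: "f \<in> carrier C \<Longrightarrow> g \<in> carrier C \<Longrightarrow> (\<lambda>p. f p * g p) \<in> carrier C"
  by (simp add: C_carrier continuous_map_atin tendsto_mult)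

lemma C_smult: "f \<in> carrier C \<Longrightarrow> (\<lambda>p. c * f p) \<in> carrier C"
proof -
  assume f: "f \<in> carrier C"
  have "(\<lambda>p. if p \<in> XX then c * f p else 0) = (\<lambda>p. c * f p)"
    using C_outside[OF f] by force
  then show "(\<lambda>p. c * f p) \<in> carrier C"
    using C_compose[OF f, of "\<lambda>z. c * z"] by (simp add: continuous_intros)
qed

lemma C_cnj: "f \<in> carrier C \<Longrightarrow> (\<lambda>p. cnj (f p)) \<in> carrier C"
proof -
  assume f: "f \<in> carrier C"
  have "(\<lambda>p. if p \<in> XX then cnj (f p) else 0) = (\<lambda>p. cnj (f p))"
    using C_outside[OF f] by force
  then show "(\<lambda>p. cnj (f p)) \<in> carrier C"
    using C_compose[OF f, of "cnj"] by (simp add: continuous_intros)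
qed

text \<open>
  The estimate extends to the whole doubled line, since at any level two points with the same address
  lie both inside or both outside the Cantor space.
\<close>

lemma C_uniform:
  assumes "f \<in> carrier C" "e > 0"
  obtains m where "\<And>p q. p \<in> Dbl \<Longrightarrow> q \<in> Dbl \<Longrightarrow> ad m p = ad m q \<Longrightarrow> cmod (f p - f q) < e"
proof -
  obtain m where m: "\<forall>p\<in>XX. \<forall>q\<in>XX. ad m p = ad m q \<longrightarrow> cmod (f p - f q) < e"
    using assms unfolding C_iff adic_uniform_def by blast
  have "cmod (f p - f q) < e" if "p \<in> Dbl" "q \<in> Dbl" "ad m p = ad m q" for p q
  proof (cases "p \<in> XX")
    case True
    then have "q \<in> XX"
      using that addr_coarser[of 0 m p q] by (simp add: mem_X_iff)
    then show ?thesis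
      using m True that by blast
  next
    case False
    then have "q \<notin> XX"
      using that addr_coarser[of 0 m p q] by (simp add: mem_X_iff)
    then have "f p = 0" "f q = 0"
      using False C_outside[OF assms(1)] by blast+
    then show ?thesis
      using assms(2) by simp
  qed
  then show ?thesis
    using that by blast
qed

lemma C_I:
  assumes "\<And>p. p \<notin> XX \<Longrightarrow> f p = 0"
    and "\<And>e. e > 0 \<Longrightarrow> \<exists>m. \<forall>p\<in>XX. \<forall>q\<in>XX. ad m p = ad m q \<longrightarrow> cmod (f p - f q) < e"
  shows "f \<in> carrier C"
  using assms by (simp add: C_iff adic_uniform_def)

lemma C_translate:
  assumes "g \<in> carrier G" "f \<in> carrier C"
  shows "(\<lambda>y. if y \<in> XX then f (act g y) else 0) \<in> carrier C"
proof (rule C_I)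
  fix e :: real assume "e > 0"
  then obtain m where m: "\<And>p q. p \<in> Dbl \<Longrightarrow> q \<in> Dbl \<Longrightarrow> ad m p = ad m q \<Longrightarrow> cmod (f p - f q) < e"
    using C_uniform[OF assms(2)] by blast
  obtain l where l: "\<And>p q. ad l p = ad l q \<Longrightarrow> ad m (act g p) = ad m (act g q)"
    using act_uniform[OF assms(1)] by blast
  have "cmod (f (act g p) - f (act g q)) < e" if "p \<in> XX" "q \<in> XX" "ad l p = ad l q" for p q
    using that assms(1) by (intro m l) (auto simp: X_in_D)
  then show "\<exists>l. \<forall>p\<in>XX. \<forall>q\<in>XX. ad l p = ad l q \<longrightarrow>
      cmod ((if p \<in> XX then f (act g p) else 0) - (if q \<in> XX then f (act g q) else 0)) < e"
    by (intro exI[of _ l]) simp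
qed simp

lemma J_iff:
  assumes "g \<in> carrier G"
  shows "f \<in> J g \<longleftrightarrow> f \<in> carrier C \<and> (\<forall>y. f y \<noteq> 0 \<longrightarrow> act (inv\<^bsub>G\<^esub> g) y \<in> XX)"
  using assms C_outside unfolding vanishing_off_def by (auto simp: ran_iff)

lemma C_abelian_monoid: "abelian_monoid C"
  by (rule abelian_monoidI) (auto simp: C_ops C_add C_zero)

lemma C_finsum:
  assumes "finite I" "\<And>i. i \<in> I \<Longrightarrow> f i \<in> carrier C"
  shows "finsum C f I = (\<lambda>y. \<Sum>i\<in>I. f i y)" "finsum C f I \<in> carrier C"
proof -
  have "finsum C f I = (\<lambda>y. \<Sum>i\<in>I. f i y) \<and> finsum C f I \<in> carrier C"
    using assms
  proof (induction I rule: finite_induct)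
    case empty
    then show ?case
      by (simp add: abelian_monoid.finsum_empty[OF C_abelian_monoid] C_ops(1) C_zero)
  next
    case (insert i I)
    then have "finsum C f (insert i I) = f i \<oplus>\<^bsub>C\<^esub> finsum C f I"
      by (intro abelian_monoid.finsum_insert[OF C_abelian_monoid]) auto
    then show ?case
      using insert by (auto simp: C_ops C_add)
  qed
  then show "finsum C f I = (\<lambda>y. \<Sum>i\<in>I. f i y)" "finsum C f I \<in> carrier C"
    by auto
qed

definition cp :: "(real \<times> int \<Rightarrow> point \<Rightarrow> complex) star_algebra" where
  "cp = partial_crossed_star_algebra G C (\<lambda>g. J g) (alpha n)"

abbreviation "supp a \<equiv> {g. a g \<noteq> (\<lambda>p. 0)}"

lemma cp_carrier: "a \<in> carrier cp \<longleftrightarrow>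
    (\<forall>g. a g \<in> carrier C) \<and> finite (supp a) \<and>
    (\<forall>g y. a g y \<noteq> 0 \<longrightarrow> g \<in> carrier G \<and> act (inv\<^bsub>G\<^esub> g) y \<in> XX)"
  (is "?l \<longleftrightarrow> ?r")
proof
  assume ?l
  then have a: "\<And>g. g \<in> carrier G \<Longrightarrow> a g \<in> J g" "\<And>g. g \<notin> carrier G \<Longrightarrow> a g = (\<lambda>p. 0)" "finite (supp a)"
    by (auto simp: cp_def partial_crossed_star_algebra_def C_ops)
  have "a g \<in> carrier C" for g
    using a C_zero by (cases "g \<in> carrier G") (auto simp: J_iff)
  moreover have "g \<in> carrier G \<and> act (inv\<^bsub>G\<^esub> g) y \<in> XX" if "a g y \<noteq> 0" for g y
    using a(1,2)[of g] that by (cases "g \<in> carrier G") (simp_all add: J_iff)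
  ultimately show ?r
    using a(3) by blast
next
  assume r: ?r
  have "a g = (\<lambda>p. 0)" if "g \<notin> carrier G" for g
    using r that by blast
  then show ?l
    using r by (auto simp: cp_def partial_crossed_star_algebra_def C_ops J_iff)
qed

lemma cpD:
  assumes "a \<in> carrier cp"
  shows "a g \<in> carrier C" "finite (supp a)" "a g y \<noteq> 0 \<Longrightarrow> g \<in> carrier G"
    "a g y \<noteq> 0 \<Longrightarrow> y \<in> XX" "a g y \<noteq> 0 \<Longrightarrow> act (inv\<^bsub>G\<^esub> g) y \<in> XX" "supp a \<subseteq> carrier G"
  using assms C_outside[of "a g" y] unfolding cp_carrier by blast+

lemma cp_I:
  assumes "\<And>g. g \<in> carrier G \<Longrightarrow> a g \<in> carrier C" "finite W" "supp a \<subseteq> W" "W \<subseteq> carrier G"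
    "\<And>g y. g \<in> carrier G \<Longrightarrow> a g y \<noteq> 0 \<Longrightarrow> act (inv\<^bsub>G\<^esub> g) y \<in> XX"
  shows "a \<in> carrier cp"
proof -
  have out: "a g = (\<lambda>p. 0)" if "g \<notin> carrier G" for g
    using assms(3,4) that by blast
  then have "a g \<in> carrier C" for g
    using assms(1) C_zero by (cases "g \<in> carrier G") auto
  moreover have "g \<in> carrier G" if "a g y \<noteq> 0" for g y
    using out that by metis
  ultimately show ?thesis
    using assms(2,3,5) finite_subset by (auto simp: cp_carrier)
qed

lemma cp_ops:
  "\<zero>\<^bsub>cp\<^esub> = (\<lambda>g p. 0)" "\<one>\<^bsub>cp\<^esub> = (\<lambda>g p. if g = \<one>\<^bsub>G\<^esub> \<and> p \<in> XX then 1 else 0)"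
  "a \<oplus>\<^bsub>cp\<^esub> b = (\<lambda>g p. a g p + b g p)" "c \<odot>\<^bsub>cp\<^esub> a = (\<lambda>g p. c * a g p)"
  by (auto simp: cp_def partial_crossed_star_algebra_def C_ops fun_eq_iff)

lemma cp_star:
  assumes "a \<in> carrier cp"
  shows "star cp a g y =
    (if g \<in> carrier G \<and> y \<in> XX then cnj (a (inv\<^bsub>G\<^esub> g) (act (inv\<^bsub>G\<^esub> g) y)) else 0)"
proof -
  have "alpha n g (\<lambda>p. cnj (a (inv\<^bsub>G\<^esub> g) p)) y = (if y \<in> XX then cnj (a (inv\<^bsub>G\<^esub> g) (act (inv\<^bsub>G\<^esub> g) y)) else 0)"
    if "g \<in> carrier G"
    by (rule alpha_eq[OF that]) (use cpD(4)[OF assms] in auto)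
  then show ?thesis
    by (auto simp: cp_def partial_crossed_star_algebra_def C_ops)
qed

text \<open>
  Multiplication is a convolution of functions on pairs of a group element and a point. The
  intermediate applications of \<open>\<alpha>\<close> disappear because the coefficients vanish where \<open>\<beta>\<close> leaves the
  space.
\<close>

lemma cp_mult_term:
  assumes a: "a \<in> carrier cp" and b: "b \<in> carrier cp" and g: "g \<in> carrier G"
  shows "alpha n g (alpha n (inv\<^bsub>G\<^esub> g) (a g) \<otimes>\<^bsub>C\<^esub> b h) = (\<lambda>y. a g y * b h (act (inv\<^bsub>G\<^esub> g) y))"
proof
  fix y
  have inner: "alpha n (inv\<^bsub>G\<^esub> g) (a g) z = (if z \<in> XX then a g (act g z) else 0)" for z
    using g alpha_eq[of "inv\<^bsub>G\<^esub> g" "a g" z] cpD(4)[OF a] by simp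
  have "alpha n g (\<lambda>z. alpha n (inv\<^bsub>G\<^esub> g) (a g) z * b h z) y
      = (if y \<in> XX then alpha n (inv\<^bsub>G\<^esub> g) (a g) (act (inv\<^bsub>G\<^esub> g) y) * b h (act (inv\<^bsub>G\<^esub> g) y) else 0)"
    by (rule alpha_eq[OF g]) (auto simp: inner split: if_splits)
  also have "\<dots> = a g y * b h (act (inv\<^bsub>G\<^esub> g) y)"
    using cpD(4,5)[OF a, of g y] g by (auto simp: inner)
  finally show "alpha n g (alpha n (inv\<^bsub>G\<^esub> g) (a g) \<otimes>\<^bsub>C\<^esub> b h) y = a g y * b h (act (inv\<^bsub>G\<^esub> g) y)"
    by (simp add: C_ops)
qed

lemma cp_term_C:
  assumes a: "a \<in> carrier cp" and b: "b \<in> carrier cp" and g: "g \<in> carrier G"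
  shows "(\<lambda>y. a g y * b h (act (inv\<^bsub>G\<^esub> g) y)) \<in> carrier C"
proof -
  have "(\<lambda>y. a g y * (if y \<in> XX then b h (act (inv\<^bsub>G\<^esub> g) y) else 0)) \<in> carrier C"
    using g by (intro C_mult cpD(1)[OF a] C_translate cpD(1)[OF b]) auto
  moreover have "(\<lambda>y. a g y * (if y \<in> XX then b h (act (inv\<^bsub>G\<^esub> g) y) else 0))
      = (\<lambda>y. a g y * b h (act (inv\<^bsub>G\<^esub> g) y))"
    using cpD(4)[OF a, of g] by (auto simp: fun_eq_iff)
  ultimately show ?thesis
    by simp
qed

text \<open>
  The set \<open>W\<close> may be larger than the support, so that the sums for different products can be taken
  over matching index sets.
\<close>

lemma cp_mult:
  assumes a: "a \<in> carrier cp" and b: "b \<in> carrier cp"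
    and W: "finite W" "supp a \<subseteq> W" "W \<subseteq> carrier G" and k: "k \<in> carrier G"
  shows "(a \<otimes>\<^bsub>cp\<^esub> b) k y = (\<Sum>g\<in>W. a g y * b (inv\<^bsub>G\<^esub> g \<otimes>\<^bsub>G\<^esub> k) (act (inv\<^bsub>G\<^esub> g) y))"
proof -
  let ?P = "{(g, h). a g \<noteq> \<zero>\<^bsub>C\<^esub> \<and> b h \<noteq> \<zero>\<^bsub>C\<^esub> \<and> g \<otimes>\<^bsub>G\<^esub> h = k}"
  let ?t = "\<lambda>x. case x of (g, h) \<Rightarrow> alpha n g (alpha n (inv\<^bsub>G\<^esub> g) (a g) \<otimes>\<^bsub>C\<^esub> b h)"
  have P: "?P \<subseteq> supp a \<times> supp b"
    by (auto simp: C_ops)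
  have G: "g \<in> carrier G" "h \<in> carrier G" if "(g, h) \<in> ?P" for g h
    using P that cpD(6)[OF a] cpD(6)[OF b] by auto
  have fin: "finite ?P"
    using finite_subset[OF P] cpD(2)[OF a] cpD(2)[OF b] by simp
  have t: "?t (g, h) = (\<lambda>y. a g y * b h (act (inv\<^bsub>G\<^esub> g) y))" if "(g, h) \<in> ?P" for g h
    using cp_mult_term[OF a b G(1)[OF that]] by simp
  have "finsum C ?t ?P = (\<lambda>y. \<Sum>x\<in>?P. ?t x y)"
  proof (rule C_finsum(1)[OF fin])
    fix x assume x: "x \<in> ?P"
    obtain g h where gh: "x = (g, h)"
      by (cases x)
    show "?t x \<in> carrier C"
      using t[of g h] cp_term_C[OF a b G(1)[of g h]] x unfolding gh by simp
  qed
  then have "(a \<otimes>\<^bsub>cp\<^esub> b) k y = (\<Sum>x\<in>?P. ?t x y)"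
    by (simp add: cp_def partial_crossed_star_algebra_def)
  also have "\<dots> = (\<Sum>x\<in>?P. a (fst x) y * b (snd x) (act (inv\<^bsub>G\<^esub> (fst x)) y))"
  proof (rule sum.cong[OF refl])
    fix x assume x: "x \<in> ?P"
    obtain g h where gh: "x = (g, h)"
      by (cases x)
    show "?t x y = a (fst x) y * b (snd x) (act (inv\<^bsub>G\<^esub> (fst x)) y)"
      using t[of g h] x unfolding gh by simp
  qed
  also have "\<dots> = (\<Sum>g\<in>fst ` ?P. a g y * b (inv\<^bsub>G\<^esub> g \<otimes>\<^bsub>G\<^esub> k) (act (inv\<^bsub>G\<^esub> g) y))"
  proof (rule sum.reindex_cong[symmetric, of fst, OF _ refl])
    have snd: "snd x = inv\<^bsub>G\<^esub> (fst x) \<otimes>\<^bsub>G\<^esub> k" if "x \<in> ?P" for x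
    proof -
      have "fst x \<in> carrier G" "snd x \<in> carrier G" "fst x \<otimes>\<^bsub>G\<^esub> snd x = k"
        using that G[of "fst x" "snd x"] by (simp_all add: case_prod_unfold)
      then show ?thesis
        by (metis G.inv_closed G.l_inv G.l_one G.m_assoc)
    qed
    show "inj_on fst ?P"
    proof (rule inj_onI)
      fix x x' assume x: "x \<in> ?P" "x' \<in> ?P" "fst x = fst x'"
      have "snd x = snd x'"
        unfolding snd[OF x(1)] snd[OF x(2)] x(3) ..
      with x(3) show "x = x'"
        by (rule prod_eqI)
    qed
    show "a (fst x) y * b (inv\<^bsub>G\<^esub> (fst x) \<otimes>\<^bsub>G\<^esub> k) (act (inv\<^bsub>G\<^esub> (fst x)) y)
        = a (fst x) y * b (snd x) (act (inv\<^bsub>G\<^esub> (fst x)) y)" if "x \<in> ?P" for x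
      using snd[OF that] by simp
  qed
  also have "\<dots> = (\<Sum>g\<in>W. a g y * b (inv\<^bsub>G\<^esub> g \<otimes>\<^bsub>G\<^esub> k) (act (inv\<^bsub>G\<^esub> g) y))"
  proof (rule sum.mono_neutral_left[OF W(1)])
    have "fst ` ?P \<subseteq> supp a"
    proof
      fix g assume "g \<in> fst ` ?P"
      then obtain x where "x \<in> ?P" "g = fst x"
        by blast
      then have "x \<in> supp a \<times> supp b" "g = fst x"
        using P by blast+
      then show "g \<in> supp a"
        by (simp add: mem_Times_iff)
    qed
    then show "fst ` ?P \<subseteq> W"
      using W(2) by (rule order_trans)
    show "\<forall>g\<in>W - fst ` ?P. a g y * b (inv\<^bsub>G\<^esub> g \<otimes>\<^bsub>G\<^esub> k) (act (inv\<^bsub>G\<^esub> g) y) = 0"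
    proof
      fix g assume g: "g \<in> W - fst ` ?P"
      show "a g y * b (inv\<^bsub>G\<^esub> g \<otimes>\<^bsub>G\<^esub> k) (act (inv\<^bsub>G\<^esub> g) y) = 0"
      proof (rule ccontr)
        assume "a g y * b (inv\<^bsub>G\<^esub> g \<otimes>\<^bsub>G\<^esub> k) (act (inv\<^bsub>G\<^esub> g) y) \<noteq> 0"
        then have "a g \<noteq> \<zero>\<^bsub>C\<^esub>" "b (inv\<^bsub>G\<^esub> g \<otimes>\<^bsub>G\<^esub> k) \<noteq> \<zero>\<^bsub>C\<^esub>"
          by (auto simp: C_ops)
        moreover have "g \<otimes>\<^bsub>G\<^esub> (inv\<^bsub>G\<^esub> g \<otimes>\<^bsub>G\<^esub> k) = k"
          using g W(3) k by (subst G.m_assoc[symmetric]) auto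
        ultimately have "(g, inv\<^bsub>G\<^esub> g \<otimes>\<^bsub>G\<^esub> k) \<in> ?P"
          by simp
        then have "g \<in> fst ` ?P"
          by (rule image_eqI[rotated]) simp
        then show False
          using g by blast
      qed
    qed
  qed
  finally show ?thesis .
qed

lemma cp_mult_outside:
  assumes a: "a \<in> carrier cp" and b: "b \<in> carrier cp" and k: "k \<notin> carrier G"
  shows "(a \<otimes>\<^bsub>cp\<^esub> b) k = (\<lambda>y. 0)"
proof -
  let ?P = "{(g, h). a g \<noteq> \<zero>\<^bsub>C\<^esub> \<and> b h \<noteq> \<zero>\<^bsub>C\<^esub> \<and> g \<otimes>\<^bsub>G\<^esub> h = k}"
  have empty: "?P = {}"
    using cpD(6)[OF a] cpD(6)[OF b] k G.m_closed unfolding C_ops by blast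
  have "(a \<otimes>\<^bsub>cp\<^esub> b) k
      = finsum C (\<lambda>x. case x of (g, h) \<Rightarrow> alpha n g (alpha n (inv\<^bsub>G\<^esub> g) (a g) \<otimes>\<^bsub>C\<^esub> b h)) ?P"
    by (simp add: cp_def partial_crossed_star_algebra_def)
  then show ?thesis
    unfolding empty by (simp only: abelian_monoid.finsum_empty[OF C_abelian_monoid] C_ops(1))
qed

definition products :: "(real \<times> int) set \<Rightarrow> (real \<times> int) set \<Rightarrow> (real \<times> int) set" where
  "products V W = (\<lambda>(g, h). g \<otimes>\<^bsub>G\<^esub> h) ` (V \<times> W)"

lemma products_simps:
  "finite V \<Longrightarrow> finite W \<Longrightarrow> finite (products V W)"
  "V \<subseteq> carrier G \<Longrightarrow> W \<subseteq> carrier G \<Longrightarrow> products V W \<subseteq> carrier G"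
  using G.m_closed by (auto simp: products_def simp del: G.m_closed) blast

lemma cp_mult_supp:
  assumes a: "a \<in> carrier cp" and b: "b \<in> carrier cp"
  shows "supp (a \<otimes>\<^bsub>cp\<^esub> b) \<subseteq> products (supp a) (supp b)"
proof
  fix k assume k: "k \<in> supp (a \<otimes>\<^bsub>cp\<^esub> b)"
  then have kG: "k \<in> carrier G"
    using cp_mult_outside[OF a b] by blast
  obtain y where "(a \<otimes>\<^bsub>cp\<^esub> b) k y \<noteq> 0"
    using k by blast
  then obtain g where g: "g \<in> supp a" "a g y * b (inv\<^bsub>G\<^esub> g \<otimes>\<^bsub>G\<^esub> k) (act (inv\<^bsub>G\<^esub> g) y) \<noteq> 0"
    unfolding cp_mult[OF a b cpD(2)[OF a] order_refl cpD(6)[OF a] kG]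
    by (elim sum.not_neutral_contains_not_neutral)
  then have "inv\<^bsub>G\<^esub> g \<otimes>\<^bsub>G\<^esub> k \<in> supp b"
    by auto
  moreover have "k = g \<otimes>\<^bsub>G\<^esub> (inv\<^bsub>G\<^esub> g \<otimes>\<^bsub>G\<^esub> k)"
    using g(1) cpD(6)[OF a] kG by (subst G.m_assoc[symmetric]) auto
  ultimately show "k \<in> products (supp a) (supp b)"
    using g(1) unfolding products_def by force
qed

lemma cp_mult_closed:
  assumes a: "a \<in> carrier cp" and b: "b \<in> carrier cp"
  shows "a \<otimes>\<^bsub>cp\<^esub> b \<in> carrier cp"
proof (rule cp_I[OF _ _ cp_mult_supp[OF a b]])
  note ab = cpD(2)[OF a] cpD(2)[OF b] cpD(6)[OF a] cpD(6)[OF b]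
  show "finite (products (supp a) (supp b))" "products (supp a) (supp b) \<subseteq> carrier G"
    using ab by (simp_all only: products_simps)
  fix k assume k: "k \<in> carrier G"
  have eq: "(a \<otimes>\<^bsub>cp\<^esub> b) k = (\<lambda>y. \<Sum>g\<in>supp a. a g y * b (inv\<^bsub>G\<^esub> g \<otimes>\<^bsub>G\<^esub> k) (act (inv\<^bsub>G\<^esub> g) y))"
    using cp_mult[OF a b ab(1) order_refl ab(3) k] by (rule ext)
  let ?f = "\<lambda>g y. a g y * b (inv\<^bsub>G\<^esub> g \<otimes>\<^bsub>G\<^esub> k) (act (inv\<^bsub>G\<^esub> g) y)"
  have term_C: "(\<lambda>y. a g y * b (inv\<^bsub>G\<^esub> g \<otimes>\<^bsub>G\<^esub> k) (act (inv\<^bsub>G\<^esub> g) y)) \<in> carrier C" if "g \<in> supp a" for g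
    using that ab(3) by (intro cp_term_C[OF a b]) blast
  have "finsum C ?f (supp a) \<in> carrier C"
    by (rule C_finsum(2)[OF ab(1)]) (rule term_C)
  moreover have "finsum C ?f (supp a) = (\<lambda>y. \<Sum>g\<in>supp a. ?f g y)"
    by (rule C_finsum(1)[OF ab(1)]) (rule term_C)
  ultimately show "(a \<otimes>\<^bsub>cp\<^esub> b) k \<in> carrier C"
    unfolding eq by (simp only:)
  show "act (inv\<^bsub>G\<^esub> k) y \<in> XX" if ne: "(a \<otimes>\<^bsub>cp\<^esub> b) k y \<noteq> 0" for y
  proof -
    obtain g where g: "g \<in> supp a" "a g y * b (inv\<^bsub>G\<^esub> g \<otimes>\<^bsub>G\<^esub> k) (act (inv\<^bsub>G\<^esub> g) y) \<noteq> 0"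
      using ne unfolding eq by (elim sum.not_neutral_contains_not_neutral)
    then have gG: "g \<in> carrier G"
      using ab(3) by blast
    have "b (inv\<^bsub>G\<^esub> g \<otimes>\<^bsub>G\<^esub> k) (act (inv\<^bsub>G\<^esub> g) y) \<noteq> 0"
      using g(2) by simp
    then have "act (inv\<^bsub>G\<^esub> (inv\<^bsub>G\<^esub> g \<otimes>\<^bsub>G\<^esub> k)) (act (inv\<^bsub>G\<^esub> g) y) \<in> XX"
      by (rule cpD(5)[OF b])
    moreover have "inv\<^bsub>G\<^esub> (inv\<^bsub>G\<^esub> g \<otimes>\<^bsub>G\<^esub> k) \<otimes>\<^bsub>G\<^esub> inv\<^bsub>G\<^esub> g = inv\<^bsub>G\<^esub> k"
      using gG k by (simp add: G.inv_mult_group G.m_assoc)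
    ultimately show ?thesis
      by (simp only: act_mult)
  qed
qed

lemma cp_supp_finite_union:
  "a \<in> carrier cp \<Longrightarrow> b \<in> carrier cp \<Longrightarrow> finite (supp a \<union> supp b) \<and> supp a \<union> supp b \<subseteq> carrier G"
  using cpD(2,6) by simp

lemma cp_add_closed:
  assumes "a \<in> carrier cp" "b \<in> carrier cp"
  shows "a \<oplus>\<^bsub>cp\<^esub> b \<in> carrier cp"
proof (rule cp_I[of _ "supp a \<union> supp b"])
  show "supp (a \<oplus>\<^bsub>cp\<^esub> b) \<subseteq> supp a \<union> supp b"
    by (auto simp: cp_ops fun_eq_iff)
  show "act (inv\<^bsub>G\<^esub> g) y \<in> XX" if "(a \<oplus>\<^bsub>cp\<^esub> b) g y \<noteq> 0" for g y
    using that cpD(5)[OF assms(1), of g y] cpD(5)[OF assms(2), of g y]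
    by (cases "a g y = 0") (auto simp: cp_ops)
qed (use cp_supp_finite_union[OF assms] assms in \<open>auto simp: cp_ops intro: C_add cpD(1)\<close>)

lemma cp_smult_closed:
  assumes "a \<in> carrier cp"
  shows "c \<odot>\<^bsub>cp\<^esub> a \<in> carrier cp"
proof (rule cp_I[of _ "supp a"])
  show "supp (c \<odot>\<^bsub>cp\<^esub> a) \<subseteq> supp a"
    by (auto simp: cp_ops fun_eq_iff)
qed (use cpD[OF assms] in \<open>auto simp: cp_ops intro: C_smult\<close>)

lemma cp_one_closed: "\<one>\<^bsub>cp\<^esub> \<in> carrier cp"
proof (rule cp_I[of _ "{\<one>\<^bsub>G\<^esub>}"])
  show "\<one>\<^bsub>cp\<^esub> g \<in> carrier C" for g
    using C_one by (cases "g = \<one>\<^bsub>G\<^esub>") (simp_all add: cp_ops)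
qed (auto simp: cp_ops split: if_splits)

lemma cp_star_supp: "a \<in> carrier cp \<Longrightarrow> supp (star cp a) \<subseteq> (\<lambda>g. inv\<^bsub>G\<^esub> g) ` supp a"
proof
  fix g assume a: "a \<in> carrier cp" and "g \<in> supp (star cp a)"
  then obtain y where y: "star cp a g y \<noteq> 0"
    by blast
  then have "g \<in> carrier G" "a (inv\<^bsub>G\<^esub> g) (act (inv\<^bsub>G\<^esub> g) y) \<noteq> 0"
    using cp_star[OF a] by (auto split: if_splits)
  then show "g \<in> (\<lambda>g. inv\<^bsub>G\<^esub> g) ` supp a"
    by (intro image_eqI[of _ _ "inv\<^bsub>G\<^esub> g"]) auto
qed

lemma cp_star_closed:
  assumes a: "a \<in> carrier cp"
  shows "star cp a \<in> carrier cp"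
proof (rule cp_I[OF _ _ cp_star_supp[OF a]])
  show "finite ((\<lambda>g. inv\<^bsub>G\<^esub> g) ` supp a)" "(\<lambda>g. inv\<^bsub>G\<^esub> g) ` supp a \<subseteq> carrier G"
    using cpD(2,6)[OF a] by auto
  fix g assume g: "g \<in> carrier G"
  have "star cp a g = (\<lambda>y. if y \<in> XX then cnj (a (inv\<^bsub>G\<^esub> g) (act (inv\<^bsub>G\<^esub> g) y)) else 0)"
    using cp_star[OF a] g by (auto simp: fun_eq_iff)
  then show "star cp a g \<in> carrier C"
    using C_translate[OF G.inv_closed[OF g] C_cnj[OF cpD(1)[OF a]]] by simp
  show "act (inv\<^bsub>G\<^esub> g) y \<in> XX" if "star cp a g y \<noteq> 0" for y
    using that cpD(4)[OF a] by (auto simp: cp_star[OF a] split: if_splits)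
qed

lemma cp_eqI:
  assumes "a \<in> carrier cp" "b \<in> carrier cp" "\<And>g y. g \<in> carrier G \<Longrightarrow> y \<in> XX \<Longrightarrow> a g y = b g y"
  shows "a = b"
proof (intro ext)
  fix g y
  show "a g y = b g y"
    using assms(3) cpD(3,4)[OF assms(1), of g y] cpD(3,4)[OF assms(2), of g y] by metis
qed

lemma cp_mult_assoc:
  assumes a: "a \<in> carrier cp" and b: "b \<in> carrier cp" and c: "c \<in> carrier cp"
  shows "(a \<otimes>\<^bsub>cp\<^esub> b) \<otimes>\<^bsub>cp\<^esub> c = a \<otimes>\<^bsub>cp\<^esub> (b \<otimes>\<^bsub>cp\<^esub> c)"
proof (rule cp_eqI)
  fix k y assume k: "k \<in> carrier G"
  note fin = cpD(2)[OF a] cpD(2)[OF b] cpD(6)[OF a] cpD(6)[OF b]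
  let ?i = "\<lambda>g. inv\<^bsub>G\<^esub> g"
  let ?W = "products (supp a) (supp b)"
  have W: "finite ?W" "?W \<subseteq> carrier G"
    using fin by (simp_all only: products_simps)
  have "((a \<otimes>\<^bsub>cp\<^esub> b) \<otimes>\<^bsub>cp\<^esub> c) k y = (\<Sum>h\<in>?W. (a \<otimes>\<^bsub>cp\<^esub> b) h y * c (?i h \<otimes>\<^bsub>G\<^esub> k) (act (?i h) y))"
    by (rule cp_mult[OF cp_mult_closed[OF a b] c W(1) cp_mult_supp[OF a b] W(2) k])
  also have "\<dots> = (\<Sum>h\<in>?W. \<Sum>g\<in>supp a. a g y * (b (?i g \<otimes>\<^bsub>G\<^esub> h) (act (?i g) y) * c (?i h \<otimes>\<^bsub>G\<^esub> k) (act (?i h) y)))"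
    using W(2) by (intro sum.cong refl) (auto simp: cp_mult[OF a b fin(1) order_refl fin(3)] sum_distrib_right mult.assoc)
  also have "\<dots> = (\<Sum>g\<in>supp a. \<Sum>h\<in>?W. a g y * (b (?i g \<otimes>\<^bsub>G\<^esub> h) (act (?i g) y) * c (?i h \<otimes>\<^bsub>G\<^esub> k) (act (?i h) y)))"
    by (rule sum.swap)
  also have "\<dots> = (\<Sum>g\<in>supp a. a g y * (b \<otimes>\<^bsub>cp\<^esub> c) (?i g \<otimes>\<^bsub>G\<^esub> k) (act (?i g) y))"
  proof (rule sum.cong[OF refl])
    fix g assume g: "g \<in> supp a"
    then have gG: "g \<in> carrier G"
      using fin(3) by blast
    have V: "finite ((\<lambda>h. ?i g \<otimes>\<^bsub>G\<^esub> h) ` ?W)" "(\<lambda>h. ?i g \<otimes>\<^bsub>G\<^esub> h) ` ?W \<subseteq> carrier G"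
      using W gG by auto
    have sub: "supp b \<subseteq> (\<lambda>h. ?i g \<otimes>\<^bsub>G\<^esub> h) ` ?W"
    proof
      fix h assume h: "h \<in> supp b"
      then have "h = ?i g \<otimes>\<^bsub>G\<^esub> (g \<otimes>\<^bsub>G\<^esub> h)"
        using gG fin(4) by (subst G.m_assoc[symmetric]) auto
      moreover have "g \<otimes>\<^bsub>G\<^esub> h \<in> ?W"
        using g h unfolding products_def by force
      ultimately show "h \<in> (\<lambda>h. ?i g \<otimes>\<^bsub>G\<^esub> h) ` ?W"
        by blast
    qed
    have inj: "inj_on (\<lambda>h. ?i g \<otimes>\<^bsub>G\<^esub> h) ?W"
      using W(2) gG by (intro inj_onI) (simp add: subset_iff)
    have "(b \<otimes>\<^bsub>cp\<^esub> c) (?i g \<otimes>\<^bsub>G\<^esub> k) (act (?i g) y) = (\<Sum>h'\<in>(\<lambda>h. ?i g \<otimes>\<^bsub>G\<^esub> h) ` ?W.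
        b h' (act (?i g) y) * c (?i h' \<otimes>\<^bsub>G\<^esub> (?i g \<otimes>\<^bsub>G\<^esub> k)) (act (?i h') (act (?i g) y)))"
      using gG k by (intro cp_mult[OF b c V(1) sub V(2)]) simp
    also have "\<dots> = (\<Sum>h\<in>?W. b (?i g \<otimes>\<^bsub>G\<^esub> h) (act (?i g) y) * c (?i h \<otimes>\<^bsub>G\<^esub> k) (act (?i h) y))"
    proof (subst sum.reindex[OF inj], rule sum.cong[OF refl])
      fix h assume "h \<in> ?W"
      then have h: "h \<in> carrier G"
        using W(2) by blast
      have "?i (?i g \<otimes>\<^bsub>G\<^esub> h) \<otimes>\<^bsub>G\<^esub> ?i g = ?i h"
        using h gG by (simp add: G.inv_mult_group G.m_assoc)
      moreover have "?i (?i g \<otimes>\<^bsub>G\<^esub> h) \<otimes>\<^bsub>G\<^esub> (?i g \<otimes>\<^bsub>G\<^esub> k) = ?i h \<otimes>\<^bsub>G\<^esub> k"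
        using h gG k calculation by (metis G.inv_closed G.m_assoc G.m_closed)
      ultimately show "((\<lambda>h'. b h' (act (?i g) y) * c (?i h' \<otimes>\<^bsub>G\<^esub> (?i g \<otimes>\<^bsub>G\<^esub> k)) (act (?i h') (act (?i g) y)))
          \<circ> (\<lambda>h. ?i g \<otimes>\<^bsub>G\<^esub> h)) h
          = b (?i g \<otimes>\<^bsub>G\<^esub> h) (act (?i g) y) * c (?i h \<otimes>\<^bsub>G\<^esub> k) (act (?i h) y)"
        by (simp add: act_mult)
    qed
    finally show "(\<Sum>h\<in>?W. a g y * (b (?i g \<otimes>\<^bsub>G\<^esub> h) (act (?i g) y) * c (?i h \<otimes>\<^bsub>G\<^esub> k) (act (?i h) y)))
        = a g y * (b \<otimes>\<^bsub>cp\<^esub> c) (?i g \<otimes>\<^bsub>G\<^esub> k) (act (?i g) y)"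
      by (simp add: sum_distrib_left)
  qed
  also have "\<dots> = (a \<otimes>\<^bsub>cp\<^esub> (b \<otimes>\<^bsub>cp\<^esub> c)) k y"
    by (rule cp_mult[OF a cp_mult_closed[OF b c] fin(1) order_refl fin(3) k, symmetric])
  finally show "((a \<otimes>\<^bsub>cp\<^esub> b) \<otimes>\<^bsub>cp\<^esub> c) k y = (a \<otimes>\<^bsub>cp\<^esub> (b \<otimes>\<^bsub>cp\<^esub> c)) k y" .
qed (use a b c cp_mult_closed in auto)

lemma cp_one_left:
  assumes a: "a \<in> carrier cp"
  shows "\<one>\<^bsub>cp\<^esub> \<otimes>\<^bsub>cp\<^esub> a = a"
proof (rule cp_eqI)
  fix k y assume k: "k \<in> carrier G" "y \<in> XX"
  have "(\<one>\<^bsub>cp\<^esub> \<otimes>\<^bsub>cp\<^esub> a) k y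
      = (\<Sum>g\<in>{\<one>\<^bsub>G\<^esub>}. \<one>\<^bsub>cp\<^esub> g y * a (inv\<^bsub>G\<^esub> g \<otimes>\<^bsub>G\<^esub> k) (act (inv\<^bsub>G\<^esub> g) y))"
    by (rule cp_mult[OF cp_one_closed a _ _ _ k(1)]) (auto simp: cp_ops split: if_splits)
  then show "(\<one>\<^bsub>cp\<^esub> \<otimes>\<^bsub>cp\<^esub> a) k y = a k y"
    using k by (simp add: cp_ops)
qed (use a cp_mult_closed cp_one_closed in auto)

lemma cp_one_right:
  assumes a: "a \<in> carrier cp"
  shows "a \<otimes>\<^bsub>cp\<^esub> \<one>\<^bsub>cp\<^esub> = a"
proof (rule cp_eqI)
  fix k y assume k: "k \<in> carrier G" "y \<in> XX"
  have "(a \<otimes>\<^bsub>cp\<^esub> \<one>\<^bsub>cp\<^esub>) k y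
      = (\<Sum>g\<in>insert k (supp a). a g y * \<one>\<^bsub>cp\<^esub> (inv\<^bsub>G\<^esub> g \<otimes>\<^bsub>G\<^esub> k) (act (inv\<^bsub>G\<^esub> g) y))"
    by (rule cp_mult[OF a cp_one_closed _ _ _ k(1)]) (use cpD(2,6)[OF a] k in auto)
  also have "\<dots> = (\<Sum>g\<in>insert k (supp a). if g = k then a k y else 0)"
  proof (rule sum.cong[OF refl])
    fix g assume "g \<in> insert k (supp a)"
    then have g: "g \<in> carrier G"
      using k cpD(6)[OF a] by blast
    then have "inv\<^bsub>G\<^esub> g \<otimes>\<^bsub>G\<^esub> k = \<one>\<^bsub>G\<^esub> \<longleftrightarrow> g = k"
      using k by (metis G.inv_closed G.inv_inv G.inv_equality G.l_inv)
    then show "a g y * \<one>\<^bsub>cp\<^esub> (inv\<^bsub>G\<^esub> g \<otimes>\<^bsub>G\<^esub> k) (act (inv\<^bsub>G\<^esub> g) y) = (if g = k then a k y else 0)"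
      using cpD(5)[OF a, of g y] by (auto simp: cp_ops)
  qed
  also have "\<dots> = a k y"
    using cpD(2)[OF a] by simp
  finally show "(a \<otimes>\<^bsub>cp\<^esub> \<one>\<^bsub>cp\<^esub>) k y = a k y" .
qed (use a cp_mult_closed cp_one_closed in auto)

lemma cp_distrib:
  assumes a: "a \<in> carrier cp" and b: "b \<in> carrier cp" and c: "c \<in> carrier cp"
  shows "(a \<oplus>\<^bsub>cp\<^esub> b) \<otimes>\<^bsub>cp\<^esub> c = a \<otimes>\<^bsub>cp\<^esub> c \<oplus>\<^bsub>cp\<^esub> b \<otimes>\<^bsub>cp\<^esub> c"
    and "c \<otimes>\<^bsub>cp\<^esub> (a \<oplus>\<^bsub>cp\<^esub> b) = c \<otimes>\<^bsub>cp\<^esub> a \<oplus>\<^bsub>cp\<^esub> c \<otimes>\<^bsub>cp\<^esub> b"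
proof -
  have ab: "a \<oplus>\<^bsub>cp\<^esub> b \<in> carrier cp"
    by (rule cp_add_closed[OF a b])
  let ?W = "supp a \<union> supp b"
  have W: "finite ?W" "?W \<subseteq> carrier G" "supp (a \<oplus>\<^bsub>cp\<^esub> b) \<subseteq> ?W"
    using cpD(2,6)[OF a] cpD(2,6)[OF b] by (auto simp: cp_ops fun_eq_iff)
  show "(a \<oplus>\<^bsub>cp\<^esub> b) \<otimes>\<^bsub>cp\<^esub> c = a \<otimes>\<^bsub>cp\<^esub> c \<oplus>\<^bsub>cp\<^esub> b \<otimes>\<^bsub>cp\<^esub> c"
  proof (rule cp_eqI)
    fix k y assume k: "k \<in> carrier G"
    show "((a \<oplus>\<^bsub>cp\<^esub> b) \<otimes>\<^bsub>cp\<^esub> c) k y = (a \<otimes>\<^bsub>cp\<^esub> c \<oplus>\<^bsub>cp\<^esub> b \<otimes>\<^bsub>cp\<^esub> c) k y"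
      unfolding cp_ops cp_mult[OF a c W(1) Un_upper1 W(2) k] cp_mult[OF b c W(1) Un_upper2 W(2) k]
        cp_mult[OF ab[unfolded cp_ops] c W(1) W(3)[unfolded cp_ops] W(2) k]
      by (simp add: sum.distrib[symmetric] distrib_right)
  qed (use a b c in \<open>auto intro: cp_mult_closed cp_add_closed\<close>)
  show "c \<otimes>\<^bsub>cp\<^esub> (a \<oplus>\<^bsub>cp\<^esub> b) = c \<otimes>\<^bsub>cp\<^esub> a \<oplus>\<^bsub>cp\<^esub> c \<otimes>\<^bsub>cp\<^esub> b"
  proof (rule cp_eqI)
    fix k y assume k: "k \<in> carrier G"
    note c' = cpD(2)[OF c] order_refl cpD(6)[OF c] k
    show "(c \<otimes>\<^bsub>cp\<^esub> (a \<oplus>\<^bsub>cp\<^esub> b)) k y = (c \<otimes>\<^bsub>cp\<^esub> a \<oplus>\<^bsub>cp\<^esub> c \<otimes>\<^bsub>cp\<^esub> b) k y"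
      unfolding cp_ops cp_mult[OF c a c'] cp_mult[OF c b c'] cp_mult[OF c ab[unfolded cp_ops] c']
      by (simp add: sum.distrib[symmetric] distrib_left)
  qed (use a b c in \<open>auto intro: cp_mult_closed cp_add_closed\<close>)
qed

lemma cp_smult_mult:
  assumes a: "a \<in> carrier cp" and b: "b \<in> carrier cp"
  shows "(c \<odot>\<^bsub>cp\<^esub> a) \<otimes>\<^bsub>cp\<^esub> b = c \<odot>\<^bsub>cp\<^esub> (a \<otimes>\<^bsub>cp\<^esub> b)"
    and "a \<otimes>\<^bsub>cp\<^esub> (c \<odot>\<^bsub>cp\<^esub> b) = c \<odot>\<^bsub>cp\<^esub> (a \<otimes>\<^bsub>cp\<^esub> b)"
proof -
  note a' = cpD(2)[OF a] order_refl cpD(6)[OF a]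
  have supp: "supp (\<lambda>g p. c * a g p) \<subseteq> supp a"
    by (auto simp: fun_eq_iff)
  show "(c \<odot>\<^bsub>cp\<^esub> a) \<otimes>\<^bsub>cp\<^esub> b = c \<odot>\<^bsub>cp\<^esub> (a \<otimes>\<^bsub>cp\<^esub> b)"
  proof (rule cp_eqI)
    fix k y assume k: "k \<in> carrier G"
    show "((c \<odot>\<^bsub>cp\<^esub> a) \<otimes>\<^bsub>cp\<^esub> b) k y = (c \<odot>\<^bsub>cp\<^esub> (a \<otimes>\<^bsub>cp\<^esub> b)) k y"
      unfolding cp_ops cp_mult[OF a b a' k]
        cp_mult[OF cp_smult_closed[OF a, unfolded cp_ops] b a'(1) supp a'(3) k]
      by (simp add: sum_distrib_left mult.assoc)
  qed (use a b in \<open>auto intro: cp_mult_closed cp_smult_closed\<close>)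
  show "a \<otimes>\<^bsub>cp\<^esub> (c \<odot>\<^bsub>cp\<^esub> b) = c \<odot>\<^bsub>cp\<^esub> (a \<otimes>\<^bsub>cp\<^esub> b)"
  proof (rule cp_eqI)
    fix k y assume k: "k \<in> carrier G"
    show "(a \<otimes>\<^bsub>cp\<^esub> (c \<odot>\<^bsub>cp\<^esub> b)) k y = (c \<odot>\<^bsub>cp\<^esub> (a \<otimes>\<^bsub>cp\<^esub> b)) k y"
      unfolding cp_ops cp_mult[OF a b a' k] cp_mult[OF a cp_smult_closed[OF b, unfolded cp_ops] a' k]
      by (simp add: sum_distrib_left algebra_simps)
  qed (use a b in \<open>auto intro: cp_mult_closed cp_smult_closed\<close>)
qed

lemma cp_star_star:
  assumes a: "a \<in> carrier cp"
  shows "star cp (star cp a) = a"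
proof (rule cp_eqI)
  fix g y assume g: "g \<in> carrier G" "y \<in> XX"
  then show "star cp (star cp a) g y = a g y"
    using cpD(5)[OF a, of g y] by (auto simp: cp_star[OF cp_star_closed[OF a]] cp_star[OF a])
qed (use a cp_star_closed in auto)

lemma cp_star_mult:
  assumes a: "a \<in> carrier cp" and b: "b \<in> carrier cp"
  shows "star cp (a \<otimes>\<^bsub>cp\<^esub> b) = star cp b \<otimes>\<^bsub>cp\<^esub> star cp a"
proof (rule cp_eqI)
  note closed = cp_star_closed[OF a] cp_star_closed[OF b] cp_mult_closed[OF a b]
  fix k y assume k: "k \<in> carrier G" and y: "y \<in> XX"
  let ?i = "\<lambda>g. inv\<^bsub>G\<^esub> g"
  let ?W = "supp (star cp b) \<union> (\<lambda>g. k \<otimes>\<^bsub>G\<^esub> g) ` supp a"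
  let ?V = "(\<lambda>h. ?i k \<otimes>\<^bsub>G\<^esub> h) ` ?W"
  have W: "finite ?W" "?W \<subseteq> carrier G"
    using cpD(2,6)[OF a] cpD(2,6)[OF closed(2)] k by auto
  have V: "finite ?V" "?V \<subseteq> carrier G"
    using W k by auto
  have sub: "supp a \<subseteq> ?V"
  proof
    fix g assume g: "g \<in> supp a"
    then have "g = ?i k \<otimes>\<^bsub>G\<^esub> (k \<otimes>\<^bsub>G\<^esub> g)"
      using k cpD(6)[OF a] by (subst G.m_assoc[symmetric]) auto
    then show "g \<in> ?V"
      using g by blast
  qed
  have inj: "inj_on (\<lambda>h. ?i k \<otimes>\<^bsub>G\<^esub> h) ?W"
    using W(2) k by (intro inj_onI) (simp add: subset_iff)
  have "star cp (a \<otimes>\<^bsub>cp\<^esub> b) k y = cnj ((a \<otimes>\<^bsub>cp\<^esub> b) (?i k) (act (?i k) y))"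
    using k y by (simp add: cp_star[OF closed(3)])
  also have "\<dots> = (\<Sum>g\<in>?V. cnj (a g (act (?i k) y)) * cnj (b (?i g \<otimes>\<^bsub>G\<^esub> ?i k) (act (?i g) (act (?i k) y))))"
    by (subst cp_mult[OF a b V(1) sub V(2)]) (use k in auto)
  also have "\<dots> = (\<Sum>h\<in>?W. star cp b h y * star cp a (?i h \<otimes>\<^bsub>G\<^esub> k) (act (?i h) y))"
  proof (subst sum.reindex[OF inj], rule sum.cong[OF refl])
    fix h assume "h \<in> ?W"
    then have h: "h \<in> carrier G"
      using W(2) by blast
    have e1: "?i (?i k \<otimes>\<^bsub>G\<^esub> h) \<otimes>\<^bsub>G\<^esub> ?i k = ?i h"
      using h k by (simp add: G.inv_mult_group G.m_assoc)
    have e2: "?i (?i h \<otimes>\<^bsub>G\<^esub> k) = ?i k \<otimes>\<^bsub>G\<^esub> h"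
      using h k by (simp add: G.inv_mult_group)
    have e3: "(?i k \<otimes>\<^bsub>G\<^esub> h) \<otimes>\<^bsub>G\<^esub> ?i h = ?i k"
      using h k by (simp add: G.m_assoc)
    have "star cp b h y = cnj (b (?i h) (act (?i h) y))"
      using h y by (simp add: cp_star[OF b])
    moreover have "b (?i h) (act (?i h) y) \<noteq> 0 \<Longrightarrow> act (?i h) y \<in> XX"
      by (rule cpD(4)[OF b])
    ultimately show "((\<lambda>g. cnj (a g (act (?i k) y)) * cnj (b (?i g \<otimes>\<^bsub>G\<^esub> ?i k) (act (?i g) (act (?i k) y))))
          \<circ> (\<lambda>h. ?i k \<otimes>\<^bsub>G\<^esub> h)) h
        = star cp b h y * star cp a (?i h \<otimes>\<^bsub>G\<^esub> k) (act (?i h) y)"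
      using h k by (auto simp: cp_star[OF a] act_mult e1 e2 e3)
  qed
  also have "\<dots> = (star cp b \<otimes>\<^bsub>cp\<^esub> star cp a) k y"
    by (rule cp_mult[OF closed(2,1) W(1) Un_upper1 W(2) k, symmetric])
  finally show "star cp (a \<otimes>\<^bsub>cp\<^esub> b) k y = (star cp b \<otimes>\<^bsub>cp\<^esub> star cp a) k y" .
qed (use a b in \<open>auto intro: cp_mult_closed cp_star_closed\<close>)

lemma cp_star_algebra: "star_algebra cp"
proof (rule star_algebraI)
  show "\<zero>\<^bsub>cp\<^esub> \<in> carrier cp"
    by (auto simp: cp_carrier cp_ops C_zero)
  show "star cp (a \<oplus>\<^bsub>cp\<^esub> b) = star cp a \<oplus>\<^bsub>cp\<^esub> star cp b" if "a \<in> carrier cp" "b \<in> carrier cp" for a b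
    using that cp_add_closed[OF that] by (auto simp: fun_eq_iff cp_star cp_ops)
  show "star cp (c \<odot>\<^bsub>cp\<^esub> a) = cnj c \<odot>\<^bsub>cp\<^esub> star cp a" if "a \<in> carrier cp" for a c
    using that cp_smult_closed[OF that, of c] by (auto simp: fun_eq_iff cp_star cp_ops)
qed (use cp_add_closed cp_mult_closed cp_smult_closed cp_one_closed cp_star_closed cp_mult_assoc
      cp_one_left cp_one_right cp_distrib cp_smult_mult cp_star_star cp_star_mult in
      \<open>simp_all add: cp_ops algebra_simps\<close>)

end

section \<open>The coefficient norm on the crossed product\<close>

context adic
begin

definition supn :: "(point \<Rightarrow> complex) \<Rightarrow> real" where
  "supn f = (SUP p\<in>XX. cmod (f p))"

text \<open>
  The norm of the Banach algebra \<open>l\<^sup>1 (G, C(X))\<close>.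
\<close>

definition l1 :: "(real \<times> int \<Rightarrow> point \<Rightarrow> complex) \<Rightarrow> real" where
  "l1 a = (\<Sum>g\<in>supp a. supn (a g))"

lemma XX_ne: "XX \<noteq> {}"
  using zero_in_X by blast

lemma C_bounded:
  assumes f: "f \<in> carrier C"
  shows "bdd_above ((\<lambda>p. cmod (f p)) ` XX)"
proof -
  obtain m where m: "\<And>p q. p \<in> Dbl \<Longrightarrow> q \<in> Dbl \<Longrightarrow> ad m p = ad m q \<Longrightarrow> cmod (f p - f q) < 1"
    using C_uniform[OF f, of 1] by auto
  define rep where "rep j = (SOME p. p \<in> XX \<and> ad m p = j)" for j
  have "cmod (f p) \<le> (\<Sum>j\<in>{0..<int n ^ m}. cmod (f (rep j))) + 1" if p: "p \<in> XX" for p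
  proof -
    have rep: "rep (ad m p) \<in> XX" "ad m (rep (ad m p)) = ad m p"
      using someI[of "\<lambda>q. q \<in> XX \<and> ad m q = ad m p" p] p by (auto simp: rep_def)
    have "cmod (f p) \<le> cmod (f (rep (ad m p))) + cmod (f p - f (rep (ad m p)))"
      by (rule norm_triangle_sub)
    also have "cmod (f p - f (rep (ad m p))) \<le> 1"
      using m[OF X_in_D[OF p] X_in_D[OF rep(1)]] rep(2) by simp
    also have "cmod (f (rep (ad m p))) \<le> (\<Sum>j\<in>{0..<int n ^ m}. cmod (f (rep j)))"
      using addr_range[OF p, of m] by (intro member_le_sum) auto
    finally show ?thesis
      by simp
  qed
  then show ?thesis
    by (intro bdd_aboveI2)
qed

lemma supn_upper:
  assumes "f \<in> carrier C"
  shows "cmod (f y) \<le> supn f"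
proof -
  have up: "cmod (f y) \<le> supn f" if "y \<in> XX" for y
    unfolding supn_def using that by (intro cSUP_upper C_bounded[OF assms])
  show ?thesis
  proof (cases "y \<in> XX")
    case False
    then have "f y = 0"
      using C_outside[OF assms] by blast
    then show ?thesis
      using order_trans[OF norm_ge_zero up[OF zero_in_X]] by simp
  qed (rule up)
qed

lemma supn_nonneg: "f \<in> carrier C \<Longrightarrow> 0 \<le> supn f"
  using supn_upper[of f "(0, Above)"] norm_ge_zero[of "f (0, Above)"] by linarith

lemma supn_least: "(\<And>y. y \<in> XX \<Longrightarrow> cmod (f y) \<le> K) \<Longrightarrow> supn f \<le> K"
  unfolding supn_def by (intro cSUP_least XX_ne)

lemma supn_zero [simp]: "supn (\<lambda>p. 0) = 0"
  using XX_ne by (simp add: supn_def)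

lemma l1_superset:
  assumes "finite W" "supp a \<subseteq> W"
  shows "l1 a = (\<Sum>g\<in>W. supn (a g))"
  unfolding l1_def using assms by (intro sum.mono_neutral_left) auto

lemma l1_ge_sum:
  assumes a: "a \<in> carrier cp" and W: "finite W"
  shows "(\<Sum>g\<in>W. supn (a g)) \<le> l1 a"
proof -
  have "(\<Sum>g\<in>W. supn (a g)) \<le> (\<Sum>g\<in>W \<union> supp a. supn (a g))"
    using W cpD(2)[OF a] by (intro sum_mono2) (auto intro: supn_nonneg cpD(1)[OF a])
  also have "\<dots> = l1 a"
    using W cpD(2)[OF a] by (intro l1_superset[symmetric]) auto
  finally show ?thesis .
qed

lemma l1_nonneg: "a \<in> carrier cp \<Longrightarrow> 0 \<le> l1 a"
  unfolding l1_def by (intro sum_nonneg supn_nonneg cpD(1))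

lemma l1_add:
  assumes a: "a \<in> carrier cp" and b: "b \<in> carrier cp"
  shows "l1 (a \<oplus>\<^bsub>cp\<^esub> b) \<le> l1 a + l1 b"
proof -
  let ?W = "supp a \<union> supp b"
  have W: "finite ?W"
    using cpD(2)[OF a] cpD(2)[OF b] by simp
  have "l1 (a \<oplus>\<^bsub>cp\<^esub> b) = (\<Sum>g\<in>?W. supn ((a \<oplus>\<^bsub>cp\<^esub> b) g))"
    by (rule l1_superset[OF W]) (auto simp: cp_ops fun_eq_iff)
  also have "\<dots> \<le> (\<Sum>g\<in>?W. supn (a g) + supn (b g))"
  proof (intro sum_mono supn_least)
    fix g y
    show "cmod ((a \<oplus>\<^bsub>cp\<^esub> b) g y) \<le> supn (a g) + supn (b g)"
      using norm_triangle_mono[OF supn_upper[OF cpD(1)[OF a]] supn_upper[OF cpD(1)[OF b]], of g y g y]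
      by (simp add: cp_ops)
  qed
  also have "\<dots> = l1 a + l1 b"
    using l1_superset[OF W Un_upper1] l1_superset[OF W Un_upper2] by (simp add: sum.distrib)
  finally show ?thesis .
qed

lemma l1_smult:
  assumes a: "a \<in> carrier cp"
  shows "l1 (c \<odot>\<^bsub>cp\<^esub> a) \<le> cmod c * l1 a"
proof -
  have "l1 (c \<odot>\<^bsub>cp\<^esub> a) = (\<Sum>g\<in>supp a. supn ((c \<odot>\<^bsub>cp\<^esub> a) g))"
    by (rule l1_superset[OF cpD(2)[OF a]]) (auto simp: cp_ops fun_eq_iff)
  also have "\<dots> \<le> (\<Sum>g\<in>supp a. cmod c * supn (a g))"
    using supn_upper[OF cpD(1)[OF a]]
    by (intro sum_mono supn_least) (simp add: cp_ops norm_mult mult_left_mono)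
  finally show ?thesis
    by (simp add: l1_def sum_distrib_left)
qed

lemma l1_mult:
  assumes a: "a \<in> carrier cp" and b: "b \<in> carrier cp"
  shows "l1 (a \<otimes>\<^bsub>cp\<^esub> b) \<le> l1 a * l1 b"
proof -
  note fin = cpD(2)[OF a] cpD(2)[OF b] cpD(6)[OF a] cpD(6)[OF b]
  let ?W = "products (supp a) (supp b)"
  have W: "finite ?W" "?W \<subseteq> carrier G"
    using fin by (simp_all only: products_simps)
  have "l1 (a \<otimes>\<^bsub>cp\<^esub> b) = (\<Sum>k\<in>?W. supn ((a \<otimes>\<^bsub>cp\<^esub> b) k))"
    by (rule l1_superset[OF W(1) cp_mult_supp[OF a b]])
  also have "\<dots> \<le> (\<Sum>k\<in>?W. \<Sum>g\<in>supp a. supn (a g) * supn (b (inv\<^bsub>G\<^esub> g \<otimes>\<^bsub>G\<^esub> k)))"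
  proof (intro sum_mono supn_least)
    fix k y assume "k \<in> ?W"
    then have k: "k \<in> carrier G"
      using W(2) by blast
    have "cmod ((a \<otimes>\<^bsub>cp\<^esub> b) k y)
        \<le> (\<Sum>g\<in>supp a. cmod (a g y * b (inv\<^bsub>G\<^esub> g \<otimes>\<^bsub>G\<^esub> k) (act (inv\<^bsub>G\<^esub> g) y)))"
      unfolding cp_mult[OF a b fin(1) order_refl fin(3) k] by (rule norm_sum)
    also have "\<dots> \<le> (\<Sum>g\<in>supp a. supn (a g) * supn (b (inv\<^bsub>G\<^esub> g \<otimes>\<^bsub>G\<^esub> k)))"
      unfolding norm_mult using supn_nonneg[OF cpD(1)[OF a]]
      by (intro sum_mono mult_mono supn_upper cpD(1)[OF a] cpD(1)[OF b]) auto
    finally show "cmod ((a \<otimes>\<^bsub>cp\<^esub> b) k y) \<le> (\<Sum>g\<in>supp a. supn (a g) * supn (b (inv\<^bsub>G\<^esub> g \<otimes>\<^bsub>G\<^esub> k)))" .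
  qed
  also have "\<dots> = (\<Sum>g\<in>supp a. supn (a g) * (\<Sum>k\<in>?W. supn (b (inv\<^bsub>G\<^esub> g \<otimes>\<^bsub>G\<^esub> k))))"
    by (subst sum.swap) (simp add: sum_distrib_left)
  also have "\<dots> \<le> (\<Sum>g\<in>supp a. supn (a g) * l1 b)"
  proof (intro sum_mono mult_left_mono supn_nonneg cpD(1)[OF a])
    fix g assume "g \<in> supp a"
    then have g: "g \<in> carrier G"
      using fin(3) by blast
    have inj: "inj_on (\<lambda>k. inv\<^bsub>G\<^esub> g \<otimes>\<^bsub>G\<^esub> k) ?W"
      using W(2) g by (intro inj_onI) (simp add: subset_iff)
    have "(\<Sum>k\<in>?W. supn (b (inv\<^bsub>G\<^esub> g \<otimes>\<^bsub>G\<^esub> k))) = (\<Sum>h\<in>(\<lambda>k. inv\<^bsub>G\<^esub> g \<otimes>\<^bsub>G\<^esub> k) ` ?W. supn (b h))"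
      by (simp add: sum.reindex[OF inj])
    also have "\<dots> \<le> l1 b"
      using W(1) by (intro l1_ge_sum[OF b]) simp
    finally show "(\<Sum>k\<in>?W. supn (b (inv\<^bsub>G\<^esub> g \<otimes>\<^bsub>G\<^esub> k))) \<le> l1 b" .
  qed
  finally show ?thesis
    by (simp add: l1_def sum_distrib_right)
qed

lemma l1_star:
  assumes a: "a \<in> carrier cp"
  shows "l1 (star cp a) \<le> l1 a"
proof -
  let ?W = "(\<lambda>g. inv\<^bsub>G\<^esub> g) ` supp a"
  have inj: "inj_on (\<lambda>g. inv\<^bsub>G\<^esub> g) (supp a)"
  proof (rule inj_onI)
    fix g h assume gh: "g \<in> supp a" "h \<in> supp a" "inv\<^bsub>G\<^esub> g = inv\<^bsub>G\<^esub> h"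
    then have "g \<in> carrier G" "h \<in> carrier G"
      using cpD(6)[OF a] by blast+
    then show "g = h"
      using arg_cong[OF gh(3), of "\<lambda>g. inv\<^bsub>G\<^esub> g"] by simp
  qed
  have "l1 (star cp a) = (\<Sum>g\<in>?W. supn (star cp a g))"
    by (rule l1_superset[OF _ cp_star_supp[OF a]]) (use cpD(2)[OF a] in simp)
  also have "\<dots> = (\<Sum>g\<in>supp a. supn (star cp a (inv\<^bsub>G\<^esub> g)))"
    by (simp add: sum.reindex[OF inj])
  also have "\<dots> \<le> (\<Sum>g\<in>supp a. supn (a g))"
  proof (intro sum_mono supn_least)
    fix g y assume "g \<in> supp a"
    then have "g \<in> carrier G"
      using cpD(6)[OF a] by blast
    then show "cmod (star cp a (inv\<^bsub>G\<^esub> g) y) \<le> supn (a g)"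
      using supn_upper[OF cpD(1)[OF a], of g "act g y"] supn_nonneg[OF cpD(1)[OF a], of g]
      by (simp add: cp_star[OF a])
  qed
  finally show ?thesis
    by (simp add: l1_def)
qed

subsection \<open>Monomials\<close>

text \<open>
  The monomial \<open>f U\<^sup>g\<close>.
\<close>

definition mono :: "real \<times> int \<Rightarrow> (point \<Rightarrow> complex) \<Rightarrow> real \<times> int \<Rightarrow> point \<Rightarrow> complex" where
  "mono g f = (\<lambda>h. if h = g then f else (\<lambda>p. 0))"

lemma mono_closed:
  assumes "g \<in> carrier G" "f \<in> carrier C" "\<And>y. f y \<noteq> 0 \<Longrightarrow> act (inv\<^bsub>G\<^esub> g) y \<in> XX"
  shows "mono g f \<in> carrier cp"
  by (rule cp_I[of _ "{g}"]) (use assms in \<open>auto simp: mono_def split: if_splits\<close>)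

lemma mono_one: "\<one>\<^bsub>cp\<^esub> = mono \<one>\<^bsub>G\<^esub> (\<lambda>p. if p \<in> XX then 1 else 0)"
  by (simp add: fun_eq_iff cp_ops mono_def)

lemma mono_mult:
  assumes f: "mono g f \<in> carrier cp" and f': "mono h f' \<in> carrier cp"
    and g: "g \<in> carrier G" and h: "h \<in> carrier G"
  shows "mono g f \<otimes>\<^bsub>cp\<^esub> mono h f' = mono (g \<otimes>\<^bsub>G\<^esub> h) (\<lambda>y. f y * f' (act (inv\<^bsub>G\<^esub> g) y))"
proof (intro ext)
  fix k y
  show "(mono g f \<otimes>\<^bsub>cp\<^esub> mono h f') k y = mono (g \<otimes>\<^bsub>G\<^esub> h) (\<lambda>y. f y * f' (act (inv\<^bsub>G\<^esub> g) y)) k y"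
  proof (cases "k \<in> carrier G")
    case True
    have "(mono g f \<otimes>\<^bsub>cp\<^esub> mono h f') k y
        = (\<Sum>g'\<in>{g}. mono g f g' y * mono h f' (inv\<^bsub>G\<^esub> g' \<otimes>\<^bsub>G\<^esub> k) (act (inv\<^bsub>G\<^esub> g') y))"
      by (rule cp_mult[OF f f']) (use g True in \<open>auto simp: mono_def split: if_splits\<close>)
    moreover have "inv\<^bsub>G\<^esub> g \<otimes>\<^bsub>G\<^esub> k = h \<longleftrightarrow> k = g \<otimes>\<^bsub>G\<^esub> h"
      using G.inv_solve_left[OF h g True] by auto
    ultimately show ?thesis
      by (simp add: mono_def)
  next
    case False
    then have "k \<noteq> g \<otimes>\<^bsub>G\<^esub> h"
      using g h by auto
    then show ?thesis
      using cp_mult_outside[OF f f' False] by (simp add: mono_def)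
  qed
qed

lemma mono_star:
  assumes f: "mono g f \<in> carrier cp" and g: "g \<in> carrier G"
  shows "star cp (mono g f) = mono (inv\<^bsub>G\<^esub> g) (\<lambda>y. if y \<in> XX then cnj (f (act g y)) else 0)"
proof (intro ext)
  fix h y
  have "inv\<^bsub>G\<^esub> h = g \<longleftrightarrow> h = inv\<^bsub>G\<^esub> g" if "h \<in> carrier G"
    using that g by auto
  moreover have "inv\<^bsub>G\<^esub> g \<in> carrier G"
    using g by simp
  ultimately show "star cp (mono g f) h y = mono (inv\<^bsub>G\<^esub> g) (\<lambda>y. if y \<in> XX then cnj (f (act g y)) else 0) h y"
    unfolding cp_star[OF f] unfolding mono_def using g by (cases "h = inv\<^bsub>G\<^esub> g") auto
qed

lemma cp_alg: "star_alg cp"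
  by (rule star_alg.intro[OF cp_star_algebra])

sublocale cp: star_alg cp
  by (rule cp_alg)

lemma cp_finsum:
  assumes "finite I" "\<And>i. i \<in> I \<Longrightarrow> a i \<in> carrier cp"
  shows "finsum cp a I g y = (\<Sum>i\<in>I. a i g y)"
  using assms
proof (induction I rule: finite_induct)
  case empty
  then show ?case
    by (simp add: cp_ops(1))
next
  case (insert i I)
  have "finsum cp a (insert i I) = a i \<oplus>\<^bsub>cp\<^esub> finsum cp a I"
    using insert by (intro cp.sum_insert) auto
  then show ?case
    using insert by (simp add: cp_ops(3))
qed

lemma mono_coefficient_closed:
  assumes a: "a \<in> carrier cp" and g: "g \<in> supp a"
  shows "mono g (a g) \<in> carrier cp"
  using cpD(6)[OF a] g by (intro mono_closed cpD(1)[OF a] cpD(5)[OF a]) auto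

lemma mono_sum:
  assumes a: "a \<in> carrier cp"
  shows "a = finsum cp (\<lambda>g. mono g (a g)) (supp a)"
proof (intro ext)
  fix g y
  have "finsum cp (\<lambda>g. mono g (a g)) (supp a) g y = (\<Sum>h\<in>supp a. mono h (a h) g y)"
    using mono_coefficient_closed[OF a] by (intro cp_finsum cpD(2)[OF a])
  also have "\<dots> = (\<Sum>h\<in>supp a. if h = g then a g y else 0)"
    by (intro sum.cong) (auto simp: mono_def)
  also have "\<dots> = a g y"
    using cpD(2)[OF a] by simp
  finally show "a g y = finsum cp (\<lambda>g. mono g (a g)) (supp a) g y" ..
qed

subsection \<open>Every C*-seminorm is dominated by the coefficient norm\<close>

text \<open>
  A continuous function with values in \<open>{0..K}\<close> is \<open>K / 2\<close> times the sum of a unitary function and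
  its adjoint, and unitaries are contractions for every C*-seminorm.
\<close>

lemma seminorm_function_le:
  assumes p: "p \<in> cstar_seminorms cp"
    and h: "h \<in> carrier C" "\<And>y. h y = of_real (r y)" "\<And>y. 0 \<le> r y" "\<And>y. r y \<le> K" and K: "K > 0"
  shows "p (mono \<one>\<^bsub>G\<^esub> h) \<le> K"
proof -
  interpret P: cstar_seminormed cp p
    by (rule cstar_seminormedI[OF cp_star_algebra p])
  define z where "z w = Complex (Re w / K) (sqrt (1 - (min 1 \<bar>Re w / K\<bar>)\<^sup>2))" for w
  have cont: "continuous_on UNIV z"
    unfolding z_def Complex_eq by (intro continuous_intros) (use K in auto)
  have small: "0 \<le> r y / K" "r y / K \<le> 1" for y
    using h(3,4) K by (simp_all add: field_simps)
  have z: "z (h y) * cnj (z (h y)) = 1" "z (h y) + cnj (z (h y)) = of_real (2 * (r y / K))" for y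
  proof -
    have eq: "z (h y) = Complex (r y / K) (sqrt (1 - (r y / K)\<^sup>2))"
      using small[of y] K h(3)[of y] by (simp add: z_def h(2) min_absorb2)
    have "(r y / K)\<^sup>2 \<le> 1"
      using small[of y] by (simp add: power_le_one)
    then show "z (h y) * cnj (z (h y)) = 1"
      unfolding eq complex_mult_cnj by (simp del: power_divide)
    show "z (h y) + cnj (z (h y)) = of_real (2 * (r y / K))"
      unfolding eq by (simp add: complex_eq_iff)
  qed
  define u where "u = mono \<one>\<^bsub>G\<^esub> (\<lambda>y. if y \<in> XX then z (h y) else 0)"
  have u: "u \<in> carrier cp"
    unfolding u_def by (rule mono_closed) (use C_compose[OF h(1) cont] in \<open>auto split: if_splits\<close>)
  have star_u: "star cp u = mono \<one>\<^bsub>G\<^esub> (\<lambda>y. if y \<in> XX then cnj (z (h y)) else 0)"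
    using mono_star[OF u[unfolded u_def]] by (simp add: u_def cong: if_cong)
  have su: "mono \<one>\<^bsub>G\<^esub> (\<lambda>y. if y \<in> XX then cnj (z (h y)) else 0) \<in> carrier cp"
    using cp_star_closed[OF u] by (simp only: star_u)
  have "star cp u \<otimes>\<^bsub>cp\<^esub> u = mono \<one>\<^bsub>G\<^esub> (\<lambda>y. (if y \<in> XX then cnj (z (h y)) else 0) * (if y \<in> XX then z (h y) else 0))"
    unfolding star_u using mono_mult[OF su u[unfolded u_def] G.one_closed G.one_closed]
    unfolding u_def G.inv_one act_one by simp
  also have "\<dots> = \<one>\<^bsub>cp\<^esub>"
    unfolding mono_one using z(1) by (intro arg_cong[where f = "mono _"] ext) (simp add: mult.commute)
  finally have unitary: "star cp u \<otimes>\<^bsub>cp\<^esub> u = \<one>\<^bsub>cp\<^esub>" .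
  have "p u \<le> 1"
    using P.isometry_le_one[OF u] P.one_le unitary by simp
  moreover have "mono \<one>\<^bsub>G\<^esub> h = of_real (K / 2) \<odot>\<^bsub>cp\<^esub> (u \<oplus>\<^bsub>cp\<^esub> star cp u)"
  proof (intro ext)
    fix g y
    have "h y = of_real (K / 2) * ((if y \<in> XX then z (h y) else 0) + (if y \<in> XX then cnj (z (h y)) else 0))"
    proof (cases "y \<in> XX")
      case True
      have "h y = of_real (K / 2) * (z (h y) + cnj (z (h y)))"
        unfolding z(2) using K by (simp add: h(2))
      then show ?thesis
        using True by (simp only: if_True)
    next
      case False
      then show ?thesis
        using C_outside[OF h(1), of y] by auto
    qed
    then show "mono \<one>\<^bsub>G\<^esub> h g y = (of_real (K / 2) \<odot>\<^bsub>cp\<^esub> (u \<oplus>\<^bsub>cp\<^esub> star cp u)) g y"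
      unfolding cp_ops star_u unfolding u_def mono_def by (cases "g = \<one>\<^bsub>G\<^esub>") simp_all
  qed
  moreover have "p (of_real (K / 2) \<odot>\<^bsub>cp\<^esub> (u \<oplus>\<^bsub>cp\<^esub> star cp u)) = K / 2 * p (u \<oplus>\<^bsub>cp\<^esub> star cp u)"
    using P.homogeneous[of "u \<oplus>\<^bsub>cp\<^esub> star cp u" "of_real (K / 2)"] u K cp_star_closed[OF u]
    by (simp add: norm_divide)
  moreover have "p (u \<oplus>\<^bsub>cp\<^esub> star cp u) \<le> p u + p u"
    using P.triangle[OF u cp_star_closed[OF u]] P.seminorm_star[OF u] by simp
  ultimately have "p (mono \<one>\<^bsub>G\<^esub> h) = K / 2 * p (u \<oplus>\<^bsub>cp\<^esub> star cp u)" "p (u \<oplus>\<^bsub>cp\<^esub> star cp u) \<le> 2"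
    by simp_all
  then show ?thesis
    using K mult_left_mono[of "p (u \<oplus>\<^bsub>cp\<^esub> star cp u)" 2 "K / 2"] by linarith
qed

text \<open>
  By the C*-identity \<open>p (f U\<^sup>g) ^ 2 = p (\<bar>f \<circ> \<beta>\<^sub>g\<bar>\<^sup>2)\<close>, and the function on the right is bounded by the square
  of the supremum norm of \<open>f\<close>.
\<close>

lemma seminorm_mono_le:
  assumes p: "p \<in> cstar_seminorms cp"
    and g: "g \<in> carrier G" and f: "f \<in> carrier C" "\<And>y. f y \<noteq> 0 \<Longrightarrow> act (inv\<^bsub>G\<^esub> g) y \<in> XX"
  shows "p (mono g f) \<le> supn f"
proof -
  interpret P: cstar_seminormed cp p
    by (rule cstar_seminormedI[OF cp_star_algebra p])
  have closed: "mono g f \<in> carrier cp"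
    by (rule mono_closed[OF g f])
  show ?thesis
  proof (cases "supn f = 0")
    case True
    have "f = (\<lambda>p. 0)"
    proof
      fix y
      show "f y = 0"
        using supn_upper[OF f(1), of y] True by simp
    qed
    then have "mono g f = \<zero>\<^bsub>cp\<^esub>"
      unfolding mono_def cp_ops(1) by (intro ext) simp
    then show ?thesis
      using True by simp
  next
    case False
    then have pos: "supn f > 0"
      using supn_nonneg[OF f(1)] by simp
    define h where "h y = (if y \<in> XX then f (act g y) * cnj (f (act g y)) else 0)" for y
    have h: "h \<in> carrier C"
    proof -
      have "(\<lambda>y. if y \<in> XX then f (act g y) else 0) \<in> carrier C"
        by (rule C_translate[OF g f(1)])
      from C_mult[OF this C_cnj[OF this]]
      have "(\<lambda>y. (if y \<in> XX then f (act g y) else 0) * cnj (if y \<in> XX then f (act g y) else 0)) \<in> carrier C" .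
      also have "(\<lambda>y. (if y \<in> XX then f (act g y) else 0) * cnj (if y \<in> XX then f (act g y) else 0)) = h"
        by (intro ext) (simp add: h_def)
      finally show ?thesis .
    qed
    have sm: "mono (inv\<^bsub>G\<^esub> g) (\<lambda>y. if y \<in> XX then cnj (f (act g y)) else 0) \<in> carrier cp"
      using cp_star_closed[OF closed] unfolding mono_star[OF closed g] .
    have "star cp (mono g f) \<otimes>\<^bsub>cp\<^esub> mono g f = mono (inv\<^bsub>G\<^esub> g \<otimes>\<^bsub>G\<^esub> g)
        (\<lambda>y. (if y \<in> XX then cnj (f (act g y)) else 0) * f (act (inv\<^bsub>G\<^esub> (inv\<^bsub>G\<^esub> g)) y))"
      unfolding mono_star[OF closed g] by (rule mono_mult[OF sm closed G.inv_closed[OF g] g])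
    also have "(\<lambda>y. (if y \<in> XX then cnj (f (act g y)) else 0) * f (act (inv\<^bsub>G\<^esub> (inv\<^bsub>G\<^esub> g)) y)) = h"
      unfolding G.inv_inv[OF g] by (intro ext) (simp add: h_def mult.commute)
    also have "inv\<^bsub>G\<^esub> g \<otimes>\<^bsub>G\<^esub> g = \<one>\<^bsub>G\<^esub>"
      by (rule G.l_inv[OF g])
    finally have "star cp (mono g f) \<otimes>\<^bsub>cp\<^esub> mono g f = mono \<one>\<^bsub>G\<^esub> h" .
    then have "(p (mono g f))\<^sup>2 = p (mono \<one>\<^bsub>G\<^esub> h)"
      using P.cstar_identity[OF closed] by simp
    also have "\<dots> \<le> (supn f)\<^sup>2"
    proof (rule seminorm_function_le[OF p h, where r = "\<lambda>y. if y \<in> XX then (cmod (f (act g y)))\<^sup>2 else 0"])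
      show "h y = of_real (if y \<in> XX then (cmod (f (act g y)))\<^sup>2 else 0)" for y
      proof (cases "y \<in> XX")
        case True
        show ?thesis
          unfolding h_def if_P[OF True] by (rule complex_norm_square[symmetric])
      qed (simp add: h_def)
      show "(if y \<in> XX then (cmod (f (act g y)))\<^sup>2 else 0) \<le> (supn f)\<^sup>2" for y
        using supn_upper[OF f(1), of "act g y"] by (simp add: power_mono)
      show "0 \<le> (if y \<in> XX then (cmod (f (act g y)))\<^sup>2 else 0)" for y
        by simp
      show "(supn f)\<^sup>2 > 0"
        using pos by simp
    qed
    finally show ?thesis
      using less_imp_le[OF pos] by (rule power2_le_imp_le)
  qed
qed

lemma seminorm_le_l1:
  assumes p: "p \<in> cstar_seminorms cp" and a: "a \<in> carrier cp"
  shows "p a \<le> l1 a"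
proof -
  interpret P: cstar_seminormed cp p
    by (rule cstar_seminormedI[OF cp_star_algebra p])
  have "p a = p (finsum cp (\<lambda>g. mono g (a g)) (supp a))"
    using mono_sum[OF a] by simp
  also have "\<dots> \<le> (\<Sum>g\<in>supp a. p (mono g (a g)))"
    by (rule P.sum_le[OF cpD(2)[OF a] mono_coefficient_closed[OF a]])
  also have "\<dots> \<le> l1 a"
    unfolding l1_def using cpD(6)[OF a]
    by (intro sum_mono seminorm_mono_le[OF p] cpD(1)[OF a] cpD(5)[OF a]) auto
  finally show ?thesis .
qed

end

section \<open>The Cuntz family in the crossed product\<close>

context adic
begin

definition cyl :: "nat \<Rightarrow> nat \<Rightarrow> point \<Rightarrow> complex" where
  "cyl m j = (\<lambda>p. if p \<in> XX \<and> ad m p = int j then 1 else 0)"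

text \<open>
  The group element that maps the Cantor space onto the cylinder with address \<open>j\<close> of level \<open>m\<close>.
\<close>

definition contraction :: "nat \<Rightarrow> nat \<Rightarrow> real \<times> int" where
  "contraction m j = (real j / real n ^ m, int m)"

definition cuntz_generator :: "nat \<Rightarrow> real \<times> int \<Rightarrow> point \<Rightarrow> complex" where
  "cuntz_generator i = mono (contraction 1 i) (cyl 1 i)"

lemma contraction_G [simp, intro]: "contraction m j \<in> carrier G"
  using integer_adic[of "int j" m] by (simp add: contraction_def adic_group_def)

lemma contraction_zero: "contraction 0 0 = \<one>\<^bsub>G\<^esub>"
  by (simp add: contraction_def adic_group_def)

lemma contraction_mult: "contraction m j \<otimes>\<^bsub>G\<^esub> contraction 1 i = contraction (Suc m) (n * j + i)"
proof -
  have "real i / real n / real n ^ m + real j / real n ^ m = (real n * real j + real i) / (real n * real n ^ m)"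
    using n_pos by (simp add: add_divide_distrib)
  then show ?thesis
    by (simp add: contraction_def adic_group_def)
qed

lemma contraction_quotient:
  "contraction m j \<otimes>\<^bsub>G\<^esub> inv\<^bsub>G\<^esub> (contraction L k)
    = (of_int (int j - int k) / real n ^ m, int m - int L)"
proof -
  have "inv\<^bsub>G\<^esub> (contraction L k) = (- (real n powi int L * (real k / real n ^ L)), - int L)"
    using adic_group_inv[OF n_ge_2 contraction_G[of L k, unfolded contraction_def]]
    by (simp add: contraction_def)
  also have "real n powi int L * (real k / real n ^ L) = real k"
    using n_pos by simp
  finally show ?thesis
    by (simp add: contraction_def adic_group_def diff_divide_distrib)
qed

lemma addr_contraction: "ad (m + l) (act (contraction m j) p) = ad l p + int j * int n ^ l"
  unfolding contraction_def by (rule addr_act) (use n_pos in \<open>simp_all add: power_add\<close>)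

lemma addr_contraction_inv:
  "ad l (act (inv\<^bsub>G\<^esub> (contraction m j)) p) = ad (m + l) p - int j * int n ^ l"
  using addr_contraction[of m l j "act (inv\<^bsub>G\<^esub> (contraction m j)) p"] by simp

lemma act_contraction_inv_mem:
  "act (inv\<^bsub>G\<^esub> (contraction m j)) p \<in> XX \<longleftrightarrow> p \<in> Dbl \<and> ad m p = int j"
  using addr_contraction_inv[of 0 m j p] by (auto simp: mem_X_iff)

lemma act_contraction_mem:
  assumes "p \<in> XX" "j < n ^ m"
  shows "act (contraction m j) p \<in> XX" "ad m (act (contraction m j) p) = int j"
proof -
  show ad: "ad m (act (contraction m j) p) = int j"
    using addr_contraction[of m 0 j p] assms(1) by (simp add: mem_X_iff)
  have "int j < int n ^ m"
    using assms(2) by (metis of_nat_less_iff of_nat_power)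
  then have "ad 0 (act (contraction m j) p) = 0"
    using addr_div[of 0 m "act (contraction m j) p"] ad by simp
  then show "act (contraction m j) p \<in> XX"
    using assms(1) by (simp add: mem_X_iff)
qed

lemma cyl_C: "cyl m j \<in> carrier C"
proof (rule C_I)
  fix e :: real assume "e > 0"
  then show "\<exists>l. \<forall>p\<in>XX. \<forall>q\<in>XX. ad l p = ad l q \<longrightarrow> cmod (cyl m j p - cyl m j q) < e"
    by (intro exI[of _ m]) (simp add: cyl_def)
qed (simp add: cyl_def)

lemma cyl_nonzero: "cyl m j p \<noteq> 0 \<Longrightarrow> p \<in> XX \<and> ad m p = int j"
  by (simp add: cyl_def split: if_splits)

lemma mono_cyl_closed:
  "mono (contraction m j) (cyl m j) \<in> carrier cp"
  by (rule mono_closed[OF contraction_G cyl_C])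
     (use cyl_nonzero X_in_D in \<open>simp add: act_contraction_inv_mem\<close>)

lemma cuntz_generator_closed: "cuntz_generator i \<in> carrier cp"
  unfolding cuntz_generator_def by (rule mono_cyl_closed)

lemma star_mono_contraction:
  assumes "j < n ^ m"
  shows "star cp (mono (contraction m j) (cyl m j)) = mono (inv\<^bsub>G\<^esub> (contraction m j)) (cyl 0 0)"
proof -
  have "(\<lambda>y. if y \<in> XX then cnj (cyl m j (act (contraction m j) y)) else 0) = cyl 0 0"
    using act_contraction_mem[OF _ assms] by (intro ext) (simp add: cyl_def mem_X_iff)
  then show ?thesis
    by (simp add: mono_star[OF mono_cyl_closed contraction_G])
qed

lemma one_cyl: "\<one>\<^bsub>cp\<^esub> = mono \<one>\<^bsub>G\<^esub> (cyl 0 0)"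
  unfolding mono_one cyl_def by (intro arg_cong[where f = "mono _"] ext) (simp add: mem_X_iff)

lemma star_monomial_closed: "j < n ^ m \<Longrightarrow> mono (inv\<^bsub>G\<^esub> (contraction m j)) (cyl 0 0) \<in> carrier cp"
  using cp_star_closed[OF mono_cyl_closed] star_mono_contraction by metis

lemma digit_word_cp:
  assumes S: "\<And>i. i < n \<Longrightarrow> S i = cuntz_generator i"
  shows "j < n ^ m \<Longrightarrow> digit_word cp n S m j = mono (contraction m j) (cyl m j)"
proof (induction m arbitrary: j)
  case 0
  then show ?case
    by (simp add: contraction_zero one_cyl)
next
  case (Suc m)
  let ?j = "j div n" and ?i = "j mod n"
  have j: "?j < n ^ m" "?i < n"
    using Suc.prems n_pos by (simp_all add: less_mult_imp_div_less mult.commute)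
  have ij: "int j = int n * int ?j + int ?i"
    by (metis mult_div_mod_eq of_nat_add of_nat_mult)
  have "digit_word cp n S (Suc m) j
      = mono (contraction m ?j) (cyl m ?j) \<otimes>\<^bsub>cp\<^esub> mono (contraction 1 ?i) (cyl 1 ?i)"
    using Suc.IH[OF j(1)] S[OF j(2)] by (simp add: cuntz_generator_def)
  also have "\<dots> = mono (contraction m ?j \<otimes>\<^bsub>G\<^esub> contraction 1 ?i)
      (\<lambda>y. cyl m ?j y * cyl 1 ?i (act (inv\<^bsub>G\<^esub> (contraction m ?j)) y))"
    by (rule mono_mult[OF mono_cyl_closed mono_cyl_closed contraction_G contraction_G])
  also have "contraction m ?j \<otimes>\<^bsub>G\<^esub> contraction 1 ?i = contraction (Suc m) j"
    by (simp add: contraction_mult)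
  also have "(\<lambda>y. cyl m ?j y * cyl 1 ?i (act (inv\<^bsub>G\<^esub> (contraction m ?j)) y)) = cyl (Suc m) j"
  proof
    fix y
    have up: "ad m y = int ?j" if "ad (Suc m) y = int j"
      using addr_Suc[of m y] that by (simp add: zdiv_int)
    have "ad 1 (act (inv\<^bsub>G\<^esub> (contraction m ?j)) y) = ad (Suc m) y - int ?j * int n"
      using addr_contraction_inv[of 1 m ?j y] by (simp add: Suc_eq_plus1)
    then have "ad 1 (act (inv\<^bsub>G\<^esub> (contraction m ?j)) y) = int ?i \<longleftrightarrow> ad (Suc m) y = int j"
      using ij by (simp only: mult.commute) linarith
    then show "cyl m ?j y * cyl 1 ?i (act (inv\<^bsub>G\<^esub> (contraction m ?j)) y) = cyl (Suc m) j y"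
      using up X_in_D by (auto simp: cyl_def act_contraction_inv_mem)
  qed
  finally show ?case .
qed

text \<open>
  Matrix units with the same right length sit on the same group element exactly if they agree in \<open>m\<close>
  and in \<open>j - k\<close>, and in this case they have disjoint supports unless they are equal.
\<close>

lemma matrix_unit_cp:
  assumes S: "\<And>i. i < n \<Longrightarrow> S i = cuntz_generator i" and jk: "j < n ^ m" "k < n ^ L"
  shows "matrix_unit cp n S L (m, j, k)
    = mono (of_int (int j - int k) / real n ^ m, int m - int L) (cyl m j)"
proof -
  have "matrix_unit cp n S L (m, j, k)
      = mono (contraction m j) (cyl m j) \<otimes>\<^bsub>cp\<^esub> mono (inv\<^bsub>G\<^esub> (contraction L k)) (cyl 0 0)"
    using digit_word_cp[OF S jk(1)] digit_word_cp[OF S jk(2)] star_mono_contraction[OF jk(2)]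
    by (simp add: matrix_unit_def)
  also have "\<dots> = mono (contraction m j \<otimes>\<^bsub>G\<^esub> inv\<^bsub>G\<^esub> (contraction L k))
      (\<lambda>y. cyl m j y * cyl 0 0 (act (inv\<^bsub>G\<^esub> (contraction m j)) y))"
    by (rule mono_mult[OF mono_cyl_closed star_monomial_closed[OF jk(2)]]) auto
  also have "(\<lambda>y. cyl m j y * cyl 0 0 (act (inv\<^bsub>G\<^esub> (contraction m j)) y)) = cyl m j"
    using X_in_D by (intro ext) (simp add: cyl_def act_contraction_inv_mem addr_contraction_inv)
  finally show ?thesis
    by (simp only: contraction_quotient)
qed

lemma cuntz_generator_orth:
  assumes "i < n" "j < n"
  shows "star cp (cuntz_generator i) \<otimes>\<^bsub>cp\<^esub> cuntz_generator j = (if i = j then \<one>\<^bsub>cp\<^esub> else \<zero>\<^bsub>cp\<^esub>)"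
proof -
  have i: "i < n ^ 1"
    using assms by simp
  let ?gi = "contraction 1 i" and ?gj = "contraction 1 j"
  have "star cp (cuntz_generator i) \<otimes>\<^bsub>cp\<^esub> cuntz_generator j
      = mono (inv\<^bsub>G\<^esub> ?gi) (cyl 0 0) \<otimes>\<^bsub>cp\<^esub> mono ?gj (cyl 1 j)"
    unfolding cuntz_generator_def by (simp only: star_mono_contraction[OF i])
  also have "\<dots> = mono (inv\<^bsub>G\<^esub> ?gi \<otimes>\<^bsub>G\<^esub> ?gj) (\<lambda>y. cyl 0 0 y * cyl 1 j (act (inv\<^bsub>G\<^esub> (inv\<^bsub>G\<^esub> ?gi)) y))"
    by (rule mono_mult[OF star_monomial_closed[OF i] mono_cyl_closed]) auto
  also have "(\<lambda>y. cyl 0 0 y * cyl 1 j (act (inv\<^bsub>G\<^esub> (inv\<^bsub>G\<^esub> ?gi)) y))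
      = (\<lambda>y. if i = j then cyl 0 0 y else 0)"
  proof
    fix y
    show "cyl 0 0 y * cyl 1 j (act (inv\<^bsub>G\<^esub> (inv\<^bsub>G\<^esub> ?gi)) y) = (if i = j then cyl 0 0 y else 0)"
      unfolding G.inv_inv[OF contraction_G]
      using act_contraction_mem[of y i 1] i by (auto simp: cyl_def)
  qed
  also have "mono (inv\<^bsub>G\<^esub> ?gi \<otimes>\<^bsub>G\<^esub> ?gj) (\<lambda>y. if i = j then cyl 0 0 y else 0)
      = (if i = j then \<one>\<^bsub>cp\<^esub> else \<zero>\<^bsub>cp\<^esub>)"
    by (cases "i = j") (simp_all add: one_cyl, simp add: mono_def cp_ops fun_eq_iff)
  finally show ?thesis .
qed

lemma cuntz_generator_sum:
  "finsum cp (\<lambda>i. cuntz_generator i \<otimes>\<^bsub>cp\<^esub> star cp (cuntz_generator i)) {..<n} = \<one>\<^bsub>cp\<^esub>"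
proof (intro ext)
  fix g y
  have summand: "cuntz_generator i \<otimes>\<^bsub>cp\<^esub> star cp (cuntz_generator i) = mono \<one>\<^bsub>G\<^esub> (cyl 1 i)" if "i < n" for i
  proof -
    have "i < n ^ 1"
      using that by simp
    from matrix_unit_cp[of cuntz_generator, OF refl this this]
    have "matrix_unit cp n cuntz_generator 1 (1, i, i) = mono \<one>\<^bsub>G\<^esub> (cyl 1 i)"
      by (simp add: adic_group_def)
    moreover have "digit_word cp n cuntz_generator 1 i = cuntz_generator i"
      using digit_word_cp[of cuntz_generator i 1, OF refl] that by (simp add: cuntz_generator_def)
    ultimately show ?thesis
      by (simp add: matrix_unit_def)
  qed
  have "finsum cp (\<lambda>i. cuntz_generator i \<otimes>\<^bsub>cp\<^esub> star cp (cuntz_generator i)) {..<n} g y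
      = (\<Sum>i<n. (cuntz_generator i \<otimes>\<^bsub>cp\<^esub> star cp (cuntz_generator i)) g y)"
    by (rule cp_finsum) (auto intro: cuntz_generator_closed)
  also have "\<dots> = (\<Sum>i<n. mono \<one>\<^bsub>G\<^esub> (cyl 1 i) g y)"
    by (intro sum.cong refl) (simp add: summand)
  also have "\<dots> = \<one>\<^bsub>cp\<^esub> g y"
  proof (cases "y \<in> XX \<and> g = \<one>\<^bsub>G\<^esub>")
    case True
    then have "0 \<le> ad 1 y" "ad 1 y < int n"
      using addr_range[of y 1] by auto
    then have k: "nat (ad 1 y) < n" "ad 1 y = int (nat (ad 1 y))"
      by auto
    have "(\<Sum>i<n. mono \<one>\<^bsub>G\<^esub> (cyl 1 i) g y) = (\<Sum>i<n. if i = nat (ad 1 y) then 1 else 0)"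
      using True k(2) by (intro sum.cong refl) (auto simp: mono_def cyl_def)
    then show ?thesis
      using True k(1) by (simp add: cp_ops)
  next
    case False
    then show ?thesis
      by (auto simp: cp_ops mono_def cyl_def intro!: sum.neutral)
  qed
  finally show "finsum cp (\<lambda>i. cuntz_generator i \<otimes>\<^bsub>cp\<^esub> star cp (cuntz_generator i)) {..<n} g y = \<one>\<^bsub>cp\<^esub> g y" .
qed

text \<open>
  The generators are numbered from \<open>1\<close>, and the cylinders of level \<open>1\<close> from \<open>0\<close>.
\<close>

definition \<phi> :: "nat free_star \<Rightarrow> real \<times> int \<Rightarrow> point \<Rightarrow> complex" where
  "\<phi> = free_hom cp (\<lambda>i. cuntz_generator (i - 1))"

lemma \<phi>_star_hom: "star_hom (free_star_algebra {1..n}) cp \<phi>"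
  unfolding \<phi>_def by (rule cp.free_hom_star_hom) (rule cuntz_generator_closed)

lemma \<phi>_generator: "i < n \<Longrightarrow> \<phi> (generator (Suc i)) = cuntz_generator i"
  unfolding \<phi>_def using cp.free_hom_generator[of "{1..n}" "\<lambda>i. cuntz_generator (i - 1)" "Suc i"]
  by (simp add: cuntz_generator_closed)

lemma \<phi>_cuntz_rep: "cuntz_rep cp n \<phi>"
proof (intro cuntz_rep.intro cuntz_family.intro generators.intro generators_axioms.intro cuntz_family_axioms.intro)
  show "star_hom (free_star_algebra {1..n}) cp \<phi>"
    by (rule \<phi>_star_hom)
  have "finsum cp (\<lambda>i. \<phi> (generator (Suc i)) \<otimes>\<^bsub>cp\<^esub> star cp (\<phi> (generator (Suc i)))) {..<n}
      = finsum cp (\<lambda>i. cuntz_generator i \<otimes>\<^bsub>cp\<^esub> star cp (cuntz_generator i)) {..<n}"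
    by (rule cp.sum_cong) (auto simp: \<phi>_generator cuntz_generator_closed)
  then show "finsum cp (\<lambda>i. \<phi> (generator (Suc i)) \<otimes>\<^bsub>cp\<^esub> star cp (\<phi> (generator (Suc i)))) {..<n} = \<one>\<^bsub>cp\<^esub>"
    by (simp add: cuntz_generator_sum)
qed (auto simp: \<phi>_generator cuntz_generator_closed cuntz_generator_orth n_pos intro: cp_alg)

subsection \<open>Density\<close>

text \<open>
  A continuous function is uniformly close to one that is constant on the cylinders of a fine level
  \<open>m\<close>. For \<open>m\<close> large enough the range of \<open>\<beta>\<^sub>g\<close> is a union of cylinders of level \<open>m\<close>, and the
  indicator of such a cylinder times \<open>U\<^sup>g\<close> is a matrix unit.
\<close>

lemma \<phi>_dense_mono:
  assumes g: "g \<in> carrier G" and f: "f \<in> carrier C" "\<And>y. f y \<noteq> 0 \<Longrightarrow> act (inv\<^bsub>G\<^esub> g) y \<in> XX"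
    and e: "e > 0"
  shows "\<exists>x\<in>carrier (free_star_algebra {1..n}). l1 (\<phi> x \<ominus>\<^bsub>cp\<^esub> mono g f) \<le> e"
proof -
  interpret R: cuntz_rep cp n \<phi>
    by (rule \<phi>_cuntz_rep)
  obtain r k where gr: "g = (r, k)" "r \<in> adic_rationals n"
    using g by (cases g) (auto simp: adic_group_def)
  obtain N where N: "\<And>m. m \<ge> N \<Longrightarrow> \<exists>b :: int. r * real n ^ m = of_int b"
    using adic_integer[OF gr(2)] by blast
  obtain m0 where m0: "\<And>p q. p \<in> Dbl \<Longrightarrow> q \<in> Dbl \<Longrightarrow> ad m0 p = ad m0 q \<Longrightarrow> cmod (f p - f q) < e"
    using C_uniform[OF f(1) e] by blast
  define m where "m = m0 + N + nat k"
  define L where "L = nat (int m - k)"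
  obtain b :: int where b: "r * real n ^ m = of_int b"
    using N[of m] by (auto simp: m_def)
  have L: "int m = k + int L"
    by (simp add: L_def m_def)
  have r: "r = of_int b / real n ^ m"
    using b n_pos by (simp add: field_simps)
  have close: "cmod (f p - f q) < e" if "p \<in> Dbl" "q \<in> Dbl" "ad m p = ad m q" for p q
    using that by (intro m0 addr_coarser[of m0 m]) (auto simp: m_def)
  have addr_inv: "ad L (act (inv\<^bsub>G\<^esub> g) y) = ad m y - b" for y
    using addr_act[OF L b, of "act (inv\<^bsub>G\<^esub> g) y"] g by (simp add: gr(1))
  \<comment> \<open>The cylinders of level \<open>m\<close> that make up the range of \<open>\<beta>\<^sub>g\<close>.\<close>
  define I where "I = {j. j < n ^ m \<and> 0 \<le> int j - b \<and> int j - b < int n ^ L}"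
  \<comment> \<open>The left end of the cylinder \<open>j\<close> of level \<open>m\<close>, where \<open>f\<close> is sampled.\<close>
  define x0 where "x0 j = (real j / real n ^ m, Above)" for j :: nat
  have x0: "x0 j \<in> Dbl" "ad m (x0 j) = int j" for j
    using integer_adic[of "int j" m] n_pos by (simp_all add: x0_def doubled_line_def addr_def)
  define t where "t j = (m, j, nat (int j - b))" for j
  have t: "t j \<in> unit_indices n L" "matrix_unit cp n (\<lambda>i. \<phi> (generator (Suc i))) L (t j) = mono g (cyl m j)"
    if "j \<in> I" for j
  proof -
    have j: "j < n ^ m" "0 \<le> int j - b" "int j - b < int n ^ L"
      using that by (auto simp: I_def)
    then have "nat (int j - b) < n ^ L"
      by (simp add: nat_less_iff)
    with j show "t j \<in> unit_indices n L"
      by (simp add: t_def unit_indices_def)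
    show "matrix_unit cp n (\<lambda>i. \<phi> (generator (Suc i))) L (t j) = mono g (cyl m j)"
      unfolding t_def using matrix_unit_cp[of "\<lambda>i. \<phi> (generator (Suc i))", OF \<phi>_generator j(1) \<open>nat (int j - b) < n ^ L\<close>] j(2) L
      by (simp add: gr(1) r)
  qed
  have "finite I"
    by (rule finite_subset[of _ "{..<n ^ m}"]) (auto simp: I_def)
  define x where "x = finsum R.FF (\<lambda>j. f (x0 j) \<odot>\<^bsub>R.FF\<^esub> R.F.E L (t j)) I"
  have x: "x \<in> carrier R.FF"
    by (auto simp: x_def)
  have mono_cl: "mono g (cyl m j) \<in> carrier cp" if "j \<in> I" for j
    using R.E_closed[of L "t j"] unfolding t(2)[OF that] .
  have "\<phi> x = finsum cp (\<lambda>j. \<phi> (f (x0 j) \<odot>\<^bsub>R.FF\<^esub> R.F.E L (t j))) I"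
    unfolding x_def by (rule R.hom_sum[OF \<open>finite I\<close>]) simp
  also have "\<dots> = finsum cp (\<lambda>j. f (x0 j) \<odot>\<^bsub>cp\<^esub> mono g (cyl m j)) I"
    by (rule cp.sum_cong) (simp_all add: R.hom_smult R.hom_E t(2) mono_cl)
  finally have \<phi>_eq: "\<phi> x = finsum cp (\<lambda>j. f (x0 j) \<odot>\<^bsub>cp\<^esub> mono g (cyl m j)) I" .
  have \<phi>x: "\<phi> x h y = (\<Sum>j\<in>I. f (x0 j) * mono g (cyl m j) h y)" for h y
  proof -
    have "\<phi> x h y = (\<Sum>j\<in>I. (f (x0 j) \<odot>\<^bsub>cp\<^esub> mono g (cyl m j)) h y)"
      unfolding \<phi>_eq by (rule cp_finsum[OF \<open>finite I\<close>]) (rule cp.smult_closed[OF mono_cl])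
    then show ?thesis
      by (simp only: cp_ops(4))
  qed
  have fm: "mono g f \<in> carrier cp"
    by (rule mono_closed[OF g f])
  define d where "d = \<phi> x \<ominus>\<^bsub>cp\<^esub> mono g f"
  have d: "d h y = \<phi> x h y - mono g f h y" for h y
    using x fm R.hom_closed[OF x] by (simp add: d_def cp.minus_eq cp_ops)
  have supp: "supp d \<subseteq> {g}"
    by (auto simp: fun_eq_iff d \<phi>x mono_def)
  have "cmod (d g y) \<le> e" if y: "y \<in> XX" for y
  proof (cases "\<exists>j\<in>I. ad m y = int j")
    case True
    then obtain j where j: "j \<in> I" "ad m y = int j"
      by blast
    have "\<phi> x g y = (\<Sum>i\<in>I. if i = j then f (x0 j) else 0)"
      unfolding \<phi>x using y j(2) by (intro sum.cong) (auto simp: mono_def cyl_def)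
    also have "\<dots> = f (x0 j)"
      using j(1) \<open>finite I\<close> by simp
    finally show ?thesis
      using close[OF x0(1) X_in_D[OF y], of j] x0(2) j(2) by (simp add: d mono_def)
  next
    case False
    then have "\<phi> x g y = 0"
      unfolding \<phi>x by (intro sum.neutral) (auto simp: mono_def cyl_def)
    moreover have "f y = 0"
    proof (rule ccontr)
      assume "f y \<noteq> 0"
      then have "act (inv\<^bsub>G\<^esub> g) y \<in> XX"
        by (rule f(2))
      then have "0 \<le> ad m y - b" "ad m y - b < int n ^ L"
        using addr_range[of "act (inv\<^bsub>G\<^esub> g) y" L] addr_inv by auto
      moreover define i where "i = nat (ad m y)"
      have i: "ad m y = int i"
        using addr_range(1)[OF y, of m] by (simp add: i_def)
      moreover have "i < n ^ m"
      proof -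
        have "int i < int (n ^ m)"
          using addr_range(2)[OF y, of m] by (simp add: i)
        then show ?thesis
          by (simp only: of_nat_less_iff)
      qed
      ultimately have "i \<in> I"
        by (simp add: I_def)
      with i have "\<exists>i\<in>I. ad m y = int i"
        by blast
      then show False
        using False by blast
    qed
    ultimately show ?thesis
      using e by (simp add: d mono_def)
  qed
  then have "supn (d g) \<le> e"
    by (rule supn_least)
  moreover have "l1 d = supn (d g)"
    using l1_superset[OF _ supp] by simp
  ultimately show ?thesis
    using x by (intro bexI[of _ x]) (simp_all add: d_def)
qed

lemma \<phi>_dense:
  assumes a: "a \<in> carrier cp" and e: "e > 0"
  shows "\<exists>x\<in>carrier (free_star_algebra {1..n}). l1 (\<phi> x \<ominus>\<^bsub>cp\<^esub> a) < e"
proof -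
  interpret R: cuntz_rep cp n \<phi>
    by (rule \<phi>_cuntz_rep)
  define K where "K = real (card (supp a)) + 1"
  have K: "K > 0"
    by (simp add: K_def add_nonneg_pos)
  define c where "c = e / (2 * K)"
  have c: "c > 0"
    using e K by (simp add: c_def)
  have "\<exists>x. x \<in> carrier R.FF \<and> l1 (\<phi> x \<ominus>\<^bsub>cp\<^esub> mono g (a g)) \<le> c" if "g \<in> supp a" for g
  proof -
    have "g \<in> carrier G"
      using cpD(6)[OF a] that by blast
    from \<phi>_dense_mono[OF this cpD(1)[OF a] cpD(5)[OF a] c] show ?thesis
      by blast
  qed
  then have "\<forall>g\<in>supp a. \<exists>x. x \<in> carrier R.FF \<and> l1 (\<phi> x \<ominus>\<^bsub>cp\<^esub> mono g (a g)) \<le> c"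
    by (rule ballI)
  then have "\<exists>x. \<forall>g\<in>supp a. x g \<in> carrier R.FF \<and> l1 (\<phi> (x g) \<ominus>\<^bsub>cp\<^esub> mono g (a g)) \<le> c"
    by (rule bchoice)
  then obtain x where x: "\<And>g. g \<in> supp a \<Longrightarrow> x g \<in> carrier R.FF"
    "\<And>g. g \<in> supp a \<Longrightarrow> l1 (\<phi> (x g) \<ominus>\<^bsub>cp\<^esub> mono g (a g)) \<le> c"
    by blast
  have fin: "finite (supp a)"
    by (rule cpD(2)[OF a])
  have "l1 (\<phi> (finsum R.FF x W) \<ominus>\<^bsub>cp\<^esub> finsum cp (\<lambda>g. mono g (a g)) W) \<le> real (card W) * c"
    if "finite W" "W \<subseteq> supp a" for W
    using that
  proof (induction W rule: finite_induct)
    case empty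
    then show ?case
      by (simp add: R.hom_zero cp.ring_rules) (simp add: l1_def cp_ops)
  next
    case (insert g W)
    have g: "g \<in> supp a" "W \<subseteq> supp a"
      using insert.prems by auto
    have cl: "x h \<in> carrier R.FF" "mono h (a h) \<in> carrier cp" if "h \<in> insert g W" for h
      using that insert.prems x(1) mono_coefficient_closed[OF a] by blast+
    have clW: "finsum R.FF x W \<in> carrier R.FF" "finsum cp (\<lambda>g. mono g (a g)) W \<in> carrier cp"
      using cl by auto
    have "\<phi> (finsum R.FF x (insert g W)) = \<phi> (x g) \<oplus>\<^bsub>cp\<^esub> \<phi> (finsum R.FF x W)"
      using insert.hyps cl clW by (subst R.B.sum_insert) (auto simp: R.hom_add)
    moreover have "finsum cp (\<lambda>g. mono g (a g)) (insert g W)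
        = mono g (a g) \<oplus>\<^bsub>cp\<^esub> finsum cp (\<lambda>g. mono g (a g)) W"
      using insert.hyps cl by (intro cp.sum_insert) auto
    ultimately have "\<phi> (finsum R.FF x (insert g W)) \<ominus>\<^bsub>cp\<^esub> finsum cp (\<lambda>g. mono g (a g)) (insert g W)
        = (\<phi> (x g) \<ominus>\<^bsub>cp\<^esub> mono g (a g)) \<oplus>\<^bsub>cp\<^esub> (\<phi> (finsum R.FF x W) \<ominus>\<^bsub>cp\<^esub> finsum cp (\<lambda>g. mono g (a g)) W)"
      using cl clW by (simp add: cp.diff_add)
    then have "l1 (\<phi> (finsum R.FF x (insert g W)) \<ominus>\<^bsub>cp\<^esub> finsum cp (\<lambda>g. mono g (a g)) (insert g W))
        \<le> l1 (\<phi> (x g) \<ominus>\<^bsub>cp\<^esub> mono g (a g)) + l1 (\<phi> (finsum R.FF x W) \<ominus>\<^bsub>cp\<^esub> finsum cp (\<lambda>g. mono g (a g)) W)"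
      using cl clW by (simp add: l1_add)
    also have "\<dots> \<le> c + real (card W) * c"
      using x(2)[OF g(1)] insert.IH[OF g(2)] by (rule add_mono)
    finally show ?case
      using insert.hyps by (simp add: algebra_simps)
  qed
  from this[OF fin order_refl] have "l1 (\<phi> (finsum R.FF x (supp a)) \<ominus>\<^bsub>cp\<^esub> a) \<le> real (card (supp a)) * c"
    using mono_sum[OF a] by simp
  also have "\<dots> \<le> K * c"
    using c by (simp add: K_def distrib_right)
  also have "\<dots> = e / 2"
    using K by (simp add: c_def)
  also have "\<dots> < e"
    using e by simp
  finally show ?thesis
    using x(1) R.B.sum_closed by blast
qed

subsection \<open>Comparison of seminorms\<close>

text \<open>
  The coefficients of a normal form can be read off in the crossed product: at a point of the cylinder
  \<open>j\<close> of level \<open>m\<close>, only one of the matrix units on the given group element does not vanish.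
\<close>

lemma combo_cp_coefficient:
  assumes I: "finite I" "I \<subseteq> unit_indices n L" and t: "(m, j, k) \<in> I"
  shows "cmod (c (m, j, k)) \<le> supn (combo cp n (\<lambda>i. \<phi> (generator (Suc i))) L I c
    (of_int (int j - int k) / real n ^ m, int m - int L))"
proof -
  interpret R: cuntz_rep cp n \<phi>
    by (rule \<phi>_cuntz_rep)
  let ?S = "\<lambda>i. \<phi> (generator (Suc i))"
  let ?g = "(of_int (int j - int k) / real n ^ m, int m - int L)"
  let ?y = "act (contraction m j) (0, Above)"
  have jk: "j < n ^ m" "k < n ^ L"
    using t I(2) by (auto simp: unit_indices_def)
  have y: "?y \<in> XX" "ad m ?y = int j"
    using act_contraction_mem[OF zero_in_X jk(1)] by auto
  have "combo cp n ?S L I c ?g ?y = (\<Sum>s\<in>I. (c s \<odot>\<^bsub>cp\<^esub> matrix_unit cp n ?S L s) ?g ?y)"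
    unfolding combo_def by (rule cp_finsum[OF I(1)]) (rule cp.smult_closed[OF R.E_closed])
  also have "\<dots> = (\<Sum>s\<in>I. c s * matrix_unit cp n ?S L s ?g ?y)"
    by (simp only: cp_ops(4))
  also have "\<dots> = (\<Sum>s\<in>I. if s = (m, j, k) then c (m, j, k) else 0)"
  proof (rule sum.cong[OF refl])
    fix s assume s: "s \<in> I"
    obtain m' j' k' where mjk: "s = (m', j', k')"
      by (cases s) auto
    have jk': "j' < n ^ m'" "k' < n ^ L"
      using s I(2) by (auto simp: unit_indices_def mjk)
    have "matrix_unit cp n ?S L s ?g ?y
        = mono (of_int (int j' - int k') / real n ^ m', int m' - int L) (cyl m' j') ?g ?y"
      unfolding mjk using matrix_unit_cp[of ?S, OF \<phi>_generator jk'] by simp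
    also have "\<dots> = (if s = (m, j, k) then 1 else 0)"
    proof (cases "m' = m \<and> int j' - int k' = int j - int k")
      case True
      then show ?thesis
        using y by (auto simp: mono_def cyl_def mjk)
    next
      case False
      then have "?g \<noteq> (of_int (int j' - int k') / real n ^ m', int m' - int L)"
        using n_pos by auto
      then show ?thesis
        using False by (auto simp: mono_def mjk)
    qed
    finally show "c s * matrix_unit cp n ?S L s ?g ?y = (if s = (m, j, k) then c (m, j, k) else 0)"
      by simp
  qed
  also have "\<dots> = c (m, j, k)"
    using I(1) t by simp
  finally have eq: "c (m, j, k) = combo cp n ?S L I c ?g ?y" ..
  have closed: "combo cp n ?S L I c \<in> carrier cp"
    by (auto simp: combo_def)
  show ?thesis
    unfolding eq by (rule supn_upper[OF cpD(1)[OF closed]])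
qed

text \<open>
  The key estimate. An element of the free algebra is brought to the same normal form in the crossed
  product and in \<open>B\<close>. In \<open>B\<close> each group of matrix units has norm at most the largest modulus of
  its coefficients, and in the crossed product this maximum is bounded by the supremum norm of one
  coefficient function of \<open>\<phi> x\<close>.
\<close>

lemma cuntz_rep_norm_le:
  assumes rep: "cuntz_rep B n \<psi>" and p: "p \<in> cstar_seminorms B"
    and x: "x \<in> carrier (free_star_algebra {1..n})"
  shows "p (\<psi> x) \<le> l1 (\<phi> x)"
proof -
  interpret R: two_cuntz_reps cp B n \<phi> \<psi>
    by (intro two_cuntz_reps.intro \<phi>_cuntz_rep rep)
  interpret P: cuntz_seminormed B n "\<lambda>i. \<psi> (generator (Suc i))" p
    by (intro cuntz_seminormed.intro R.r2.cuntz_family_axioms cstar_seminormed.intro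
        cstar_seminormed_axioms.intro p R.r2.A.star_alg_axioms)
  obtain L I c where I: "finite I" "I \<subseteq> unit_indices n L"
    and eq: "\<phi> x = combo cp n (\<lambda>i. \<phi> (generator (Suc i))) L I c"
      "\<psi> x = combo B n (\<lambda>i. \<psi> (generator (Suc i))) L I c"
    by (rule R.common_normal_form[OF x])
  define key where "key = (\<lambda>(m :: nat, d :: int). (of_int d / real n ^ m, int m - int L))"
  define K where "K r = supn (\<phi> x (key r))" for r
  have \<phi>x: "\<phi> x \<in> carrier cp"
    using x by (rule R.r1.hom_closed)
  let ?R = "(\<lambda>(m, j, k). (m, int j - int k)) ` I"
  have "p (\<psi> x) \<le> (\<Sum>r\<in>?R. K r)"
    unfolding eq(2)
  proof (rule P.combo_norm_le[OF I])
    show "cmod (c (m, j, k)) \<le> K (m, int j - int k)" if "(m, j, k) \<in> I" for m j k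
      using combo_cp_coefficient[OF I that, of c] by (simp add: K_def key_def eq(1))
    show "K r \<ge> 0" for r
      unfolding K_def by (rule supn_nonneg[OF cpD(1)[OF \<phi>x]])
  qed
  also have "\<dots> = (\<Sum>g\<in>key ` ?R. supn (\<phi> x g))"
  proof -
    have "inj_on key ?R"
      using n_pos by (intro inj_onI) (auto simp: key_def)
    then show ?thesis
      by (simp add: sum.reindex K_def)
  qed
  also have "\<dots> \<le> l1 (\<phi> x)"
    using I(1) by (intro l1_ge_sum[OF \<phi>x]) simp
  finally show ?thesis .
qed

end

section \<open>The isomorphism\<close>

context adic
begin

abbreviation "FC \<equiv> free_star_algebra {1..n}"

lemma FC_alg: "star_alg FC"
  by (rule free_alg)

lemma cuntz_relations_iff: "r \<in> cuntz_relations n \<longleftrightarrow>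
    (\<exists>i\<in>{1..n}. r = star FC (generator i) \<otimes>\<^bsub>FC\<^esub> generator i \<ominus>\<^bsub>FC\<^esub> \<one>\<^bsub>FC\<^esub>) \<or>
    r = finsum FC (\<lambda>i. generator i \<otimes>\<^bsub>FC\<^esub> star FC (generator i)) {1..n} \<ominus>\<^bsub>FC\<^esub> \<one>\<^bsub>FC\<^esub>"
  unfolding cuntz_relations_def Let_def Un_iff singleton_iff mem_Collect_eq Bex_def by (simp only: conj_commute)

lemma generator_sum_shift:
  "finsum FC (\<lambda>i. generator i \<otimes>\<^bsub>FC\<^esub> star FC (generator i)) {1..n}
    = finsum FC (\<lambda>i. generator (Suc i) \<otimes>\<^bsub>FC\<^esub> star FC (generator (Suc i))) {..<n}"
proof -
  interpret F: star_alg FC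
    by (rule FC_alg)
  have "bij_betw Suc {..<n} {1..n}"
    by (simp add: bij_betw_def image_Suc_lessThan)
  then show ?thesis
    by (rule F.sum_bij[symmetric]) auto
qed

lemma \<phi>_relations:
  assumes "r \<in> cuntz_relations n"
  shows "\<phi> r = \<zero>\<^bsub>cp\<^esub>"
proof -
  interpret R: cuntz_rep cp n \<phi>
    by (rule \<phi>_cuntz_rep)
  have "(\<exists>i\<in>{1..n}. r = star FC (generator i) \<otimes>\<^bsub>FC\<^esub> generator i \<ominus>\<^bsub>FC\<^esub> \<one>\<^bsub>FC\<^esub>) \<or>
      r = finsum FC (\<lambda>i. generator (Suc i) \<otimes>\<^bsub>FC\<^esub> star FC (generator (Suc i))) {..<n} \<ominus>\<^bsub>FC\<^esub> \<one>\<^bsub>FC\<^esub>"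
    using assms by (simp only: cuntz_relations_iff generator_sum_shift)
  then show ?thesis
  proof (elim disjE bexE)
    fix j assume "j \<in> {1..n}" and r: "r = star FC (generator j) \<otimes>\<^bsub>FC\<^esub> generator j \<ominus>\<^bsub>FC\<^esub> \<one>\<^bsub>FC\<^esub>"
    then have j: "Suc (j - 1) = j" "j - 1 < n" and g: "generator j \<in> carrier FC"
      by auto
    have "star cp (\<phi> (generator j)) \<otimes>\<^bsub>cp\<^esub> \<phi> (generator j) = \<one>\<^bsub>cp\<^esub>"
      using R.S_orth[OF j(2) j(2)] unfolding j(1) by simp
    then show ?thesis
      unfolding r using g by (simp add: R.hom_diff R.hom_mult R.hom_star R.hom_one)
  next
    assume r: "r = finsum FC (\<lambda>i. generator (Suc i) \<otimes>\<^bsub>FC\<^esub> star FC (generator (Suc i))) {..<n} \<ominus>\<^bsub>FC\<^esub> \<one>\<^bsub>FC\<^esub>"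
    have g: "generator (Suc i) \<in> carrier FC" if "i \<in> {..<n}" for i
      using that by auto
    have "\<phi> (finsum FC (\<lambda>i. generator (Suc i) \<otimes>\<^bsub>FC\<^esub> star FC (generator (Suc i))) {..<n})
        = finsum cp (\<lambda>i. \<phi> (generator (Suc i) \<otimes>\<^bsub>FC\<^esub> star FC (generator (Suc i)))) {..<n}"
      using g by (intro R.hom_sum) auto
    also have "\<dots> = finsum cp (\<lambda>i. \<phi> (generator (Suc i)) \<otimes>\<^bsub>cp\<^esub> star cp (\<phi> (generator (Suc i)))) {..<n}"
      using g by (intro cp.sum_cong refl) (auto simp: R.hom_mult R.hom_star intro!: cp.mult_closed cp.star_closed R.hom_closed)
    also have "\<dots> = \<one>\<^bsub>cp\<^esub>"
      by (rule R.S_sum)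
    finally have sum: "\<phi> (finsum FC (\<lambda>i. generator (Suc i) \<otimes>\<^bsub>FC\<^esub> star FC (generator (Suc i))) {..<n}) = \<one>\<^bsub>cp\<^esub>" .
    have "finsum FC (\<lambda>i. generator (Suc i) \<otimes>\<^bsub>FC\<^esub> star FC (generator (Suc i))) {..<n} \<in> carrier FC"
      using g by (intro star_alg.sum_closed[OF FC_alg]) auto
    then show ?thesis
      unfolding r using sum by (simp add: R.hom_diff R.hom_one)
  qed
qed

text \<open>
  In the completion for a C*-seminorm that vanishes on the relations, the relations hold as equations,
  and \<open>ranges_orthogonal\<close> supplies the orthogonality that is missing among them.
\<close>

lemma completion_cuntz_rep:
  assumes q: "q \<in> cstar_seminorms FC" and zero: "\<And>r. r \<in> cuntz_relations n \<Longrightarrow> q r = 0"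
  shows "cuntz_rep (completion FC q) n (\<lambda>x. null_rel FC q `` {\<lambda>_. x})"
proof -
  interpret Q: cstar_seminormed FC q
    by (rule cstar_seminormedI[OF free_star_algebra q])
  let ?\<iota> = "\<lambda>x. Q.cls (\<lambda>_. x)"
  interpret I: star_hom FC Q.cpl ?\<iota>
    by (rule Q.comp_embedding)
  interpret B: cstar_seminormed Q.cpl "cnorm Q.cpl"
    by (rule cstar_seminormedI[OF Q.comp_star_algebra Q.comp_seminorm])
  have eqI: "?\<iota> x = ?\<iota> y" if "x \<in> carrier FC" "y \<in> carrier FC" "q (x \<ominus>\<^bsub>FC\<^esub> y) = 0" for x y
    using that by (intro Q.cls_eqI) (auto intro: Q.cauchy_const)
  let ?S = "\<lambda>i. ?\<iota> (generator (Suc i))"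
  have S: "?S i \<in> carrier Q.cpl" if "i < n" for i
    using that by (intro I.hom_closed) auto
  have isometry: "star Q.cpl (?S i) \<otimes>\<^bsub>Q.cpl\<^esub> ?S i = \<one>\<^bsub>Q.cpl\<^esub>" if i: "i < n" for i
  proof -
    have g: "generator (Suc i) \<in> carrier FC"
      using i by auto
    have "q (star FC (generator (Suc i)) \<otimes>\<^bsub>FC\<^esub> generator (Suc i) \<ominus>\<^bsub>FC\<^esub> \<one>\<^bsub>FC\<^esub>) = 0"
      using i by (intro zero) (auto simp: cuntz_relations_iff)
    then have "?\<iota> (star FC (generator (Suc i)) \<otimes>\<^bsub>FC\<^esub> generator (Suc i)) = ?\<iota> \<one>\<^bsub>FC\<^esub>"
      using g by (intro eqI) auto
    then show ?thesis
      using g I.hom_mult[of "star FC (generator (Suc i))" "generator (Suc i)"] I.hom_star[of "generator (Suc i)"]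
        I.hom_one by simp
  qed
  have sum: "finsum Q.cpl (\<lambda>i. ?S i \<otimes>\<^bsub>Q.cpl\<^esub> star Q.cpl (?S i)) {..<n} = \<one>\<^bsub>Q.cpl\<^esub>"
  proof -
    let ?x = "finsum FC (\<lambda>i. generator (Suc i) \<otimes>\<^bsub>FC\<^esub> star FC (generator (Suc i))) {..<n}"
    have gens: "generator (Suc i) \<in> carrier FC" if "i \<in> {..<n}" for i
      using that by auto
    have "q (?x \<ominus>\<^bsub>FC\<^esub> \<one>\<^bsub>FC\<^esub>) = 0"
      by (intro zero) (simp add: cuntz_relations_iff generator_sum_shift)
    then have "?\<iota> ?x = ?\<iota> \<one>\<^bsub>FC\<^esub>"
      using gens by (intro eqI) auto
    moreover have "?\<iota> ?x = finsum Q.cpl (\<lambda>i. ?\<iota> (generator (Suc i) \<otimes>\<^bsub>FC\<^esub> star FC (generator (Suc i)))) {..<n}"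
      using gens by (intro I.hom_sum) auto
    moreover have "\<dots> = finsum Q.cpl (\<lambda>i. ?S i \<otimes>\<^bsub>Q.cpl\<^esub> star Q.cpl (?S i)) {..<n}"
    proof (rule I.A.sum_cong[OF refl])
      fix i assume i: "i \<in> {..<n}"
      show "?\<iota> (generator (Suc i) \<otimes>\<^bsub>FC\<^esub> star FC (generator (Suc i))) = ?S i \<otimes>\<^bsub>Q.cpl\<^esub> star Q.cpl (?S i)"
        using gens[OF i] I.hom_mult[of "generator (Suc i)" "star FC (generator (Suc i))"]
          I.hom_star[of "generator (Suc i)"] by simp
      show "?S i \<otimes>\<^bsub>Q.cpl\<^esub> star Q.cpl (?S i) \<in> carrier Q.cpl"
        using S i by (intro I.A.mult_closed I.A.star_closed) auto
    qed
    ultimately show ?thesis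
      using I.hom_one by simp
  qed
  have orth: "star Q.cpl (?S i) \<otimes>\<^bsub>Q.cpl\<^esub> ?S j = \<zero>\<^bsub>Q.cpl\<^esub>" if "i < n" "j < n" "i \<noteq> j" for i j
  proof (rule Q.comp_definite)
    show "star Q.cpl (?S i) \<otimes>\<^bsub>Q.cpl\<^esub> ?S j \<in> carrier Q.cpl"
      using S that by (intro I.A.mult_closed I.A.star_closed)
    show "cnorm Q.cpl (star Q.cpl (?S i) \<otimes>\<^bsub>Q.cpl\<^esub> ?S j) = 0"
      by (rule B.ranges_orthogonal[of n ?S]) (use S isometry sum that in auto)
  qed
  show ?thesis
  proof (intro cuntz_rep.intro cuntz_family.intro generators.intro generators_axioms.intro
      cuntz_family_axioms.intro)
    show "star_hom FC Q.cpl ?\<iota>"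
      by (rule Q.comp_embedding)
    show "star_alg Q.cpl"
      by (rule Q.comp_alg)
    show "star Q.cpl (?S i) \<otimes>\<^bsub>Q.cpl\<^esub> ?S j = (if i = j then \<one>\<^bsub>Q.cpl\<^esub> else \<zero>\<^bsub>Q.cpl\<^esub>)" if "i < n" "j < n" for i j
      using isometry orth that by simp
  qed (use S sum n_pos in auto)
qed

lemma cuntz_seminorm_le:
  assumes q: "q \<in> cstar_seminorms FC" "\<And>r. r \<in> cuntz_relations n \<Longrightarrow> q r = 0" and x: "x \<in> carrier FC"
  shows "q x \<le> l1 (\<phi> x)"
proof -
  interpret Q: cstar_seminormed FC q
    by (rule cstar_seminormedI[OF free_star_algebra q(1)])
  have "cnorm Q.cpl (Q.cls (\<lambda>_. x)) \<le> l1 (\<phi> x)"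
    by (rule cuntz_rep_norm_le[OF completion_cuntz_rep[OF q] Q.comp_seminorm x])
  then show ?thesis
    using Q.comp_norm_const[OF x] by simp
qed

lemma cuntz_seminorm_descends:
  assumes q: "q \<in> cstar_seminorms FC" "\<And>r. r \<in> cuntz_relations n \<Longrightarrow> q r = 0"
  shows "\<exists>p\<in>cstar_seminorms cp. \<forall>x\<in>carrier FC. p (\<phi> x) = q x"
proof (rule seminorm_extension[where N = l1])
  show "star_hom FC cp \<phi>"
    by (rule \<phi>_star_hom)
  show "q x \<le> l1 (\<phi> x)" if "x \<in> carrier FC" for x
    by (rule cuntz_seminorm_le) (fact q that)+
qed (fact q(1) l1_nonneg l1_add l1_smult l1_mult l1_star \<phi>_dense)+

text \<open>
  Composition with \<open>\<phi>\<close> takes C*-seminorms of the crossed product to C*-seminorms of the free algebra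
  that vanish on the relations, and every one of the latter arises in this way. So the suprema of the
  two families correspond to each other, and \<open>\<phi>\<close> induces an isomorphism of the completions.
\<close>

lemma crossed_product_isomorphic: "cstar_isomorphic (adic_crossed_product n) (cuntz_algebra n)"
proof -
  define P where "P = {p \<in> cstar_seminorms cp. \<forall>r\<in>{}. p r = 0}"
  define Q where "Q = {q \<in> cstar_seminorms FC. \<forall>r\<in>cuntz_relations n. q r = 0}"
  define pmax where "pmax x = (SUP p\<in>P. p x)" for x
  define qmax where "qmax x = (SUP q\<in>Q. q x)" for x
  have ne: "P \<noteq> {}" "Q \<noteq> {}"
    using cstar_seminorms_zero[of cp] cstar_seminorms_zero[of FC] by (auto simp: P_def Q_def)
  have bdd_P: "bdd_above ((\<lambda>p. p a) ` P)" if "a \<in> carrier cp" for a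
    using seminorm_le_l1 that by (intro bdd_aboveI2[of _ _ "l1 a"]) (auto simp: P_def)
  have bdd_Q: "bdd_above ((\<lambda>q. q x) ` Q)" if "x \<in> carrier FC" for x
    using cuntz_seminorm_le that by (intro bdd_aboveI2[of _ _ "l1 (\<phi> x)"]) (auto simp: Q_def)
  have pmax: "pmax \<in> cstar_seminorms cp"
    unfolding pmax_def using cstar_seminorms_SUP[OF cp_star_algebra _ ne(1) bdd_P] by (auto simp: P_def)
  have qmax: "qmax \<in> cstar_seminorms FC"
    unfolding qmax_def using cstar_seminorms_SUP[OF free_star_algebra _ ne(2) bdd_Q] by (auto simp: Q_def)
  interpret H: star_hom FC cp \<phi>
    by (rule \<phi>_star_hom)
  have "qmax x = pmax (\<phi> x)" if x: "x \<in> carrier FC" for x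
  proof (rule antisym)
    show "qmax x \<le> pmax (\<phi> x)"
      unfolding qmax_def
    proof (rule cSUP_least[OF ne(2)])
      fix q assume "q \<in> Q"
      then have q: "q \<in> cstar_seminorms FC" "\<And>r. r \<in> cuntz_relations n \<Longrightarrow> q r = 0"
        by (simp_all add: Q_def)
      have "\<exists>p\<in>cstar_seminorms cp. \<forall>x\<in>carrier FC. p (\<phi> x) = q x"
        by (rule cuntz_seminorm_descends) (fact q)+
      then obtain p where "p \<in> cstar_seminorms cp" "p (\<phi> x) = q x"
        using x by (elim bexE) (drule (1) bspec)
      then show "q x \<le> pmax (\<phi> x)"
        unfolding pmax_def using cSUP_upper[OF _ bdd_P[OF H.hom_closed[OF x]], of p] by (simp add: P_def)
    qed
    show "pmax (\<phi> x) \<le> qmax x"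
      unfolding pmax_def
    proof (rule cSUP_least[OF ne(1)])
      fix p assume "p \<in> P"
      then have p: "p \<in> cstar_seminorms cp"
        by (simp add: P_def)
      then have "p \<zero>\<^bsub>cp\<^esub> = 0"
        by (rule cstar_seminormed.seminorm_zero[OF cstar_seminormedI[OF cp_star_algebra]])
      then have "(\<lambda>x. p (\<phi> x)) \<in> Q"
        using H.pullback_seminorm[OF p] \<phi>_relations by (simp add: Q_def)
      then show "p (\<phi> x) \<le> qmax x"
        unfolding qmax_def by (rule cSUP_upper[OF _ bdd_Q[OF x]])
    qed
  qed
  moreover have "\<exists>x\<in>carrier FC. pmax (\<phi> x \<ominus>\<^bsub>cp\<^esub> a) < e" if a: "a \<in> carrier cp" and e: "e > 0" for a e
  proof -
    obtain x where x: "x \<in> carrier FC" "l1 (\<phi> x \<ominus>\<^bsub>cp\<^esub> a) < e"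
      using \<phi>_dense[OF a e] by blast
    then have "pmax (\<phi> x \<ominus>\<^bsub>cp\<^esub> a) \<le> l1 (\<phi> x \<ominus>\<^bsub>cp\<^esub> a)"
      using a by (intro seminorm_le_l1[OF pmax] cp.minus_closed H.hom_closed)
    then show ?thesis
      using x by (intro bexI[of _ x]) auto
  qed
  ultimately have "cstar_isomorphic (completion cp pmax) (completion FC qmax)"
    by (intro completion_isomorphic[OF \<phi>_star_hom pmax qmax])
  moreover have "adic_crossed_product n = completion cp pmax"
    unfolding adic_crossed_product_def partial_crossed_product_def enveloping_cstar_def
      universal_cstar_def cp_def P_def pmax_def ..
  moreover have "cuntz_algebra n = completion FC qmax"
    unfolding cuntz_algebra_def universal_cstar_def Q_def qmax_def ..
  ultimately show ?thesis
    by (simp only:)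
qed

end

theorem theorem1:
  fixes n :: nat
  assumes "n \<ge> 2"
  shows "cstar_isomorphic (adic_crossed_product n) (cuntz_algebra n)"
  by (rule adic.crossed_product_isomorphic) (rule adic.intro[OF assms])

end
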